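(* Let $(X_t)_{t\ge0}$ be an $(\mathcal F_t)_{t\ge0}$-adapted right continuous process with values in $\mathbb R^d$. Let $q>1$, $\gamma\in(0,\frac12]$, $\nu$ a Borel probability measure on $\mathbb R^d$ and $e:\mathbb R_+\to\mathbb R_+$ a bounded Borel function such that (i) $\|\mathcal L(X_t\,|\,\mathcal F_s)-\nu\|_{TV}\le\Upsilon_{t,s}\,e(t-s)$ for all $0\le s\le t$; (ii) $\int_0^te(s)\,ds=O(t^{1-2\gamma})$ as $t\to+\infty$; (iii) $C_q:=\sup_{t\ge0}\big(\sup_{0\le s\le t}\mathbb E\,\Upsilon_{t,s}^q+\mathbb E\,|X_t|^q\big)<+\infty$, where, for every $s\ge0$, $(\Upsilon_{t,s}(\omega))_{\omega\in\Omega,\,t\ge s}$ is a $\mathcal Bor([s,+\infty))\otimes\mathcal F_s$-measurable family of non-negative random variables. Then $\int|\xi|^q\nu(d\xi)<+\infty$ and, for every $t_0>0$, Property $\mathbf A_{\beta,q,\gamma}$ (see context) holds with $\beta=\frac12(1-\frac1q)$ and $\pi_t=\frac12(\bar\nu_t+\nu)$, and $\mathsf M_{\pi,q}\le 1\vee\sup_{t\ge0}\mathbb E\,|X_t|^q$. Thus, for every $p\in(0,q)$ and every $t_0>0$ there exists a positive constant $K$ such that, for every $t\ge t_0$, $\mathbb E\,\mathcal W_p^p(\nu_t,\nu)\le K\,\mathsf M_{\pi,q}\,r(t)$ where, with $d_-:=\frac{d+\sqrt{d^2+8d}}4<d_+:=\frac{d+1+\sqrt{(d+1)^2+4d}}2$,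 - if $p<\frac d2(1+\frac1q)$: $r(t)=t^{-\frac{2\gamma pq}{(q+1)d}}$ when $p<\frac{dq}{d+q}$, and $r(t)=t^{-\frac{2\gamma(q-p)}{q+1}}$ when $\frac{dq}{d+q}<p<q$; - if $p=\frac d2(1+\frac1q)$: $r(t)=t^{-\frac{2\gamma(q-p)}{q+1}}$ when $d_-<q<d_+$, and $r(t)=t^{-\gamma}\log(1+t)$ when $q>d_+$; - if $p>\frac d2(1+\frac1q)$: $r(t)=t^{-\gamma}$ when $p<\frac{q-1}2$, and $r(t)=t^{-\frac{2\gamma(q-p)}{q+1}}$ when $\frac{q-1}2<p<q$. In particular, if $C_q<+\infty$ for every $q>0$, then for every $p>0$, $\varepsilon>0$ and $t_0>0$ there exists a finite positive constant $\bar K$ such that for every $t\ge t_0$ $$\|\mathcal W_p(\nu_t,\nu)\|_p\le\bar K\times\begin{cases}t^{-\frac{2\gamma}d(1-\varepsilon)}&\text{if }p\le\frac d2,\\ t^{-\frac\gamma p}&\text{if }p>\frac d2.\end{cases}$$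
   Context: All processes live on a stochastic basis $(\Omega,\mathcal A,(\mathcal F_t)_{t\ge0},\mathbb P)$ satisfying the usual conditions. The occupation measure is $\nu_t(\omega,d\xi)=\frac1t\int_0^t\delta_{X_s(\omega)}(d\xi)\,ds$, $t>0$, and the mean occupation measure is $\bar\nu_t(f)=\mathbb E\,\nu_t(f)=\frac1t\int_0^t\mathbb E f(X_s)\,ds$. $\mathcal L(X_t|\mathcal F_s)$ is the regular conditional distribution; $\|\mu-\mu'\|_{TV}=\sup\{|\mu(f)-\mu'(f)|: f$ Borel, $|f|\le1\}$. $|\cdot|$ is the Euclidean norm, $M_\mu(q)=\int|\xi|^q\mu(d\xi)$; for $p>0$, $\mathcal W_p(\mu,\nu)=\inf_\varpi(\int|x-y|^p\varpi(dx,dy))^{1/p}$ over couplings $\varpi$ of $\mu$ and $\nu$; $\|Z\|_p=(\mathbb E|Z|^p)^{1/p}$; $a\vee b=\max(a,b)$. Property $\mathbf A_{\beta,q,\gamma}$ (for a given $t_0>0$ and a family $(\pi_t)_{t\ge t_0}$ of probability measures): there is a constant $C_0\in(0,\infty)$ with $\mathbb E|\nu_t(A)-\nu(A)|\le C_0\min\big(\pi_t(A),\pi_t(A)^\beta t^{-\gamma}\big)$ for every $t\ge t_0$ and every Borel $A$, and $\mathsf M_{\pi,q}:=1\vee\sup_{t\ge t_0}M_{\pi_t}(q)<+\infty$. *)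

theory Defs
  imports "HOL-Probability.Probability" "HOL-Library.Landau_Symbols"
begin

text \<open>Time is \<open>[0, \<infinity>)\<close>, encoded by nonnegative reals; the values of \<open>F\<close> (and later of \<open>X\<close>)
  at negative times are irrelevant. \<open>null_F0\<close> states at once that the probability space is
  complete and that \<open>F 0\<close> contains all negligible sets.\<close>

locale stochastic_basis = prob_space M
  for M :: "'w measure" and F :: "real \<Rightarrow> 'w measure" +
  assumes subalg_F: "\<And>t. 0 \<le> t \<Longrightarrow> subalgebra M (F t)"
    and mono_F: "\<And>s t. 0 \<le> s \<Longrightarrow> s \<le> t \<Longrightarrow> sets (F s) \<subseteq> sets (F t)"
    and right_cont_F: "\<And>t. 0 \<le> t \<Longrightarrow> sets (F t) = (\<Inter>u\<in>{t<..}. sets (F u))"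
    and null_F0: "\<And>N A. N \<in> null_sets M \<Longrightarrow> A \<subseteq> N \<Longrightarrow> A \<in> sets (F 0)"

definition adapted_right_cont ::
  "'w measure \<Rightarrow> (real \<Rightarrow> 'w measure) \<Rightarrow> (real \<Rightarrow> 'w \<Rightarrow> 'a::euclidean_space) \<Rightarrow> bool" where
  "adapted_right_cont M F X \<longleftrightarrow>
     (\<forall>t\<ge>0. X t \<in> borel_measurable (F t)) \<and>
     (\<forall>\<omega>\<in>space M. \<forall>t\<ge>0. continuous (at_right t) (\<lambda>s. X s \<omega>))"

definition regular_cond_distr ::
  "'w measure \<Rightarrow> 'w measure \<Rightarrow> ('w \<Rightarrow> 'a::euclidean_space) \<Rightarrow> ('w \<Rightarrow> 'a measure) \<Rightarrow> bool" where
  "regular_cond_distr M G Y \<kappa> \<longleftrightarrow>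
     \<kappa> \<in> G \<rightarrow>\<^sub>M prob_algebra borel \<and>
     (\<forall>B\<in>sets borel. AE \<omega> in M.
        measure (\<kappa> \<omega>) B = real_cond_exp M G (\<lambda>\<omega>'. indicator B (Y \<omega>')) \<omega>)"

text \<open>The total variation norm is not halved: test functions range over \<open>[-1, 1]\<close>.\<close>

definition tv_dist :: "'a::euclidean_space measure \<Rightarrow> 'a measure \<Rightarrow> real" where
  "tv_dist \<mu> \<mu>' =
     (SUP f \<in> {f \<in> borel_measurable borel. \<forall>x. \<bar>f x\<bar> \<le> 1}.
        \<bar>(\<integral>x. f x \<partial>\<mu>) - (\<integral>x. f x \<partial>\<mu>')\<bar>)"

text \<open>Real powers on \<open>[0, \<infinity>]\<close>; only used for exponents \<open>a > 0\<close>, where \<open>\<infinity>\<close> is mapped to \<open>\<infinity>\<close>.\<close>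

definition ennreal_powr :: "ennreal \<Rightarrow> real \<Rightarrow> ennreal" where
  "ennreal_powr x a = (if x = \<top> then \<top> else ennreal (enn2real x powr a))"

definition Lp_norm :: "'w measure \<Rightarrow> real \<Rightarrow> ('w \<Rightarrow> ennreal) \<Rightarrow> ennreal" where
  "Lp_norm M p Z = ennreal_powr (\<integral>\<^sup>+\<omega>. ennreal_powr (Z \<omega>) p \<partial>M) (1 / p)"

definition abs_moment :: "'a::euclidean_space measure \<Rightarrow> real \<Rightarrow> ennreal" where
  "abs_moment \<mu> q = (\<integral>\<^sup>+\<xi>. ennreal (norm \<xi> powr q) \<partial>\<mu>)"

definition couplings ::
  "'a::euclidean_space measure \<Rightarrow> 'a measure \<Rightarrow> ('a \<times> 'a) measure set" where
  "couplings \<mu> \<nu> =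
     {\<rho>. sets \<rho> = sets (borel \<Otimes>\<^sub>M borel) \<and> distr \<rho> borel fst = \<mu> \<and> distr \<rho> borel snd = \<nu>}"

definition wasserstein :: "real \<Rightarrow> 'a::euclidean_space measure \<Rightarrow> 'a measure \<Rightarrow> ennreal" where
  "wasserstein p \<mu> \<nu> =
     (INF \<rho> \<in> couplings \<mu> \<nu>.
        ennreal_powr (\<integral>\<^sup>+z. ennreal (norm (fst z - snd z) powr p) \<partial>\<rho>) (1 / p))"

definition occ_measure :: "(real \<Rightarrow> 'w \<Rightarrow> 'a::euclidean_space) \<Rightarrow> real \<Rightarrow> 'w \<Rightarrow> 'a measure" where
  "occ_measure X t \<omega> =
     scale_measure (ennreal (1 / t)) (distr (restrict_space lborel {0..t}) borel (\<lambda>s. X s \<omega>))"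

text \<open>The Giry bind is the average of the random measure \<open>occ_measure X t\<close> under \<open>M\<close>.\<close>

definition mean_occ_measure ::
  "'w measure \<Rightarrow> (real \<Rightarrow> 'w \<Rightarrow> 'a::euclidean_space) \<Rightarrow> real \<Rightarrow> 'a measure" where
  "mean_occ_measure M X t = M \<bind> occ_measure X t"

definition half_sum :: "'a::euclidean_space measure \<Rightarrow> 'a measure \<Rightarrow> 'a measure" where
  "half_sum \<mu> \<nu> = measure_of UNIV (sets borel) (\<lambda>A. (emeasure \<mu> A + emeasure \<nu> A) / 2)"

definition sup_moment :: "(real \<Rightarrow> 'a::euclidean_space measure) \<Rightarrow> real \<Rightarrow> real \<Rightarrow> ennreal" where
  "sup_moment \<pi> t0 q = max 1 (SUP t\<in>{t0..}. abs_moment (\<pi> t) q)"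

text \<open>\<open>N t \<omega>\<close> is the random measure approximating \<open>\<nu>\<close> at time \<open>t\<close>.\<close>

definition property_A ::
  "'w measure \<Rightarrow> (real \<Rightarrow> 'w \<Rightarrow> 'a::euclidean_space measure) \<Rightarrow> 'a measure \<Rightarrow>
   (real \<Rightarrow> 'a measure) \<Rightarrow> real \<Rightarrow> real \<Rightarrow> real \<Rightarrow> real \<Rightarrow> bool" where
  "property_A M N \<nu> \<pi> t0 \<beta> q \<gamma> \<longleftrightarrow>
     (\<forall>t\<ge>t0. prob_space (\<pi> t) \<and> sets (\<pi> t) = sets borel) \<and>
     (\<exists>C0>0. \<forall>t\<ge>t0. \<forall>A\<in>sets borel.
        (\<integral>\<^sup>+\<omega>. ennreal \<bar>measure (N t \<omega>) A - measure \<nu> A\<bar> \<partial>M)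
          \<le> ennreal (C0 * min (measure (\<pi> t) A) (measure (\<pi> t) A powr \<beta> * t powr (-\<gamma>)))) \<and>
     sup_moment \<pi> t0 q < \<top>"

definition C_const ::
  "'w measure \<Rightarrow> (real \<Rightarrow> 'w \<Rightarrow> 'a::euclidean_space) \<Rightarrow> (real \<Rightarrow> real \<Rightarrow> 'w \<Rightarrow> real) \<Rightarrow> real \<Rightarrow> ennreal"
  where
  "C_const M X \<Upsilon> q =
     (SUP t\<in>{0..}. (SUP s\<in>{0..t}. \<integral>\<^sup>+\<omega>. ennreal (\<Upsilon> t s \<omega> powr q) \<partial>M)
                   + (\<integral>\<^sup>+\<omega>. ennreal (norm (X t \<omega>) powr q) \<partial>M))"

definition d_minus :: "real \<Rightarrow> real" where
  "d_minus d = (d + sqrt (d\<^sup>2 + 8 * d)) / 4"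

definition d_plus :: "real \<Rightarrow> real" where
  "d_plus d = (d + 1 + sqrt ((d + 1)\<^sup>2 + 4 * d)) / 2"

definition wasserstein_rate ::
  "'w measure \<Rightarrow> (real \<Rightarrow> 'w \<Rightarrow> 'a::euclidean_space measure) \<Rightarrow> 'a measure \<Rightarrow>
   (real \<Rightarrow> 'a measure) \<Rightarrow> real \<Rightarrow> real \<Rightarrow> real \<Rightarrow> (real \<Rightarrow> real) \<Rightarrow> bool" where
  "wasserstein_rate M N \<nu> \<pi> q p t0 r \<longleftrightarrow>
     (\<exists>K>0. \<forall>t\<ge>t0.
        (\<integral>\<^sup>+\<omega>. ennreal_powr (wasserstein p (N t \<omega>) \<nu>) p \<partial>M)
          \<le> ennreal K * sup_moment \<pi> t0 q * ennreal (r t))"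

end

theory Submission
  imports Defs
begin

text \<open>The proof separates probability from geometry.  They meet in the bound of \<open>property_A\<close> on the mean
  deviation of \<open>\<nu>\<^sub>t(A)\<close> from \<open>\<nu>(A)\<close>.

  Probability.  Put \<open>Y\<^sub>s = 1\<^sub>A(X\<^sub>s) - \<nu>(A)\<close>.  Conditioning on \<open>F s\<close> and the mixing hypothesis give
  \<open>\<bar>E(Y\<^sub>s Y\<^sub>u)\<bar> \<le> e(u - s) E(\<bar>Y\<^sub>s\<bar> \<Upsilon>)\<close> for \<open>s \<le> u\<close>.  Since \<open>\<bar>Y\<^sub>s\<bar> \<le> 1\<close>, the pointwise inequality
  \<open>\<bar>y\<bar> v \<le> \<lambda> \<bar>y\<bar> + \<lambda>\<^bsup>1-q\<^esup> v\<^bsup>q\<^esup>\<close> bounds the expectation (\<open>covariance_le\<close>).  One value of \<open>\<lambda>\<close>, namely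
  \<open>(2 \<pi>\<^sub>t(A))\<^bsup>-1/q\<^esup>\<close>, serves all times at once, so averaging over \<open>[0,t]\<^sup>2\<close> yields
  \<open>E(\<nu>\<^sub>t(A) - \<nu>(A))\<^sup>2 = O(t\<^bsup>-2\<gamma>\<^esup> \<pi>\<^sub>t(A)\<^bsup>1-1/q\<^esup>)\<close> (\<open>second_moment_le\<close>,
  \<open>property_A_occ_measure\<close>).  The moment of \<open>\<nu>\<close> is finite because \<open>e\<close> takes arbitrarily small values,
  so that \<open>\<nu>\<close> is a limit in total variation of laws of \<open>X\<^sub>t\<close> (\<open>moment_\<nu>_le\<close>).

  Geometry.  Cut space into the unit ball and the shells \<open>2\<^bsup>n-1\<^esup> < \<bar>x\<bar> \<le> 2\<^sup>n\<close>, and each shell into cubes of side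
  \<open>2\<^bsup>n-l\<^esup>\<close>.  Two probability measures are coupled greedily from the finest cubes to the coarsest:
  in each cell the largest possible equal amounts of mass are matched.  The mass left over in a cell
  is then exactly the excess of one measure over the other there (\<open>match_cells\<close>), so that the mass
  transported at scale \<open>l\<close> is controlled by the differences of the two measures on the cells of
  scale \<open>l + 1\<close> (\<open>tree_coupling\<close>).  With cost \<open>\<bar>x - y\<bar>\<^sup>p\<close> this gives
  \<open>W\<^sub>p\<^sup>p(\<mu>,\<nu>) \<le> c \<Sum>\<^sub>l \<Sum>\<^sub>n 2\<^bsup>p(n-l)\<^esup> \<Sum>\<^sub>F \<bar>\<mu>(F) - \<nu>(F)\<bar>\<close> over the cells \<open>F\<close> of shell \<open>n\<close> and
  scale \<open>l\<close> (\<open>wasserstein_dyadic_bound\<close>).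

  Taking expectations, the bound of \<open>property_A\<close> applies to every cell.  Concavity of \<open>x\<^sup>\<beta>\<close> over the
  \<open>O(2\<^bsup>dl\<^esup>)\<close> cells of a shell and the tail \<open>\<pi>\<^sub>t(shell n) = O(2\<^bsup>-qn\<^esup>)\<close> reduce everything to a
  double series in \<open>n\<close>, \<open>l\<close> and \<open>\<epsilon> = t\<^bsup>-\<gamma>\<^esup>\<close> (\<open>expected_wasserstein_le_dyadic_sum\<close>).  Its terms are
  minima of a decreasing and an increasing geometric sequence, and the cases of the theorem are the
  possible signs of the exponents (\<open>dyadic_sum_le_fast\<close>, \<open>dyadic_sum_le_slow\<close>,
  \<open>dyadic_sum_critical_le\<close>).  The last assertion takes \<open>q\<close> large in these rates.\<close>

section \<open>Sums of measures and half sums\<close>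

definition add_measure :: "'b measure \<Rightarrow> 'b measure \<Rightarrow> 'b measure" where
  "add_measure \<mu> \<nu> = measure_of (space \<mu>) (sets \<mu>) (\<lambda>A. emeasure \<mu> A + emeasure \<nu> A)"

lemma sets_add_measure [simp, measurable_cong]: "sets (add_measure \<mu> \<nu>) = sets \<mu>"
  by (simp add: add_measure_def)

lemma space_add_measure [simp]: "space (add_measure \<mu> \<nu>) = space \<mu>"
  by (simp add: add_measure_def)

lemma emeasure_add_measure:
  assumes "sets \<nu> = sets \<mu>" "A \<in> sets \<mu>"
  shows "emeasure (add_measure \<mu> \<nu>) A = emeasure \<mu> A + emeasure \<nu> A"
proof (rule emeasure_measure_of[OF add_measure_def])
  show "sets \<mu> \<subseteq> Pow (space \<mu>)"
    by (rule sets.space_closed)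
  show "positive (sets (add_measure \<mu> \<nu>)) (\<lambda>A. emeasure \<mu> A + emeasure \<nu> A)"
    by (simp add: positive_def)
  show "countably_additive (sets (add_measure \<mu> \<nu>)) (\<lambda>A. emeasure \<mu> A + emeasure \<nu> A)"
  proof (rule countably_additiveI)
    fix A :: "nat \<Rightarrow> _" assume A: "range A \<subseteq> sets (add_measure \<mu> \<nu>)" "disjoint_family A"
    then show "(\<Sum>i. emeasure \<mu> (A i) + emeasure \<nu> (A i)) = emeasure \<mu> (\<Union>i. A i) + emeasure \<nu> (\<Union>i. A i)"
      using assms(1) by (subst suminf_add[symmetric]) (auto simp: suminf_emeasure)
  qed
qed (use assms in auto)

lemma nn_integral_add_measure:
  assumes s: "sets \<nu> = sets \<mu>" and f: "f \<in> borel_measurable \<mu>"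
  shows "(\<integral>\<^sup>+x. f x \<partial>add_measure \<mu> \<nu>) = (\<integral>\<^sup>+x. f x \<partial>\<mu>) + (\<integral>\<^sup>+x. f x \<partial>\<nu>)"
  using f
proof (induction rule: borel_measurable_induct)
  case (cong f g)
  moreover have "space \<nu> = space \<mu>" using s by (rule sets_eq_imp_space_eq)
  ultimately show ?case by (simp cong: nn_integral_cong_simp)
next
  case (set A)
  then show ?case by (simp add: s emeasure_add_measure)
next
  case (mult u c)
  moreover have "u \<in> borel_measurable \<nu>" "u \<in> borel_measurable (add_measure \<mu> \<nu>)"
    using mult(2) by (simp_all add: measurable_cong_sets[OF s refl] measurable_cong_sets[OF sets_add_measure refl])
  ultimately show ?case
    by (simp add: nn_integral_cmult distrib_left)
next
  case (add u v)
  moreover have "u \<in> borel_measurable \<nu>" "u \<in> borel_measurable (add_measure \<mu> \<nu>)"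
     "v \<in> borel_measurable \<nu>" "v \<in> borel_measurable (add_measure \<mu> \<nu>)"
    using add(1,3) by (simp_all add: measurable_cong_sets[OF s refl] measurable_cong_sets[OF sets_add_measure refl])
  ultimately show ?case
    by (simp add: nn_integral_add ac_simps)
next
  case (seq U)
  have m: "U i \<in> borel_measurable \<nu>" "U i \<in> borel_measurable (add_measure \<mu> \<nu>)" for i
    using seq(1)[of i] by (simp_all add: measurable_cong_sets[OF s refl] measurable_cong_sets[OF sets_add_measure refl])
  have "(\<integral>\<^sup>+x. (SUP i. U i x) \<partial>add_measure \<mu> \<nu>) = (SUP i. \<integral>\<^sup>+x. U i x \<partial>add_measure \<mu> \<nu>)"
    by (rule nn_integral_monotone_convergence_SUP) (use seq m in auto)
  also have "\<dots> = (SUP i. (\<integral>\<^sup>+x. U i x \<partial>\<mu>) + (\<integral>\<^sup>+x. U i x \<partial>\<nu>))"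
    using seq.IH by simp
  also have "\<dots> = (SUP i. \<integral>\<^sup>+x. U i x \<partial>\<mu>) + (SUP i. \<integral>\<^sup>+x. U i x \<partial>\<nu>)"
    by (rule ennreal_SUP_add) (auto intro!: monoI nn_integral_mono le_funD[OF incseqD[OF \<open>incseq U\<close>]])
  also have "\<dots> = (\<integral>\<^sup>+x. (SUP i. U i x) \<partial>\<mu>) + (\<integral>\<^sup>+x. (SUP i. U i x) \<partial>\<nu>)"
    using seq m by (subst (1 2) nn_integral_monotone_convergence_SUP) auto
  finally show ?case by (simp add: image_comp SUP_apply)
qed

lemma sets_half_sum [simp, measurable_cong]: "sets (half_sum \<mu> \<nu>) = sets borel"
  using sets.sigma_sets_eq[of borel] by (simp add: half_sum_def)

text \<open>Expressing the half sum through \<open>add_measure\<close> makes the integration rules for scaled and added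
  measures available for it.\<close>

lemma half_sum_eq:
  fixes \<mu> \<nu> :: "'a::euclidean_space measure"
  assumes "sets \<mu> = sets borel" "sets \<nu> = sets borel"
  shows "half_sum \<mu> \<nu> = scale_measure (1/2) (add_measure \<mu> \<nu>)"
proof (rule measure_eqI)
  show "sets (half_sum \<mu> \<nu>) = sets (scale_measure (1 / 2) (add_measure \<mu> \<nu>))"
    using assms by simp
  fix A assume "A \<in> sets (half_sum \<mu> \<nu>)"
  then have A: "A \<in> sets borel" by simp
  have e: "(emeasure \<mu> B + emeasure \<nu> B) / 2 = emeasure (scale_measure (1/2) (add_measure \<mu> \<nu>)) B"
    if "B \<in> sets borel" for B
    using that assms by (simp add: emeasure_add_measure ennreal_times_divide ac_simps divide_ennreal_def)
  show "emeasure (half_sum \<mu> \<nu>) A = emeasure (scale_measure (1/2) (add_measure \<mu> \<nu>)) A"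
    unfolding e[OF A, symmetric]
  proof (rule emeasure_measure_of[OF half_sum_def])
    show "positive (sets (half_sum \<mu> \<nu>)) (\<lambda>A. (emeasure \<mu> A + emeasure \<nu> A) / 2)"
      by (simp add: positive_def)
    show "countably_additive (sets (half_sum \<mu> \<nu>)) (\<lambda>A. (emeasure \<mu> A + emeasure \<nu> A) / 2)"
    proof (rule countably_additiveI)
      fix B :: "nat \<Rightarrow> _" assume B: "range B \<subseteq> sets (half_sum \<mu> \<nu>)" "disjoint_family B" "\<Union> (range B) \<in> sets (half_sum \<mu> \<nu>)"
      have *: "range B \<subseteq> sets borel" "\<And>i. B i \<in> sets borel" using B by auto
      show "(\<Sum>i. (emeasure \<mu> (B i) + emeasure \<nu> (B i)) / 2) = (emeasure \<mu> (\<Union>i. B i) + emeasure \<nu> (\<Union>i. B i)) / 2"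
        using B * assms by (subst (1 2) e) (auto simp: suminf_emeasure)
    qed
  qed (use A in auto)
qed

section \<open>Matching the masses of two measures cell by cell\<close>

text \<open>\<open>\<rho>\<close> transports a part of \<open>\<mu>\<close> to a part of \<open>\<nu>\<close>; the residuals \<open>\<mu>'\<close> and \<open>\<nu>'\<close> are what remains to be
  transported.\<close>

definition partial_coupling ::
  "('a \<times> 'a) measure \<Rightarrow> 'a measure \<Rightarrow> 'a measure \<Rightarrow> 'a measure \<Rightarrow> 'a::euclidean_space measure \<Rightarrow> bool" where
  "partial_coupling \<rho> \<mu>' \<nu>' \<mu> \<nu> \<longleftrightarrow>
     sets \<rho> = sets (borel \<Otimes>\<^sub>M borel) \<and> sets \<mu>' = sets borel \<and> sets \<nu>' = sets borel \<and>
     (\<forall>A\<in>sets borel. emeasure (distr \<rho> borel fst) A + emeasure \<mu>' A = emeasure \<mu> A) \<and>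
     (\<forall>A\<in>sets borel. emeasure (distr \<rho> borel snd) A + emeasure \<nu>' A = emeasure \<nu> A)"

text \<open>In a cell of masses \<open>a\<close> and \<open>b\<close>, the product of the two restrictions divided by \<open>max a b\<close> has total
  mass \<open>min a b\<close> and marginals proportional to the restrictions.  Hence one of the two residuals
  vanishes on the cell and the other one has the truncated difference as its mass.  The cells are the
  fibres of a countable labelling.\<close>

lemma match_cells:
  fixes \<mu> \<nu> :: "'a::euclidean_space measure" and lab :: "'a \<Rightarrow> 'i::countable"
  assumes fin: "finite_measure \<mu>" "finite_measure \<nu>"
    and sets: "sets \<mu> = sets borel" "sets \<nu> = sets borel"
    and lab [measurable]: "lab \<in> borel \<rightarrow>\<^sub>M count_space UNIV"
  obtains \<rho> \<mu>' \<nu>' where "partial_coupling \<rho> \<mu>' \<nu>' \<mu> \<nu>"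
    "AE z in \<rho>. lab (fst z) = lab (snd z)"
    "\<forall>i. emeasure \<mu>' (lab -` {i}) = emeasure \<mu> (lab -` {i}) - emeasure \<nu> (lab -` {i})"
    "\<forall>i. emeasure \<nu>' (lab -` {i}) = emeasure \<nu> (lab -` {i}) - emeasure \<mu> (lab -` {i})"
proof -
  interpret \<mu>: finite_measure \<mu> by fact
  interpret \<nu>: finite_measure \<nu> by fact
  interpret P: pair_sigma_finite \<mu> \<nu> ..
  note [measurable_cong] = sets
  have sp: "space \<mu> = UNIV" "space \<nu> = UNIV"
    using sets by (auto dest: sets_eq_imp_space_eq)
  define a where "a = (\<lambda>i. emeasure \<mu> (lab -` {i}))"
  define b where "b = (\<lambda>i. emeasure \<nu> (lab -` {i}))"
  define m where "m = (\<lambda>i. max (a i) (b i))"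
  define r where "r = (\<lambda>(x, y). if lab x = lab y then 1 / m (lab x) else 0)"
  have cell [measurable]: "lab -` {i} \<in> sets borel" for i
    using measurable_sets[OF lab, of "{i}"] by simp
  have fa: "a i < \<top>" "b i < \<top>" for i
    by (simp_all add: a_def b_def \<mu>.emeasure_finite \<nu>.emeasure_finite less_top[symmetric])
  have r_meas [measurable]: "r \<in> borel_measurable (borel \<Otimes>\<^sub>M borel)"
  proof -
    have "(\<lambda>z. (lab (fst z), lab (snd z))) \<in> borel \<Otimes>\<^sub>M borel \<rightarrow>\<^sub>M count_space UNIV \<Otimes>\<^sub>M count_space UNIV"
      by measurable
    moreover have "(\<lambda>(i, j). if i = j then 1 / m i else 0) \<in> borel_measurable (count_space UNIV \<Otimes>\<^sub>M count_space UNIV)"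
      by (simp add: pair_measure_countable)
    ultimately have "(\<lambda>z. (\<lambda>(i, j). if i = j then 1 / m i else 0) (lab (fst z), lab (snd z))) \<in> borel_measurable (borel \<Otimes>\<^sub>M borel)"
      by (rule measurable_compose)
    then show ?thesis by (simp add: r_def case_prod_beta)
  qed
  define wx where "wx = (\<lambda>i. b i * (1 / m i))"
  define wy where "wy = (\<lambda>i. a i * (1 / m i))"
  have wx1: "wx i \<le> 1" and wy1: "wy i \<le> 1" for i
  proof -
    have m: "m i < \<top>" using fa by (simp add: m_def)
    have *: "m i * (1 / m i) \<le> 1"
    proof (cases "m i = 0")
      case False
      then show ?thesis using m by (simp add: ennreal_times_divide ennreal_divide_self)
    qed simp
    have "wx i \<le> m i * (1 / m i)" "wy i \<le> m i * (1 / m i)"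
      unfolding wx_def wy_def by (auto intro!: mult_right_mono simp: m_def)
    then show "wx i \<le> 1" "wy i \<le> 1" using * by (auto intro: order_trans)
  qed
  have cx: "(1 - wx i) * a i = a i - b i" and cy: "(1 - wy i) * b i = b i - a i" for i
  proof -
    have *: "(1 - u * (1 / max v u)) * v = v - u" if "u < \<top>" "v < \<top>" for u v :: ennreal
    proof (cases "u \<le> v")
      case le: True
      show ?thesis
      proof (cases "v = 0")
        case False
        from that obtain x y where xy: "u = ennreal x" "0 \<le> x" "v = ennreal y" "0 \<le> y"
          by (metis ennreal_cases less_irrefl)
        with False have "0 < y" by auto
        then have "(1 - u * (1 / v)) * v = v - u"
          using xy le by (simp add: divide_ennreal ennreal_minus ennreal_mult'[symmetric] algebra_simps
              flip: ennreal_1 ennreal_mult')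
        then show ?thesis using le by (simp add: max_absorb1)
      qed simp
    next
      case False
      then have "max v u = u" "u \<noteq> 0" by auto
      then have "u * (1 / max v u) = 1"
        using that by (simp add: ennreal_times_divide ennreal_divide_self)
      then show ?thesis using False that by (simp add: diff_eq_0_iff_ennreal)
    qed
    show "(1 - wx i) * a i = a i - b i"
      using *[OF fa(2,1)] by (simp add: wx_def m_def)
    show "(1 - wy i) * b i = b i - a i"
      using *[OF fa(1,2)] by (simp add: wy_def m_def max.commute)
  qed
  define \<rho> where "\<rho> = density (\<mu> \<Otimes>\<^sub>M \<nu>) r"
  define \<mu>' where "\<mu>' = density \<mu> (\<lambda>x. 1 - wx (lab x))"
  define \<nu>' where "\<nu>' = density \<nu> (\<lambda>y. 1 - wy (lab y))"
  have intx: "(\<integral>\<^sup>+y. r (x, y) \<partial>\<nu>) = wx (lab x)" for x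
  proof -
    have "(\<integral>\<^sup>+y. r (x, y) \<partial>\<nu>) = (\<integral>\<^sup>+y. 1 / m (lab x) * indicator (lab -` {lab x}) y \<partial>\<nu>)"
      by (intro nn_integral_cong) (auto simp: r_def indicator_def)
    also have "\<dots> = 1 / m (lab x) * b (lab x)"
      by (subst nn_integral_cmult_indicator) (auto simp: b_def)
    finally show ?thesis by (simp add: wx_def mult.commute)
  qed
  have inty: "(\<integral>\<^sup>+x. r (x, y) \<partial>\<mu>) = wy (lab y)" for y
  proof -
    have "(\<integral>\<^sup>+x. r (x, y) \<partial>\<mu>) = (\<integral>\<^sup>+x. 1 / m (lab y) * indicator (lab -` {lab y}) x \<partial>\<mu>)"
      by (intro nn_integral_cong) (auto simp: r_def indicator_def)
    also have "\<dots> = 1 / m (lab y) * a (lab y)"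
      by (subst nn_integral_cmult_indicator) (auto simp: a_def)
    finally show ?thesis by (simp add: wy_def mult.commute)
  qed
  have sr: "sets \<rho> = sets (borel \<Otimes>\<^sub>M borel)"
    by (simp add: \<rho>_def sets cong: sets_pair_measure_cong)
  note [measurable_cong] = sr
  have lx [measurable]: "(\<lambda>x. wx (lab x)) \<in> borel_measurable borel" "(\<lambda>x. wy (lab x)) \<in> borel_measurable borel"
    by measurable
  have fst_marg: "emeasure (distr \<rho> borel fst) A + emeasure \<mu>' A = emeasure \<mu> A" if [measurable]: "A \<in> sets borel" for A
  proof -
    have "emeasure (distr \<rho> borel fst) A = emeasure \<rho> (fst -` A)"
      by (subst emeasure_distr) (auto simp: sp \<rho>_def space_pair_measure)
    also have "\<dots> = (\<integral>\<^sup>+z. r z * indicator (fst -` A) z \<partial>(\<mu> \<Otimes>\<^sub>M \<nu>))"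
      unfolding \<rho>_def by (rule emeasure_density) (auto simp: sets vimage_fst cong: measurable_cong_sets sets_pair_measure_cong)
    also have "\<dots> = (\<integral>\<^sup>+x. \<integral>\<^sup>+y. r (x, y) * indicator A x \<partial>\<nu> \<partial>\<mu>)"
      by (subst \<nu>.nn_integral_fst[symmetric]) (auto simp: vimage_fst indicator_def intro!: nn_integral_cong)
    also have "\<dots> = (\<integral>\<^sup>+x. wx (lab x) * indicator A x \<partial>\<mu>)"
      by (intro nn_integral_cong) (simp add: nn_integral_multc intx)
    finally have "emeasure (distr \<rho> borel fst) A + emeasure \<mu>' A
       = (\<integral>\<^sup>+x. wx (lab x) * indicator A x + (1 - wx (lab x)) * indicator A x \<partial>\<mu>)"
      by (simp add: \<mu>'_def emeasure_density nn_integral_add sets)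
    also have "\<dots> = (\<integral>\<^sup>+x. indicator A x \<partial>\<mu>)"
      using wx1 by (intro nn_integral_cong) (auto simp: indicator_def)
    finally show ?thesis by (simp add: sets)
  qed
  have snd_marg: "emeasure (distr \<rho> borel snd) A + emeasure \<nu>' A = emeasure \<nu> A" if [measurable]: "A \<in> sets borel" for A
  proof -
    have "emeasure (distr \<rho> borel snd) A = emeasure \<rho> (snd -` A)"
      by (subst emeasure_distr) (auto simp: sp \<rho>_def space_pair_measure)
    also have "\<dots> = (\<integral>\<^sup>+z. r z * indicator (snd -` A) z \<partial>(\<mu> \<Otimes>\<^sub>M \<nu>))"
      unfolding \<rho>_def by (rule emeasure_density) (auto simp: sets vimage_snd cong: measurable_cong_sets sets_pair_measure_cong)
    also have "\<dots> = (\<integral>\<^sup>+y. \<integral>\<^sup>+x. r (x, y) * indicator A y \<partial>\<mu> \<partial>\<nu>)"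
      by (subst P.nn_integral_snd[symmetric]) (auto simp: vimage_snd indicator_def intro!: nn_integral_cong)
    also have "\<dots> = (\<integral>\<^sup>+y. wy (lab y) * indicator A y \<partial>\<nu>)"
      by (intro nn_integral_cong) (simp add: nn_integral_multc inty)
    finally have "emeasure (distr \<rho> borel snd) A + emeasure \<nu>' A
       = (\<integral>\<^sup>+y. wy (lab y) * indicator A y + (1 - wy (lab y)) * indicator A y \<partial>\<nu>)"
      by (simp add: \<nu>'_def emeasure_density nn_integral_add sets)
    also have "\<dots> = (\<integral>\<^sup>+y. indicator A y \<partial>\<nu>)"
      using wy1 by (intro nn_integral_cong) (auto simp: indicator_def)
    finally show ?thesis by (simp add: sets)
  qed
  have ae: "AE z in \<rho>. lab (fst z) = lab (snd z)"
    unfolding \<rho>_def by (subst AE_density) (auto simp: r_def intro!: AE_I2 split: if_splits)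
  have "emeasure \<mu>' (lab -` {i}) = a i - b i" for i
  proof -
    have "emeasure \<mu>' (lab -` {i}) = (\<integral>\<^sup>+x. (1 - wx i) * indicator (lab -` {i}) x \<partial>\<mu>)"
      unfolding \<mu>'_def by (subst emeasure_density) (auto simp: sets indicator_def intro!: nn_integral_cong)
    also have "\<dots> = (1 - wx i) * a i"
      by (subst nn_integral_cmult_indicator) (auto simp: a_def)
    finally show ?thesis by (simp add: cx)
  qed
  moreover have "emeasure \<nu>' (lab -` {i}) = b i - a i" for i
  proof -
    have "emeasure \<nu>' (lab -` {i}) = (\<integral>\<^sup>+x. (1 - wy i) * indicator (lab -` {i}) x \<partial>\<nu>)"
      unfolding \<nu>'_def by (subst emeasure_density) (auto simp: sets indicator_def intro!: nn_integral_cong)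
    also have "\<dots> = (1 - wy i) * b i"
      by (subst nn_integral_cmult_indicator) (auto simp: b_def)
    finally show ?thesis by (simp add: cy)
  qed
  ultimately show thesis
    using sr fst_marg snd_marg ae
    by (intro that[of \<rho> \<mu>' \<nu>']) (auto simp: partial_coupling_def a_def b_def \<mu>'_def \<nu>'_def sets)
qed

text \<open>A partial coupling is completed by any coupling of the residuals.\<close>

lemma add_measure_couplings:
  fixes \<mu> \<nu> \<mu>' \<nu>' :: "'a::euclidean_space measure"
  assumes sets: "sets \<mu> = sets borel" "sets \<nu> = sets borel" "sets \<rho> = sets (borel \<Otimes>\<^sub>M borel)"
    and f: "\<And>A. A \<in> sets borel \<Longrightarrow> emeasure (distr \<rho> borel fst) A + emeasure \<mu>' A = emeasure \<mu> A"
    and s: "\<And>A. A \<in> sets borel \<Longrightarrow> emeasure (distr \<rho> borel snd) A + emeasure \<nu>' A = emeasure \<nu> A"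
    and \<rho>': "\<rho>' \<in> couplings \<mu>' \<nu>'"
  shows "add_measure \<rho> \<rho>' \<in> couplings \<mu> \<nu>"
proof -
  have \<rho>'s: "sets \<rho>' = sets (borel \<Otimes>\<^sub>M borel)" "distr \<rho>' borel fst = \<mu>'" "distr \<rho>' borel snd = \<nu>'"
    using \<rho>' by (auto simp: couplings_def)
  note [measurable_cong] = sets(3) \<rho>'s(1)
  have sp: "space \<rho> = UNIV" "space \<rho>' = UNIV"
    using sets(3) \<rho>'s(1) by (auto dest!: sets_eq_imp_space_eq simp: space_pair_measure)
  have "distr (add_measure \<rho> \<rho>') borel fst = \<mu>"
  proof (rule measure_eqI)
    fix A :: "'a set" assume "A \<in> sets (distr (add_measure \<rho> \<rho>') borel fst)"
    then have A [measurable]: "A \<in> sets borel" by simp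
    have m: "fst -` A \<in> sets ((borel :: 'a measure) \<Otimes>\<^sub>M (borel :: 'a measure))"
      using pair_measureI[OF A, of UNIV borel] by (simp add: vimage_fst del: borel_prod)
    have "emeasure (distr (add_measure \<rho> \<rho>') borel fst) A = emeasure (distr \<rho> borel fst) A + emeasure (distr \<rho>' borel fst) A"
      using m by (simp add: emeasure_distr emeasure_add_measure sets \<rho>'s(1) sp)
    then show "emeasure (distr (add_measure \<rho> \<rho>') borel fst) A = emeasure \<mu> A"
      using f[OF A] \<rho>'s by simp
  qed (use sets in simp)
  moreover have "distr (add_measure \<rho> \<rho>') borel snd = \<nu>"
  proof (rule measure_eqI)
    fix A :: "'a set" assume "A \<in> sets (distr (add_measure \<rho> \<rho>') borel snd)"
    then have A [measurable]: "A \<in> sets borel" by simp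
    have m: "snd -` A \<in> sets ((borel :: 'a measure) \<Otimes>\<^sub>M (borel :: 'a measure))"
      using pair_measureI[OF _ A, of UNIV borel] by (simp add: vimage_snd del: borel_prod)
    have "emeasure (distr (add_measure \<rho> \<rho>') borel snd) A = emeasure (distr \<rho> borel snd) A + emeasure (distr \<rho>' borel snd) A"
      using m by (simp add: emeasure_distr emeasure_add_measure sets \<rho>'s(1) sp)
    then show "emeasure (distr (add_measure \<rho> \<rho>') borel snd) A = emeasure \<nu> A"
      using s[OF A] \<rho>'s by simp
  qed (use sets in simp)
  ultimately show ?thesis
    by (simp add: couplings_def sets)
qed

lemma nn_integral_cells:
  fixes lab :: "'a::topological_space \<Rightarrow> 'i::countable" and h :: "'i \<Rightarrow> ennreal"
  assumes [measurable_cong]: "sets \<mu> = sets borel" and lab [measurable]: "lab \<in> borel \<rightarrow>\<^sub>M count_space UNIV"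
  shows "(\<integral>\<^sup>+x. h (lab x) \<partial>\<mu>) = (\<integral>\<^sup>+i. h i * emeasure \<mu> (lab -` {i}) \<partial>count_space UNIV)"
proof -
  have [measurable]: "lab -` {i} \<in> sets borel" for i
    using measurable_sets[OF lab, of "{i}"] by simp
  have cell: "h (lab x) = (\<integral>\<^sup>+i. h i * indicator (lab -` {i}) x \<partial>count_space UNIV)" for x
  proof -
    have "(\<integral>\<^sup>+i. h i * indicator (lab -` {i}) x \<partial>count_space UNIV) = (\<integral>\<^sup>+i. h (lab x) * indicator {lab x} i \<partial>count_space UNIV)"
      by (intro nn_integral_cong) (auto simp: indicator_def)
    also have "\<dots> = h (lab x)"
      by (subst nn_integral_cmult_indicator) simp_all
    finally show ?thesis by (rule sym)
  qed
  have "(\<integral>\<^sup>+x. h (lab x) \<partial>\<mu>) = (\<integral>\<^sup>+x. \<integral>\<^sup>+i. h i * indicator (lab -` {i}) x \<partial>count_space UNIV \<partial>\<mu>)"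
    by (rule nn_integral_cong) (rule cell)
  also have "\<dots> = (\<integral>\<^sup>+i. \<integral>\<^sup>+x. h i * indicator (lab -` {i}) x \<partial>\<mu> \<partial>count_space UNIV)"
    by (rule nn_integral_count_space_nn_integral) measurable
  also have "\<dots> = (\<integral>\<^sup>+i. h i * emeasure \<mu> (lab -` {i}) \<partial>count_space UNIV)"
    by (intro nn_integral_cong nn_integral_cmult_indicator) simp
  finally show ?thesis .
qed

text \<open>Transport inside the cells moves no mass into or out of a union of cells.\<close>

lemma emeasure_marginals_eq_on_matched:
  fixes \<rho> :: "('a::euclidean_space \<times> 'a) measure"
  assumes [measurable_cong]: "sets \<rho> = sets (borel \<Otimes>\<^sub>M borel)"
    and ae: "AE z in \<rho>. fst z \<in> E \<longleftrightarrow> snd z \<in> E" and E [measurable]: "E \<in> sets borel"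
  shows "emeasure (distr \<rho> borel fst) E = emeasure (distr \<rho> borel snd) E"
  using ae by (subst (1 2) emeasure_distr) (auto intro!: emeasure_eq_AE)

lemma ennreal_add_diff_add_cancel_left:
  fixes m :: ennreal
  assumes "m < \<top>" shows "(m + a) - (m + b) = a - b"
  using assms by (simp add: diff_add_eq_diff_diff_swap_ennreal)

text \<open>Matching inside cells removes the same mass from both measures on every union of cells, so the
  differences on the unions of cells, in particular on all coarser cells, pass unchanged to the
  residuals.  The truncated differences of extended reals record both signs.\<close>

lemma match_cells_cost:
  fixes \<mu> \<nu> :: "'a::euclidean_space measure" and lab flab :: "'a \<Rightarrow> 'i::countable"
    and c :: "'a \<times> 'a \<Rightarrow> ennreal" and v :: "'i \<Rightarrow> ennreal"
  assumes lab [measurable]: "lab \<in> borel \<rightarrow>\<^sub>M count_space UNIV"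
    and lab' [measurable]: "flab \<in> borel \<rightarrow>\<^sub>M count_space UNIV"
    and c [measurable]: "c \<in> borel_measurable (borel \<Otimes>\<^sub>M borel)"
    and c_cell: "\<forall>x y. lab x = lab y \<longrightarrow> c (x, y) \<le> v (flab y)"
    and fin: "finite_measure \<mu>" "finite_measure \<nu>"
    and sets: "sets \<mu> = sets borel" "sets \<nu> = sets borel"
    and mass: "emeasure \<mu> UNIV = emeasure \<nu> UNIV"
  shows "\<exists>\<rho> \<mu>' \<nu>'. partial_coupling \<rho> \<mu>' \<nu>' \<mu> \<nu> \<and> (\<integral>\<^sup>+z. c z \<partial>\<rho>) \<le> (\<integral>\<^sup>+y. v (flab y) \<partial>\<nu>) \<and>
    finite_measure \<mu>' \<and> finite_measure \<nu>' \<and> emeasure \<mu>' UNIV = emeasure \<nu>' UNIV \<and>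
    (\<forall>i. emeasure \<mu>' (lab -` {i}) = emeasure \<mu> (lab -` {i}) - emeasure \<nu> (lab -` {i})) \<and>
    (\<forall>i. emeasure \<nu>' (lab -` {i}) = emeasure \<nu> (lab -` {i}) - emeasure \<mu> (lab -` {i})) \<and>
    (\<forall>E\<in>sets borel. (\<forall>x y. lab x = lab y \<longrightarrow> (x \<in> E \<longleftrightarrow> y \<in> E)) \<longrightarrow>
       emeasure \<nu>' E - emeasure \<mu>' E = emeasure \<nu> E - emeasure \<mu> E \<and>
       emeasure \<mu>' E - emeasure \<nu>' E = emeasure \<mu> E - emeasure \<nu> E)"
proof -
  obtain \<rho> \<mu>' \<nu>' where pc: "partial_coupling \<rho> \<mu>' \<nu>' \<mu> \<nu>"
    and ae: "AE z in \<rho>. lab (fst z) = lab (snd z)"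
    and cell: "\<forall>i. emeasure \<mu>' (lab -` {i}) = emeasure \<mu> (lab -` {i}) - emeasure \<nu> (lab -` {i})"
    "\<forall>i. emeasure \<nu>' (lab -` {i}) = emeasure \<nu> (lab -` {i}) - emeasure \<mu> (lab -` {i})"
    by (rule match_cells[OF fin sets lab])
  note m = pc[unfolded partial_coupling_def, THEN conjunct1]
    pc[unfolded partial_coupling_def, THEN conjunct2, THEN conjunct1]
    pc[unfolded partial_coupling_def, THEN conjunct2, THEN conjunct2, THEN conjunct1]
    pc[unfolded partial_coupling_def, THEN conjunct2, THEN conjunct2, THEN conjunct2, THEN conjunct1, rule_format]
    pc[unfolded partial_coupling_def, THEN conjunct2, THEN conjunct2, THEN conjunct2, THEN conjunct2, rule_format]
  note [measurable_cong] = m(1)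
  have sp: "space \<mu> = UNIV" "space \<nu> = UNIV" "space \<mu>' = UNIV" "space \<nu>' = UNIV"
    using sets m(2,3) by (auto dest!: sets_eq_imp_space_eq)
  have \<mu>fin: "emeasure \<mu> UNIV < \<top>" "emeasure \<nu> UNIV < \<top>"
    using fin sp by (metis finite_measure.emeasure_finite less_top)+
  have part: "emeasure (distr \<rho> borel fst) A < \<top>" "emeasure \<mu>' A < \<top>" 
    "emeasure (distr \<rho> borel snd) A < \<top>" "emeasure \<nu>' A < \<top>" if "A \<in> sets borel" for A
  proof -
    have "emeasure \<mu> A < \<top>" "emeasure \<nu> A < \<top>"
      using fin by (metis finite_measure.emeasure_finite less_top)+
    then show "emeasure (distr \<rho> borel fst) A < \<top>" "emeasure \<mu>' A < \<top>" 
    "emeasure (distr \<rho> borel snd) A < \<top>" "emeasure \<nu>' A < \<top>"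
      using m(4,5)[OF that, symmetric] by simp_all
  qed
  have same: "emeasure (distr \<rho> borel fst) E = emeasure (distr \<rho> borel snd) E"
    if "E \<in> sets borel" "\<forall>x y. lab x = lab y \<longrightarrow> (x \<in> E \<longleftrightarrow> y \<in> E)" for E
  proof (rule emeasure_marginals_eq_on_matched[OF m(1) _ that(1)])
    show "AE z in \<rho>. fst z \<in> E \<longleftrightarrow> snd z \<in> E"
      using ae by eventually_elim (use that(2) in blast)
  qed
  have diff: "emeasure \<nu>' E - emeasure \<mu>' E = emeasure \<nu> E - emeasure \<mu> E \<and>
      emeasure \<mu>' E - emeasure \<nu>' E = emeasure \<mu> E - emeasure \<nu> E"
    if "E \<in> sets borel" "\<forall>x y. lab x = lab y \<longrightarrow> (x \<in> E \<longleftrightarrow> y \<in> E)" for E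
    using same[OF that] part[OF that(1)] m(4,5)[OF that(1), symmetric]
    by (metis ennreal_add_diff_add_cancel_left)
  have mass': "emeasure \<mu>' UNIV = emeasure \<nu>' UNIV"
  proof -
    have "emeasure (distr \<rho> borel fst) UNIV + emeasure \<mu>' UNIV = emeasure (distr \<rho> borel fst) UNIV + emeasure \<nu>' UNIV"
      using same[of UNIV] m(4,5)[of UNIV] mass by simp
    then show ?thesis
      using part(1)[of UNIV] by (auto simp: ennreal_add_left_cancel)
  qed
  have "(\<integral>\<^sup>+z. c z \<partial>\<rho>) \<le> (\<integral>\<^sup>+z. v (flab (snd z)) \<partial>\<rho>)"
    using ae c_cell by (intro nn_integral_mono_AE) auto
  also have "\<dots> = (\<integral>\<^sup>+y. v (flab y) \<partial>distr \<rho> borel snd)"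
    by (subst nn_integral_distr) auto
  also have "\<dots> \<le> (\<integral>\<^sup>+y. v (flab y) \<partial>\<nu>)"
  proof -
    have "(\<integral>\<^sup>+ i. v i * emeasure (distr \<rho> borel snd) (flab -` {i}) \<partial>count_space UNIV)
      \<le> (\<integral>\<^sup>+ i. v i * emeasure \<nu> (flab -` {i}) \<partial>count_space UNIV)"
    proof (intro nn_integral_mono mult_left_mono)
      fix i have "flab -` {i} \<in> sets borel"
        using measurable_sets[OF lab', of "{i}"] by simp
      from m(5)[OF this] show "emeasure (distr \<rho> borel snd) (flab -` {i}) \<le> emeasure \<nu> (flab -` {i})"
        by (metis le_iff_add)
    qed simp
    then show ?thesis
      using nn_integral_cells[OF sets_distr lab', where h="v"] nn_integral_cells[OF sets(2) lab', where h="v"] by metis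
  qed
  finally have cost: "(\<integral>\<^sup>+z. c z \<partial>\<rho>) \<le> (\<integral>\<^sup>+y. v (flab y) \<partial>\<nu>)" .
  have fin': "finite_measure \<mu>'" "finite_measure \<nu>'"
    using part[of UNIV] sp by (auto intro!: finite_measureI)
  show ?thesis
    using pc cost fin' mass' cell diff by blast
qed

lemma add_measure_couplings_cost:
  fixes \<mu> \<nu> \<mu>' \<nu>' :: "'a::euclidean_space measure" and c :: "'a \<times> 'a \<Rightarrow> ennreal"
  assumes c: "c \<in> borel_measurable (borel \<Otimes>\<^sub>M borel)"
    and sets: "sets \<mu> = sets borel" "sets \<nu> = sets borel" and \<rho>: "partial_coupling \<rho> \<mu>' \<nu>' \<mu> \<nu>"
    and \<rho>': "\<rho>' \<in> couplings \<mu>' \<nu>'"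
  obtains \<rho>'' where "\<rho>'' \<in> couplings \<mu> \<nu>" "(\<integral>\<^sup>+z. c z \<partial>\<rho>'') = (\<integral>\<^sup>+z. c z \<partial>\<rho>) + (\<integral>\<^sup>+z. c z \<partial>\<rho>')"
proof (rule that)
  show "add_measure \<rho> \<rho>' \<in> couplings \<mu> \<nu>"
    using \<rho> unfolding partial_coupling_def by (intro add_measure_couplings[OF sets _ _ _ \<rho>']) auto
  show "(\<integral>\<^sup>+z. c z \<partial>add_measure \<rho> \<rho>') = (\<integral>\<^sup>+z. c z \<partial>\<rho>) + (\<integral>\<^sup>+z. c z \<partial>\<rho>')"
  proof (rule nn_integral_add_measure)
    show "sets \<rho>' = sets \<rho>" using \<rho> \<rho>' by (simp add: couplings_def partial_coupling_def)
    show "c \<in> borel_measurable \<rho>"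
      using c \<rho> unfolding partial_coupling_def by (metis measurable_cong_sets)
  qed
qed

text \<open>Matching is repeated along a refining sequence of labellings, starting with the finest.  The mass
  moved at level \<open>l\<close> is at most the residual mass after level \<open>l + 1\<close>, and this is the excess of
  \<open>\<nu>\<close> over \<open>\<mu>\<close> in the cells of level \<open>l + 1\<close>; for this reason \<open>v l\<close> is a function of the finer
  label.  At the finest level all of \<open>\<nu>\<close> may move, and at the root, where the remaining mass is
  matched regardless of cells, the cost is split between the two end points.\<close>

lemma tree_coupling:
  fixes lab :: "nat \<Rightarrow> 'a::euclidean_space \<Rightarrow> 'i::countable" and c :: "'a \<times> 'a \<Rightarrow> ennreal"
    and v :: "nat \<Rightarrow> 'i \<Rightarrow> ennreal" and u :: "'i \<Rightarrow> ennreal"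
  assumes lab [measurable]: "\<And>l. lab l \<in> borel \<rightarrow>\<^sub>M count_space UNIV"
    and refine: "\<And>l x y. lab (Suc l) x = lab (Suc l) y \<Longrightarrow> lab l x = lab l y"
    and c [measurable]: "c \<in> borel_measurable (borel \<Otimes>\<^sub>M borel)"
    and c_cell: "\<And>l. \<forall>x y. lab l x = lab l y \<longrightarrow> c (x, y) \<le> v l (lab (Suc l) y)"
    and c_root: "\<And>x y. c (x, y) \<le> u (lab 0 x) + u (lab 0 y)"
    and fin: "finite_measure \<mu>" "finite_measure \<nu>"
    and sets: "sets \<mu> = sets borel" "sets \<nu> = sets borel"
    and mass: "emeasure \<mu> UNIV = emeasure \<nu> UNIV"
  shows "\<exists>\<rho>\<in>couplings \<mu> \<nu>. (\<integral>\<^sup>+z. c z \<partial>\<rho>) \<le>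
      (\<integral>\<^sup>+y. v L (lab (Suc L) y) \<partial>\<nu>)
      + (\<Sum>l<L. \<integral>\<^sup>+i. v l i * (emeasure \<nu> (lab (Suc l) -` {i}) - emeasure \<mu> (lab (Suc l) -` {i})) \<partial>count_space UNIV)
      + (\<integral>\<^sup>+i. u i * ((emeasure \<mu> (lab 0 -` {i}) - emeasure \<nu> (lab 0 -` {i}))
           + (emeasure \<nu> (lab 0 -` {i}) - emeasure \<mu> (lab 0 -` {i}))) \<partial>count_space UNIV)"
  using fin sets mass
proof (induction L arbitrary: \<mu> \<nu>)
  case 0
  obtain \<rho> \<mu>' \<nu>' where pc: "partial_coupling \<rho> \<mu>' \<nu>' \<mu> \<nu>"
      and cost: "(\<integral>\<^sup>+z. c z \<partial>\<rho>) \<le> (\<integral>\<^sup>+y. v 0 (lab (Suc 0) y) \<partial>\<nu>)"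
      and fin': "finite_measure \<mu>'" "finite_measure \<nu>'" and mass': "emeasure \<mu>' UNIV = emeasure \<nu>' UNIV"
      and cell': "\<forall>i. emeasure \<mu>' (lab 0 -` {i}) = emeasure \<mu> (lab 0 -` {i}) - emeasure \<nu> (lab 0 -` {i})"
      "\<forall>i. emeasure \<nu>' (lab 0 -` {i}) = emeasure \<nu> (lab 0 -` {i}) - emeasure \<mu> (lab 0 -` {i})"
    using match_cells_cost[OF lab[of "0"] lab[of "Suc 0"] c c_cell[of "0"] 0] by (elim exE conjE) (rule that, assumption+)
  note cell = cell'[rule_format]
  have sets': "sets \<mu>' = sets borel" "sets \<nu>' = sets borel"
    using pc by (auto simp: partial_coupling_def)
  \<comment> \<open>The root step: a single cell, in which the residuals of equal mass are matched completely.\<close>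
  obtain \<rho>' \<mu>'' \<nu>'' where pc': "partial_coupling \<rho>' \<mu>'' \<nu>'' \<mu>' \<nu>'"
    and total: "\<forall>i. emeasure \<mu>'' ((\<lambda>_. ()) -` {i}) = emeasure \<mu>' ((\<lambda>_. ()) -` {i}) - emeasure \<nu>' ((\<lambda>_. ()) -` {i})"
     "\<forall>i. emeasure \<nu>'' ((\<lambda>_. ()) -` {i}) = emeasure \<nu>' ((\<lambda>_. ()) -` {i}) - emeasure \<mu>' ((\<lambda>_. ()) -` {i})"
    by (rule match_cells[OF fin' sets', of "\<lambda>_. ()"]) simp
  have m: "sets \<rho>' = sets (borel \<Otimes>\<^sub>M borel)" "sets \<mu>'' = sets borel" "sets \<nu>'' = sets borel"
    "\<And>A. A \<in> sets borel \<Longrightarrow> emeasure (distr \<rho>' borel fst) A + emeasure \<mu>'' A = emeasure \<mu>' A"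
    "\<And>A. A \<in> sets borel \<Longrightarrow> emeasure (distr \<rho>' borel snd) A + emeasure \<nu>'' A = emeasure \<nu>' A"
    using pc' by (auto simp: partial_coupling_def simp del: borel_prod)
  note [measurable_cong] = m(1)
  have z: "emeasure \<mu>'' A = 0" "emeasure \<nu>'' A = 0" for A
  proof -
    have "emeasure \<mu>'' UNIV = 0" "emeasure \<nu>'' UNIV = 0"
      using total fin' mass' by (auto simp: finite_measure.emeasure_finite)
    then show "emeasure \<mu>'' A = 0" "emeasure \<nu>'' A = 0"
      by (metis emeasure_mono m(2,3) le_zero_eq sets.top space_borel subset_UNIV sets_eq_imp_space_eq)+
  qed
  have marg: "distr \<rho>' borel fst = \<mu>'" "distr \<rho>' borel snd = \<nu>'"
    using m(4,5) z sets' by (auto intro!: measure_eqI)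
  have cpl: "\<rho>' \<in> couplings \<mu>' \<nu>'"
    by (simp add: couplings_def m marg)
  obtain \<rho>'' where
    \<rho>'': "\<rho>'' \<in> couplings \<mu> \<nu>" "(\<integral>\<^sup>+z. c z \<partial>\<rho>'') = (\<integral>\<^sup>+z. c z \<partial>\<rho>) + (\<integral>\<^sup>+z. c z \<partial>\<rho>')"
    by (rule add_measure_couplings_cost[OF c 0(3,4) pc cpl])
  have "(\<integral>\<^sup>+z. c z \<partial>\<rho>') \<le> (\<integral>\<^sup>+z. u (lab 0 (fst z)) + u (lab 0 (snd z)) \<partial>\<rho>')"
    using c_root by (intro nn_integral_mono) (auto simp: split_paired_all)
  also have "\<dots> = (\<integral>\<^sup>+x. u (lab 0 x) \<partial>\<mu>') + (\<integral>\<^sup>+x. u (lab 0 x) \<partial>\<nu>')"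
    by (subst nn_integral_add) (auto simp: marg[symmetric] nn_integral_distr)
  also have "\<dots> = (\<integral>\<^sup>+i. u i * ((emeasure \<mu> (lab 0 -` {i}) - emeasure \<nu> (lab 0 -` {i}))
         + (emeasure \<nu> (lab 0 -` {i}) - emeasure \<mu> (lab 0 -` {i}))) \<partial>count_space UNIV)"
    unfolding nn_integral_cells[OF sets'(1) lab, where h=u] nn_integral_cells[OF sets'(2) lab, where h=u] cell
    by (simp add: nn_integral_add[symmetric] distrib_left)
  finally have "(\<integral>\<^sup>+z. c z \<partial>\<rho>'') \<le> (\<integral>\<^sup>+y. v 0 (lab (Suc 0) y) \<partial>\<nu>) + (\<integral>\<^sup>+i. u i * ((emeasure \<mu> (lab 0 -` {i}) - emeasure \<nu> (lab 0 -` {i}))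
         + (emeasure \<nu> (lab 0 -` {i}) - emeasure \<mu> (lab 0 -` {i}))) \<partial>count_space UNIV)"
    unfolding \<rho>''(2) by (intro add_mono cost)
  then show ?case
    using \<rho>''(1) by auto
next
  case (Suc L)
  obtain \<rho> \<mu>' \<nu>' where pc: "partial_coupling \<rho> \<mu>' \<nu>' \<mu> \<nu>"
      and cost: "(\<integral>\<^sup>+z. c z \<partial>\<rho>) \<le> (\<integral>\<^sup>+y. v (Suc L) (lab (Suc (Suc L)) y) \<partial>\<nu>)"
      and fin': "finite_measure \<mu>'" "finite_measure \<nu>'" and mass': "emeasure \<mu>' UNIV = emeasure \<nu>' UNIV"
      and cell': "\<forall>i. emeasure \<mu>' (lab (Suc L) -` {i}) = emeasure \<mu> (lab (Suc L) -` {i}) - emeasure \<nu> (lab (Suc L) -` {i})"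
      "\<forall>i. emeasure \<nu>' (lab (Suc L) -` {i}) = emeasure \<nu> (lab (Suc L) -` {i}) - emeasure \<mu> (lab (Suc L) -` {i})"
      and \<rho>E: "\<forall>E\<in>sets borel. (\<forall>x y. lab (Suc L) x = lab (Suc L) y \<longrightarrow> (x \<in> E \<longleftrightarrow> y \<in> E)) \<longrightarrow>
          emeasure \<nu>' E - emeasure \<mu>' E = emeasure \<nu> E - emeasure \<mu> E
        \<and> emeasure \<mu>' E - emeasure \<nu>' E = emeasure \<mu> E - emeasure \<nu> E"
    using match_cells_cost[OF lab[of "Suc L"] lab[of "Suc (Suc L)"] c c_cell[of "Suc L"] Suc.prems] by (elim exE conjE) (rule that, assumption+)
  note cell = cell'[rule_format]
  have sets': "sets \<mu>' = sets borel" "sets \<nu>' = sets borel"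
    using pc by (auto simp: partial_coupling_def)
  have coarse: "lab l x = lab l y" if "l \<le> Suc L" "lab (Suc L) x = lab (Suc L) y" for l x y
    using that(1)
  proof (induction rule: inc_induct)
    case (step n)
    from step.IH show ?case by (rule refine)
  qed (fact that(2))
  have cells: "emeasure \<nu>' (lab l -` {i}) - emeasure \<mu>' (lab l -` {i}) = emeasure \<nu> (lab l -` {i}) - emeasure \<mu> (lab l -` {i})"
    "emeasure \<mu>' (lab l -` {i}) - emeasure \<nu>' (lab l -` {i}) = emeasure \<mu> (lab l -` {i}) - emeasure \<nu> (lab l -` {i})"
    if "l \<le> Suc L" for l i
  proof -
    have meas: "lab l -` {i} \<in> sets borel"
      using measurable_sets[OF lab, of "{i}"] by simp
    have inv: "\<forall>x y. lab (Suc L) x = lab (Suc L) y \<longrightarrow> (x \<in> lab l -` {i} \<longleftrightarrow> y \<in> lab l -` {i})"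
      unfolding vimage_singleton_eq using coarse[OF that] by metis
    show "emeasure \<nu>' (lab l -` {i}) - emeasure \<mu>' (lab l -` {i}) = emeasure \<nu> (lab l -` {i}) - emeasure \<mu> (lab l -` {i})"
      by (rule bspec[OF \<rho>E meas, THEN mp, OF inv, THEN conjunct1])
    show "emeasure \<mu>' (lab l -` {i}) - emeasure \<nu>' (lab l -` {i}) = emeasure \<mu> (lab l -` {i}) - emeasure \<nu> (lab l -` {i})"
      by (rule bspec[OF \<rho>E meas, THEN mp, OF inv, THEN conjunct2])
  qed
  obtain \<rho>' where \<rho>': "\<rho>' \<in> couplings \<mu>' \<nu>'" "(\<integral>\<^sup>+z. c z \<partial>\<rho>') \<le>
    (\<integral>\<^sup>+y. v L (lab (Suc L) y) \<partial>\<nu>')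
    + (\<Sum>l<L. \<integral>\<^sup>+i. v l i * (emeasure \<nu>' (lab (Suc l) -` {i}) - emeasure \<mu>' (lab (Suc l) -` {i})) \<partial>count_space UNIV)
    + (\<integral>\<^sup>+i. u i * ((emeasure \<mu>' (lab 0 -` {i}) - emeasure \<nu>' (lab 0 -` {i}))
         + (emeasure \<nu>' (lab 0 -` {i}) - emeasure \<mu>' (lab 0 -` {i}))) \<partial>count_space UNIV)"
    using Suc.IH[OF fin' sets' mass'] by (elim bexE) (rule that)
  obtain \<rho>'' where
    \<rho>'': "\<rho>'' \<in> couplings \<mu> \<nu>" "(\<integral>\<^sup>+z. c z \<partial>\<rho>'') = (\<integral>\<^sup>+z. c z \<partial>\<rho>) + (\<integral>\<^sup>+z. c z \<partial>\<rho>')"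
    by (rule add_measure_couplings_cost[OF c Suc.prems(3,4) pc \<rho>'(1)])
  have "(\<integral>\<^sup>+z. c z \<partial>\<rho>'') \<le> (\<integral>\<^sup>+y. v (Suc L) (lab (Suc (Suc L)) y) \<partial>\<nu>) + ((\<integral>\<^sup>+y. v L (lab (Suc L) y) \<partial>\<nu>')
    + (\<Sum>l<L. \<integral>\<^sup>+i. v l i * (emeasure \<nu>' (lab (Suc l) -` {i}) - emeasure \<mu>' (lab (Suc l) -` {i})) \<partial>count_space UNIV)
    + (\<integral>\<^sup>+i. u i * ((emeasure \<mu>' (lab 0 -` {i}) - emeasure \<nu>' (lab 0 -` {i}))
         + (emeasure \<nu>' (lab 0 -` {i}) - emeasure \<mu>' (lab 0 -` {i}))) \<partial>count_space UNIV))"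
    unfolding \<rho>''(2) by (intro add_mono cost \<rho>'(2))
  also have "\<dots> = (\<integral>\<^sup>+y. v (Suc L) (lab (Suc (Suc L)) y) \<partial>\<nu>) + 
       (\<Sum>l<Suc L. \<integral>\<^sup>+i. v l i * (emeasure \<nu> (lab (Suc l) -` {i}) - emeasure \<mu> (lab (Suc l) -` {i})) \<partial>count_space UNIV)
    + (\<integral>\<^sup>+i. u i * ((emeasure \<mu> (lab 0 -` {i}) - emeasure \<nu> (lab 0 -` {i}))
         + (emeasure \<nu> (lab 0 -` {i}) - emeasure \<mu> (lab 0 -` {i}))) \<partial>count_space UNIV)"
  proof -
    have assoc: "w + (a + s + r) = w + (s + a) + r" for w a s r :: ennreal
      by (simp add: ac_simps)
    have sums: "(\<Sum>l<L. \<integral>\<^sup>+i. v l i * (emeasure \<nu>' (lab (Suc l) -` {i}) - emeasure \<mu>' (lab (Suc l) -` {i})) \<partial>count_space UNIV)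
      = (\<Sum>l<L. \<integral>\<^sup>+i. v l i * (emeasure \<nu> (lab (Suc l) -` {i}) - emeasure \<mu> (lab (Suc l) -` {i})) \<partial>count_space UNIV)"
      by (intro sum.cong refl nn_integral_cong) (simp add: cells)
    show ?thesis
      unfolding nn_integral_cells[OF sets'(2) lab, where h="v L"] cell(2) cells[OF le0] sum.lessThan_Suc sums
      by (rule assoc)
  qed
  finally show ?case
    by (rule bexI[OF _ \<rho>''(1)])
qed

section \<open>Dyadic cells and the Wasserstein distance\<close>

definition shell :: "'a::real_normed_vector \<Rightarrow> nat" where
  "shell x = (LEAST n. norm x \<le> 2 ^ n)"

text \<open>An enumeration of the basis turns the integer coordinates of a cube into a list, hence into an
  element of a countable type.\<close>

definition basis_list :: "'a::euclidean_space list" where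
  "basis_list = (SOME bs. set bs = Basis \<and> distinct bs)"

text \<open>The cubes of level \<open>l\<close> in shell \<open>n\<close> have side \<open>2\<^bsup>n-l\<^esup>\<close>: the mesh is relative to the size of the
  shell, so that the number of cubes in a shell depends on \<open>l\<close> only.\<close>

definition dyadic_label :: "nat \<Rightarrow> 'a::euclidean_space \<Rightarrow> nat \<times> int list" where
  "dyadic_label l x = (shell x, map (\<lambda>b. \<lfloor>2 ^ l * (x \<bullet> b) / 2 ^ shell x\<rfloor>) basis_list)"

lemma basis_list: "set basis_list = (Basis :: 'a::euclidean_space set)" "distinct (basis_list :: 'a list)"
  using someI_ex[OF finite_distinct_list[OF finite_Basis]] unfolding basis_list_def by blast+

lemma length_basis_list: "length (basis_list :: 'a::euclidean_space list) = DIM('a)"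
  using distinct_card[OF basis_list(2)[where ?'a='a]] basis_list(1)[where ?'a='a] by simp

lemma norm_le_shell: "norm x \<le> 2 ^ shell x"
proof -
  obtain n :: nat where "norm x \<le> 2 ^ n"
    using real_arch_pow[of 2 "norm x"] by (auto intro: less_imp_le)
  then show ?thesis unfolding shell_def by (rule LeastI)
qed

lemma shell_less_norm: "n < shell x \<Longrightarrow> 2 ^ n < norm x"
  unfolding shell_def using not_less_Least linorder_not_less by blast

lemma measurable_shell [measurable]: "shell \<in> borel \<rightarrow>\<^sub>M count_space UNIV"
  unfolding shell_def [abs_def] by measurable

lemma measurable_map_count_space:
  fixes f :: "'b \<Rightarrow> 'c \<Rightarrow> 'd::countable"
  assumes "\<And>b. b \<in> set bs \<Longrightarrow> f b \<in> M \<rightarrow>\<^sub>M count_space UNIV"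
  shows "(\<lambda>x. map (\<lambda>b. f b x) bs) \<in> M \<rightarrow>\<^sub>M count_space UNIV"
  using assms
proof (induction bs)
  case (Cons b bs)
  have [measurable]: "f b \<in> M \<rightarrow>\<^sub>M count_space UNIV" "(\<lambda>x. map (\<lambda>b. f b x) bs) \<in> M \<rightarrow>\<^sub>M count_space UNIV"
    using Cons by auto
  have "(\<lambda>x. (\<lambda>z xs. z # xs) (f b x) (map (\<lambda>b. f b x) bs)) \<in> M \<rightarrow>\<^sub>M count_space UNIV"
    by (rule measurable_compose_countable[where g="f b"]) measurable
  then show ?case by simp
qed simp

lemma measurable_dyadic_label [measurable]:
  "(dyadic_label l :: 'a::euclidean_space \<Rightarrow> _) \<in> borel \<rightarrow>\<^sub>M count_space UNIV"
proof -
  have m: "(\<lambda>x::'a. map (\<lambda>b. \<lfloor>2 ^ l * (x \<bullet> b) / 2 ^ shell x\<rfloor>) basis_list) \<in> borel \<rightarrow>\<^sub>M count_space UNIV"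
    by (rule measurable_map_count_space) measurable
  note [measurable] = m
  have "(\<lambda>x::'a. (\<lambda>n zs. (n, zs)) (shell x) (map (\<lambda>b. \<lfloor>2 ^ l * (x \<bullet> b) / 2 ^ shell x\<rfloor>) basis_list)) \<in> borel \<rightarrow>\<^sub>M count_space UNIV"
    by (rule measurable_compose_countable[where g=shell]) measurable
  then show ?thesis by (simp add: dyadic_label_def[abs_def])
qed

lemma sets_dyadic_cell [measurable]: "dyadic_label l -` {i} \<in> sets borel"
  using measurable_sets[OF measurable_dyadic_label, of "{i}" l] by simp

lemma fst_dyadic_label [simp]: "fst (dyadic_label l x) = shell x"
  by (simp add: dyadic_label_def)

text \<open>The coordinates at level \<open>l\<close> are the halves, rounded down, of those at level \<open>l + 1\<close>.\<close>

lemma dyadic_label_refine: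
  fixes x y :: "'a::euclidean_space"
  assumes "dyadic_label (Suc l) x = dyadic_label (Suc l) y"
  shows "dyadic_label l x = dyadic_label l y"
proof -
  have half: "\<lfloor>2 ^ l * u / v\<rfloor> = \<lfloor>2 ^ Suc l * u / v\<rfloor> div 2" for u v :: real
    using floor_divide_real_eq_div[of 2 "2 ^ Suc l * u / v"] by simp
  have "shell x = shell y"
    and "\<forall>b\<in>set basis_list. \<lfloor>2 ^ Suc l * (x \<bullet> b) / 2 ^ shell x\<rfloor> = \<lfloor>2 ^ Suc l * (y \<bullet> b) / 2 ^ shell y\<rfloor>"
    using assms by (auto simp: dyadic_label_def simp del: power_Suc)
  then show ?thesis
    by (auto simp: dyadic_label_def half simp del: power_Suc)
qed

lemma norm_diff_dyadic_cell:
  fixes x y :: "'a::euclidean_space"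
  assumes "dyadic_label l x = dyadic_label l y"
  shows "norm (x - y) \<le> DIM('a) * (2 ^ shell y / 2 ^ l)"
proof -
  have s: "shell x = shell y"
    and f: "\<forall>b\<in>Basis. \<lfloor>2 ^ l * (x \<bullet> b) / 2 ^ shell x\<rfloor> = \<lfloor>2 ^ l * (y \<bullet> b) / 2 ^ shell y\<rfloor>"
    using assms by (auto simp: dyadic_label_def basis_list)
  have "\<bar>(x - y) \<bullet> b\<bar> \<le> 2 ^ shell y / 2 ^ l" if "b \<in> Basis" for b
  proof -
    have "\<bar>2 ^ l * (x \<bullet> b) / 2 ^ shell y - 2 ^ l * (y \<bullet> b) / 2 ^ shell y\<bar> \<le> 1"
      using bspec[OF f that] s by (simp add: ) linarith
    also have "2 ^ l * (x \<bullet> b) / 2 ^ shell y - 2 ^ l * (y \<bullet> b) / 2 ^ shell y = (2 ^ l / 2 ^ shell y) * ((x - y) \<bullet> b)"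
      by (simp add: inner_diff_left field_simps)
    finally show ?thesis
      by (simp add: abs_mult field_simps)
  qed
  then have "(\<Sum>b\<in>Basis. \<bar>(x - y) \<bullet> b\<bar>) \<le> (\<Sum>b\<in>(Basis::'a set). 2 ^ shell y / 2 ^ l)"
    by (rule sum_mono)
  then show ?thesis
    using norm_le_l1[of "x - y"] by simp
qed

text \<open>Superset of the coordinate lists of the cubes of level \<open>l\<close> in any shell.\<close>

definition grid :: "nat \<Rightarrow> nat \<Rightarrow> int list set" where
  "grid d l = {zs. set zs \<subseteq> {- (2 ^ l)..2 ^ l} \<and> length zs = d}"

lemma finite_grid: "finite (grid d l)"
  unfolding grid_def by (rule finite_lists_length_eq) simp

lemma card_grid_le: "real (card (grid d l)) \<le> (3 * 2 ^ l) ^ d"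
proof -
  have "real (card {- (2 ^ l)..2 ^ l :: int}) = 2 * 2 ^ l + 1"
    by simp
  also have "\<dots> \<le> 3 * 2 ^ l"
    using one_le_power[of "2::real" l] by simp
  finally have "real (card {- (2 ^ l)..2 ^ l :: int}) ^ d \<le> (3 * 2 ^ l) ^ d"
    by (rule power_mono) (rule of_nat_0_le_iff)
  then show ?thesis
    unfolding grid_def card_lists_length_eq[OF finite_atLeastAtMost_int] of_nat_power .
qed

lemma snd_dyadic_label_in_grid:
  "snd (dyadic_label l x) \<in> grid DIM('a) l" for x :: "'a::euclidean_space"
proof -
  have "\<lfloor>2 ^ l * (x \<bullet> b) / 2 ^ shell x\<rfloor> \<in> {- (2 ^ l)..2 ^ l}" if b: "b \<in> Basis" for b
  proof -
    have "\<bar>x \<bullet> b\<bar> \<le> 2 ^ shell x"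
      using Basis_le_norm[OF b, of x] norm_le_shell[of x] by linarith
    then have "\<bar>2 ^ l * (x \<bullet> b) / 2 ^ shell x\<bar> \<le> 2 ^ l"
      by (simp add: abs_mult field_simps)
    then have "- (2 ^ l) \<le> 2 ^ l * (x \<bullet> b) / 2 ^ shell x" "2 ^ l * (x \<bullet> b) / 2 ^ shell x \<le> 2 ^ l"
      by linarith+
    from this[THEN floor_mono]
    have "\<lfloor>- (2 ^ l) :: real\<rfloor> \<le> \<lfloor>2 ^ l * (x \<bullet> b) / 2 ^ shell x\<rfloor>" "\<lfloor>2 ^ l * (x \<bullet> b) / 2 ^ shell x\<rfloor> \<le> \<lfloor>2 ^ l :: real\<rfloor>" .
    moreover have "\<lfloor>- (2 ^ l) :: real\<rfloor> = - (2 ^ l)" "\<lfloor>2 ^ l :: real\<rfloor> = 2 ^ l"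
      using floor_of_int[of "- (2 ^ l)", where ?'a = real] floor_of_int[of "2 ^ l", where ?'a = real] by simp_all
    ultimately show ?thesis by simp
  qed
  then show ?thesis
    by (auto simp: grid_def dyadic_label_def length_basis_list basis_list)
qed

lemma ennreal_powr_inverse:
  assumes "p > 0" shows "ennreal_powr (ennreal_powr x (1 / p)) p = x"
  using assms by (cases x) (auto simp: ennreal_powr_def powr_powr)

lemma ennreal_powr_mono:
  assumes "p > 0" "x \<le> y" shows "ennreal_powr x p \<le> ennreal_powr y p"
  using assms by (cases x; cases y) (auto simp: ennreal_powr_def powr_mono2 top_unique ennreal_leI)

text \<open>Exhibiting one coupling bounds the \<open>p\<close>-th power of the Wasserstein distance; the roots in its
  definition cancel for every \<open>p > 0\<close>, the range \<open>p < 1\<close> included.\<close>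

lemma wasserstein_powr_le_coupling:
  assumes "\<rho> \<in> couplings \<mu> \<nu>" "p > 0"
  shows "ennreal_powr (wasserstein p \<mu> \<nu>) p \<le> (\<integral>\<^sup>+z. ennreal (norm (fst z - snd z) powr p) \<partial>\<rho>)"
proof -
  have "wasserstein p \<mu> \<nu> \<le> ennreal_powr (\<integral>\<^sup>+z. ennreal (norm (fst z - snd z) powr p) \<partial>\<rho>) (1 / p)"
    unfolding wasserstein_def by (rule INF_lower) fact
  then have "ennreal_powr (wasserstein p \<mu> \<nu>) p \<le> ennreal_powr (ennreal_powr (\<integral>\<^sup>+z. ennreal (norm (fst z - snd z) powr p) \<partial>\<rho>) (1 / p)) p"
    by (rule ennreal_powr_mono[OF assms(2)])
  then show ?thesis by (simp add: ennreal_powr_inverse assms(2))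
qed

lemma powr_shell_le:
  assumes "p > 0"
  shows "2 powr (p * real (shell x)) \<le> 1 + 2 powr p * norm x powr p"
proof (cases "shell x")
  case (Suc n)
  then have "2 ^ shell x \<le> 2 * norm x"
    using shell_less_norm[of n x] by simp
  then have "(2 ^ shell x) powr p \<le> (2 * norm x) powr p"
    using assms by (intro powr_mono2) auto
  moreover have "(2 ^ shell x :: real) powr p = 2 powr (p * real (shell x))"
    by (simp add: powr_realpow[symmetric] powr_powr mult.commute)
  ultimately show ?thesis
    by (simp add: powr_mult)
qed simp

text \<open>Points in one cell of level \<open>l\<close> are at distance at most \<open>d 2\<^bsup>n-l\<^esup>\<close>, which is the cost for
  \<open>tree_coupling\<close>; at the root \<open>\<bar>x - y\<bar>\<close> is at most twice the larger shell radius.  A coupling built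
  from finitely many levels pays an extra \<open>O(2\<^bsup>-pL\<^esup>)\<close> times a moment of \<open>\<nu>\<close>; this vanishes as
  \<open>L\<close> grows, and the distance is an infimum over couplings.\<close>

lemma wasserstein_dyadic_bound:
  fixes \<mu> \<nu> :: "'a::euclidean_space measure"
  assumes p: "p > 0" and prob: "prob_space \<mu>" "prob_space \<nu>"
    and sets: "sets \<mu> = sets borel" "sets \<nu> = sets borel"
    and mom: "abs_moment \<nu> p < \<top>"
  shows "ennreal_powr (wasserstein p \<mu> \<nu>) p \<le> ennreal ((2 * DIM('a)) powr p) *
    (\<Sum>l. \<integral>\<^sup>+i. ennreal (2 powr (p * (real (fst i) - real l))) *
        ennreal \<bar>measure \<mu> (dyadic_label l -` {i}) - measure \<nu> (dyadic_label l -` {i})\<bar> \<partial>count_space UNIV)"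
proof -
  interpret \<mu>: prob_space \<mu> by fact
  interpret \<nu>: prob_space \<nu> by fact
  note [measurable_cong] = sets
  define D where "D = real DIM('a)"
  have D: "D > 0" by (simp add: D_def)
  define v where "v = (\<lambda>l (i::nat \<times> int list). ennreal (D powr p * 2 powr (p * (real (fst i) - real l))))"
  define u where "u = (\<lambda>i::nat \<times> int list. ennreal (2 powr p * 2 powr (p * real (fst i))))"
  define T where "T = (\<lambda>l. \<integral>\<^sup>+i. ennreal (2 powr (p * (real (fst i) - real l))) *
        ennreal \<bar>measure \<mu> (dyadic_label l -` {i}) - measure \<nu> (dyadic_label l -` {i})\<bar> \<partial>count_space UNIV)"
  define C where "C = ennreal ((2 * D) powr p)"
  define W where "W = ennreal_powr (wasserstein p \<mu> \<nu>) p"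
  have two: "(2 ^ n :: real) = 2 powr real n" for n by (simp add: powr_realpow)
  have c_cell: "\<forall>x y::'a. dyadic_label l x = dyadic_label l y \<longrightarrow>
      ennreal (norm (fst (x, y) - snd (x, y)) powr p) \<le> v l (dyadic_label (Suc l) y)" for l
  proof (intro allI impI)
    fix x y :: 'a assume "dyadic_label l x = dyadic_label l y"
    then have "norm (x - y) powr p \<le> (D * (2 ^ shell y / 2 ^ l)) powr p"
      using p unfolding D_def by (intro powr_mono2 norm_diff_dyadic_cell) auto
    also have "\<dots> = D powr p * 2 powr (p * (real (shell y) - real l))"
      using D by (simp add: powr_mult two powr_diff[symmetric] powr_powr mult.commute)
    finally show "ennreal (norm (fst (x, y) - snd (x, y)) powr p) \<le> v l (dyadic_label (Suc l) y)"
      by (simp add: v_def ennreal_leI)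
  qed
  have c_root: "ennreal (norm (fst (x, y) - snd (x, y)) powr p) \<le> u (dyadic_label 0 x) + u (dyadic_label 0 y)" for x y :: 'a
  proof -
    have "norm (x - y) \<le> norm x + norm y"
      by (rule norm_triangle_ineq4)
    also have "\<dots> \<le> 2 * 2 ^ max (shell x) (shell y)"
    proof -
      have "(2::real) ^ shell x \<le> 2 ^ max (shell x) (shell y)" "(2::real) ^ shell y \<le> 2 ^ max (shell x) (shell y)"
        by (rule power_increasing; simp)+
      then show ?thesis
        using norm_le_shell[of x] norm_le_shell[of y] by linarith
    qed
    finally have "norm (x - y) powr p \<le> (2 * 2 ^ max (shell x) (shell y)) powr p"
      using p by (intro powr_mono2) auto
    also have "\<dots> = 2 powr p * 2 powr (p * real (max (shell x) (shell y)))"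
      by (simp add: powr_mult two powr_powr mult.commute)
    also have "\<dots> \<le> 2 powr p * 2 powr (p * real (shell x)) + 2 powr p * 2 powr (p * real (shell y))"
      by (cases "shell x \<le> shell y") (auto simp: max_def)
    finally show ?thesis
      by (simp add: u_def ennreal_plus[symmetric] ennreal_leI del: ennreal_plus)
  qed
  have cell_diff: "emeasure \<nu> (dyadic_label l -` {i}) - emeasure \<mu> (dyadic_label l -` {i})
        \<le> ennreal \<bar>measure \<mu> (dyadic_label l -` {i}) - measure \<nu> (dyadic_label l -` {i})\<bar>"
    "(emeasure \<mu> (dyadic_label l -` {i}) - emeasure \<nu> (dyadic_label l -` {i})) + 
     (emeasure \<nu> (dyadic_label l -` {i}) - emeasure \<mu> (dyadic_label l -` {i}))
        \<le> ennreal \<bar>measure \<mu> (dyadic_label l -` {i}) - measure \<nu> (dyadic_label l -` {i})\<bar>" for l i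
    by (auto simp: \<mu>.emeasure_eq_measure \<nu>.emeasure_eq_measure ennreal_minus ennreal_leI abs_if ennreal_neg)
  have bound: "W \<le> (\<integral>\<^sup>+y. v L (dyadic_label (Suc L) y) \<partial>\<nu>) + C * (\<Sum>l. T l)" for L
  proof -
    have vC: "v l i = C * ennreal (2 powr (p * (real (fst i) - real (Suc l))))" for l i
      using D unfolding v_def C_def
      by (simp add: ennreal_mult[symmetric] powr_mult powr_add[symmetric] algebra_simps)
    have uC: "u i \<le> C * ennreal (2 powr (p * (real (fst i) - real 0)))" for i
    proof -
      have "1 \<le> D" unfolding D_def by (simp add: Suc_leI)
      then have "1 \<le> D powr p" using p by (simp add: ge_one_powr_ge_zero)
      then show ?thesis
        using D unfolding u_def C_def by (simp add: ennreal_mult[symmetric] powr_mult ennreal_leI)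
    qed
    obtain \<rho> where \<rho>: "\<rho> \<in> couplings \<mu> \<nu>" "(\<integral>\<^sup>+z. ennreal (norm (fst z - snd z) powr p) \<partial>\<rho>) \<le>
        (\<integral>\<^sup>+y. v L (dyadic_label (Suc L) y) \<partial>\<nu>)
      + (\<Sum>l<L. \<integral>\<^sup>+i. v l i * (emeasure \<nu> (dyadic_label (Suc l) -` {i}) - emeasure \<mu> (dyadic_label (Suc l) -` {i})) \<partial>count_space UNIV)
      + (\<integral>\<^sup>+i. u i * ((emeasure \<mu> (dyadic_label 0 -` {i}) - emeasure \<nu> (dyadic_label 0 -` {i}))
           + (emeasure \<nu> (dyadic_label 0 -` {i}) - emeasure \<mu> (dyadic_label 0 -` {i}))) \<partial>count_space UNIV)"
      by (rule bexE[OF tree_coupling[OF measurable_dyadic_label dyadic_label_refine _ c_cell c_root \<mu>.finite_measure_axioms \<nu>.finite_measure_axioms sets, of L]])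
         (simp_all add: \<mu>.emeasure_space_1[simplified sets_eq_imp_space_eq[OF sets(1)], simplified] \<nu>.emeasure_space_1[simplified sets_eq_imp_space_eq[OF sets(2)], simplified])
    have "W \<le> (\<integral>\<^sup>+z. ennreal (norm (fst z - snd z) powr p) \<partial>\<rho>)"
      unfolding W_def by (rule wasserstein_powr_le_coupling[OF \<rho>(1) p])
    also note \<rho>(2)
    also have "(\<Sum>l<L. \<integral>\<^sup>+i. v l i * (emeasure \<nu> (dyadic_label (Suc l) -` {i}) - emeasure \<mu> (dyadic_label (Suc l) -` {i})) \<partial>count_space UNIV)
       \<le> (\<Sum>l<L. C * T (Suc l))"
      unfolding T_def by (subst nn_integral_cmult[symmetric])
        (auto intro!: sum_mono nn_integral_mono mult_mono cell_diff simp: vC mult.assoc[symmetric])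
    also have "(\<integral>\<^sup>+i. u i * ((emeasure \<mu> (dyadic_label 0 -` {i}) - emeasure \<nu> (dyadic_label 0 -` {i}))
           + (emeasure \<nu> (dyadic_label 0 -` {i}) - emeasure \<mu> (dyadic_label 0 -` {i}))) \<partial>count_space UNIV)
         \<le> C * T 0"
      unfolding T_def
      by (subst nn_integral_cmult[symmetric]; (unfold mult.assoc[symmetric])?)
        (auto intro!: nn_integral_mono mult_mono cell_diff uC[simplified])
    also have "(\<integral>\<^sup>+y. v L (dyadic_label (Suc L) y) \<partial>\<nu>) + (\<Sum>l<L. C * T (Suc l)) + C * T 0
        = (\<integral>\<^sup>+y. v L (dyadic_label (Suc L) y) \<partial>\<nu>) + C * (\<Sum>l<Suc L. T l)"
      by (simp only: sum.lessThan_Suc_shift sum_distrib_left[symmetric] distrib_left ac_simps)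
    also have "\<dots> \<le> (\<integral>\<^sup>+y. v L (dyadic_label (Suc L) y) \<partial>\<nu>) + C * (\<Sum>l. T l)"
      by (intro add_left_mono mult_left_mono sum_le_suminf) auto
    finally show ?thesis by (simp add: add_mono)
  qed
  define m where "m = enn2real (abs_moment \<nu> p)"
  have m: "abs_moment \<nu> p = ennreal m" "0 \<le> m"
    using mom by (simp_all add: m_def)
  have err: "(\<integral>\<^sup>+y. v L (dyadic_label (Suc L) y) \<partial>\<nu>) \<le> ennreal ((2 powr (-p)) ^ L * (D powr p * (1 + 2 powr p * m)))" for L
  proof -
    have "(\<integral>\<^sup>+y. v L (dyadic_label (Suc L) y) \<partial>\<nu>) \<le> (\<integral>\<^sup>+y. ennreal (2 powr (- p * L) * D powr p) * (1 + ennreal (2 powr p) * ennreal (norm y powr p)) \<partial>\<nu>)"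
    proof (intro nn_integral_mono)
      fix y :: 'a
      have "D powr p * 2 powr (p * (real (shell y) - real L)) = 2 powr (- p * L) * D powr p * 2 powr (p * real (shell y))"
        by (simp add: powr_add[symmetric] algebra_simps)
      also have "\<dots> \<le> 2 powr (- p * L) * D powr p * (1 + 2 powr p * norm y powr p)"
        by (intro mult_left_mono powr_shell_le p) auto
      finally show "v L (dyadic_label (Suc L) y) \<le> ennreal (2 powr (- p * L) * D powr p) * (1 + ennreal (2 powr p) * ennreal (norm y powr p))"
        by (simp add: v_def ennreal_mult[symmetric] ennreal_plus[symmetric] ennreal_leI del: ennreal_plus flip: ennreal_1)
    qed
    also have "\<dots> = ennreal (2 powr (- p * L) * D powr p) * (1 + ennreal (2 powr p) * abs_moment \<nu> p)"
      by (simp add: nn_integral_cmult nn_integral_add abs_moment_def \<nu>.emeasure_space_1)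
    also have "\<dots> = ennreal ((2 powr (-p)) ^ L * (D powr p * (1 + 2 powr p * m)))"
      using m(2) by (simp add: m ennreal_mult[symmetric] ennreal_plus[symmetric] powr_realpow[symmetric] powr_powr ac_simps del: ennreal_plus flip: ennreal_1)
    finally show ?thesis .
  qed
  have "(\<lambda>L. ennreal ((2 powr (-p)) ^ L * (D powr p * (1 + 2 powr p * m))) + C * (\<Sum>l. T l)) \<longlonglongrightarrow> ennreal (0 * (D powr p * (1 + 2 powr p * m))) + C * (\<Sum>l. T l)"
    using p by (intro tendsto_add tendsto_ennrealI tendsto_mult LIMSEQ_power_zero tendsto_const) (simp add: powr_less_one)
  moreover have "W \<le> ennreal ((2 powr (-p)) ^ L * (D powr p * (1 + 2 powr p * m))) + C * (\<Sum>l. T l)" for L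
    by (rule order_trans[OF bound[of L]]) (intro add_right_mono err)
  ultimately have "W \<le> ennreal (0 * (D powr p * (1 + 2 powr p * m))) + C * (\<Sum>l. T l)"
    by (intro LIMSEQ_le_const) auto
  then show ?thesis
    by (simp add: W_def C_def T_def D_def)
qed

section \<open>Double sums over shells and scales\<close>

lemma two_powr_neg_less_1: "c > 0 \<Longrightarrow> 2 powr (- c) < (1::real)"
  by (simp add: powr_less_one)

lemma suminf_geometric_le:
  fixes f :: "nat \<Rightarrow> real"
  assumes "c > 0" "K \<ge> 0" and f: "\<And>n. f n \<le> K * 2 powr (- (c * real n))"
  shows "(\<Sum>n. ennreal (f n)) \<le> ennreal (K / (1 - 2 powr (- c)))"
proof -
  have g: "(2 powr (- c)) ^ n = 2 powr (- (c * real n))" for n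
    by (simp add: powr_realpow[symmetric] powr_powr)
  have c1: "2 powr (- c) < 1" using \<open>c > 0\<close> by (simp add: powr_less_one)
  have s: "(\<lambda>n. K * (2 powr (- c)) ^ n) sums (K * (1 / (1 - 2 powr (- c))))"
    using c1 by (intro sums_mult geometric_sums) simp
  have "(\<Sum>n. ennreal (f n)) \<le> (\<Sum>n. ennreal (K * (2 powr (- c)) ^ n))"
    using f by (intro suminf_le summableI ennreal_leI) (simp add: g)
  also have "\<dots> = ennreal (K * (1 / (1 - 2 powr (- c))))"
    using \<open>K \<ge> 0\<close> by (intro suminf_ennreal_eq s) simp
  finally show ?thesis by simp
qed

text \<open>The two geometric sequences cross at the real index where \<open>2\<^bsup>-(a+b)n\<^esup> = \<delta>\<close>; there both equal
  \<open>\<delta>\<^bsup>a/(a+b)\<^esup>\<close>, and the minimum decays geometrically on either side.\<close>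

lemma suminf_min_geometric_le:
  fixes a b \<delta> :: real
  assumes a: "a > 0" and b: "b > 0" and \<delta>: "\<delta> > 0"
  shows "(\<Sum>n. ennreal (min (2 powr (- (a * real n))) (2 powr (b * real n) * \<delta>)))
     \<le> ennreal ((1 / (1 - 2 powr (- a)) + 1 / (1 - 2 powr (- b))) * \<delta> powr (a / (a + b)))"
proof -
  define x where "x = log 2 \<delta>"
  have x: "\<delta> = 2 powr x" using \<delta> by (simp add: x_def)
  define m where "m = nat \<lceil>- x / (a + b)\<rceil>"
  define f where "f = (\<lambda>n. min (2 powr (- (a * real n))) (2 powr (b * real n) * \<delta>))"
  define D where "D = \<delta> powr (a / (a + b))"
  have D: "D = 2 powr (a * x / (a + b))" by (simp add: D_def x powr_powr mult.commute)
  have fD: "0 \<le> f n" for n using \<delta> by (simp add: f_def)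
  have right: "f (n + m) \<le> D * 2 powr (- (a * real n))" for n
  proof -
    have "real m \<ge> - x / (a + b)" unfolding m_def by linarith
    then have "a * real m \<ge> a * (- x / (a + b))" using a by (intro mult_left_mono) auto
    then have "- (a * real (n + m)) \<le> a * x / (a + b) + - (a * real n)"
      by (simp add: algebra_simps)
    then have "2 powr (- (a * real (n + m))) \<le> D * 2 powr (- (a * real n))"
      unfolding D powr_add[symmetric] by simp
    then show ?thesis by (simp add: f_def)
  qed
  have left: "f (m - Suc n) \<le> D * 2 powr (- (b * real n))" if "n < m" for n
  proof -
    have "real m - 1 \<le> - x / (a + b)" using that unfolding m_def by linarith
    then have "b * (real m - 1) \<le> b * (- x / (a + b))" using b by (intro mult_left_mono) auto
    moreover have "b * (- x / (a + b)) + x = a * x / (a + b)"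
      using a b by (simp add: field_simps)
    ultimately have "b * real (m - Suc n) + x \<le> a * x / (a + b) + - (b * real n)"
      using that by (simp add: of_nat_diff algebra_simps)
    then have "2 powr (b * real (m - Suc n)) * \<delta> \<le> D * 2 powr (- (b * real n))"
      unfolding D x powr_add[symmetric] by simp
    then show ?thesis by (simp add: f_def)
  qed
  have "(\<Sum>n. ennreal (f n)) = (\<Sum>n. ennreal (f (n + m))) + (\<Sum>n<m. ennreal (f n))"
    by (rule suminf_offset) simp
  also have "(\<Sum>n<m. ennreal (f n)) = (\<Sum>n<m. ennreal (f (m - Suc n)))"
    by (rule sum.nat_diff_reindex[symmetric])
  also have "(\<Sum>n<m. ennreal (f (m - Suc n))) \<le> (\<Sum>n<m. ennreal (D * 2 powr (- (b * real n))))"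
    using left by (intro sum_mono ennreal_leI) simp
  also have "\<dots> \<le> (\<Sum>n. ennreal (D * 2 powr (- (b * real n))))"
    by (rule sum_le_suminf) auto
  also have "\<dots> \<le> ennreal (D / (1 - 2 powr (- b)))"
    using b by (rule suminf_geometric_le) (simp_all add: D)
  also have "(\<Sum>n. ennreal (f (n + m))) \<le> ennreal (D / (1 - 2 powr (- a)))"
    using a by (rule suminf_geometric_le) (simp_all add: D right[unfolded D])
  finally have "(\<Sum>n. ennreal (f n)) \<le> ennreal (D / (1 - 2 powr (- a))) + ennreal (D / (1 - 2 powr (- b)))"
    by (simp add: add_mono)
  also have "\<dots> = ennreal ((1 / (1 - 2 powr (- a)) + 1 / (1 - 2 powr (- b))) * D)"
    using a b by (simp add: ennreal_plus[symmetric] D two_powr_neg_less_1 less_imp_le field_simps del: ennreal_plus)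
  finally show ?thesis unfolding f_def D_def .
qed

text \<open>The sum over the scales \<open>l\<close> inside one shell of mass \<open>1\<close>: the minimum compares the trivial bound
  with the fluctuation bound \<open>2\<^bsup>al\<^esup> \<delta>\<close> of all cells of scale \<open>l\<close> together.\<close>

definition scale_sum :: "real \<Rightarrow> real \<Rightarrow> real \<Rightarrow> ennreal" where
  "scale_sum p a \<delta> = (\<Sum>l. ennreal (2 powr (- (p * real l)) * min 1 (2 powr (a * real l) * \<delta>)))"

text \<open>The sum over the shells \<open>n\<close>, with mass \<open>O(2\<^bsup>-qn\<^esup>)\<close> and transport cost \<open>2\<^bsup>pn\<^esup>\<close>, thus
  \<open>r = q - p\<close>; the relative fluctuation in a shell grows like \<open>2\<^bsup>wn\<^esup>\<close> with \<open>w = q (1 - \<beta>)\<close>.\<close>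

definition dyadic_sum :: "real \<Rightarrow> real \<Rightarrow> real \<Rightarrow> real \<Rightarrow> real \<Rightarrow> ennreal" where
  "dyadic_sum p a r w \<epsilon> = (\<Sum>n. ennreal (2 powr (- (r * real n))) * scale_sum p a (2 powr (w * real n) * \<epsilon>))"

lemma scale_sum_le_const:
  assumes "p > 0" "\<delta> > 0"
  shows "scale_sum p a \<delta> \<le> ennreal (1 / (1 - 2 powr (- p)))"
  unfolding scale_sum_def using assms(1) by (rule suminf_geometric_le) (auto intro: mult_left_le)

text \<open>If \<open>a < p\<close> the coarsest scale dominates and the sum is of order \<open>\<delta>\<close>.  If \<open>a > p\<close> the scale where
  the two bounds cross dominates.  If \<open>a = p\<close> the sum is of order \<open>\<delta> log (1/\<delta>)\<close>, and giving up an
  arbitrarily small part of the exponent removes the logarithm.  The cut at \<open>1\<close> is the trivial bound.\<close>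

lemma scale_sum_le_powr:
  assumes p: "p > 0" and a: "a > 0"
    and \<theta>: "a < p \<and> \<theta> = 1 \<or> p < a \<and> \<theta> = p / a \<or> a = p \<and> 0 < \<theta> \<and> \<theta> < 1"
  shows "\<exists>C>0. \<forall>\<delta>>0. scale_sum p a \<delta> \<le> ennreal (C * min 1 (\<delta> powr \<theta>))"
proof -
  have "\<exists>C\<ge>0. \<forall>\<delta>>0. scale_sum p a \<delta> \<le> ennreal (C * \<delta> powr \<theta>)"
    using \<theta>
  proof (elim disjE conjE)
    assume ap: "a < p" and [simp]: "\<theta> = 1"
    have "scale_sum p a \<delta> \<le> ennreal (\<delta> / (1 - 2 powr (- (p - a))))" if "\<delta> > 0" for \<delta>
      unfolding scale_sum_def
    proof (rule suminf_geometric_le)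
      fix n
      have "2 powr (- (p * real n)) * min 1 (2 powr (a * real n) * \<delta>) \<le> 2 powr (- (p * real n)) * (2 powr (a * real n) * \<delta>)"
        by (intro mult_left_mono) auto
      also have "\<dots> = \<delta> * 2 powr (- ((p - a) * real n))"
        by (simp add: powr_add[symmetric] algebra_simps)
      finally show "2 powr (- (p * real n)) * min 1 (2 powr (a * real n) * \<delta>) \<le> \<delta> * 2 powr (- ((p - a) * real n))" .
    qed (use ap that in auto)
    then show ?thesis
      using ap two_powr_neg_less_1[of "p - a"] by (intro exI[of _ "1 / (1 - 2 powr (- (p - a)))"]) (auto intro!: divide_nonneg_nonneg add_nonneg_nonneg simp: two_powr_neg_less_1 less_imp_le)
  next
    assume ap: "p < a" and th: "\<theta> = p / a"
    define C where "C = 1 / (1 - 2 powr (- p)) + 1 / (1 - 2 powr (- (a - p)))"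
    have "scale_sum p a \<delta> \<le> ennreal (C * \<delta> powr \<theta>)" if \<delta>: "\<delta> > 0" for \<delta>
    proof -
      have "scale_sum p a \<delta> = (\<Sum>n. ennreal (min (2 powr (- (p * real n))) (2 powr ((a - p) * real n) * \<delta>)))"
      proof -
        have "2 powr ((a - p) * real n) = 2 powr (- (p * real n)) * 2 powr (a * real n)" for n
          unfolding powr_add[symmetric] by (simp add: algebra_simps)
        then show ?thesis
          unfolding scale_sum_def by (simp add: min_mult_distrib_left mult.assoc)
      qed
      also have "\<dots> \<le> ennreal (C * \<delta> powr (p / (p + (a - p))))"
        unfolding C_def using p ap \<delta> by (intro suminf_min_geometric_le) auto
      finally show ?thesis by (simp add: th)
    qed
    moreover have "C \<ge> 0" using p ap two_powr_neg_less_1[of "a - p"] by (auto intro!: divide_nonneg_nonneg add_nonneg_nonneg simp: C_def two_powr_neg_less_1 less_imp_le)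
    ultimately show ?thesis by auto
  next
    assume ap: "a = p" and th: "0 < \<theta>" "\<theta> < 1"
    have "scale_sum p a \<delta> \<le> ennreal (\<delta> powr \<theta> / (1 - 2 powr (- (p * (1 - \<theta>)))))" if \<delta>: "\<delta> > 0" for \<delta>
      unfolding scale_sum_def
    proof (rule suminf_geometric_le)
      fix n
      have "min 1 z \<le> z powr \<theta>" if "z > 0" for z :: real
      proof (cases "z \<le> 1")
        case True
        then have "z powr 1 \<le> z powr \<theta>" using that th by (intro powr_mono') auto
        then show ?thesis using True that by simp
      next
        case False
        then show ?thesis using th by (simp add: ge_one_powr_ge_zero)
      qed
      then have "min 1 (2 powr (a * real n) * \<delta>) \<le> (2 powr (a * real n) * \<delta>) powr \<theta>"
        using \<delta> by simp
      then have "2 powr (- (p * real n)) * min 1 (2 powr (a * real n) * \<delta>) \<le> 2 powr (- (p * real n)) * (2 powr (a * real n) * \<delta>) powr \<theta>"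
        by (intro mult_left_mono) auto
      also have "\<dots> = \<delta> powr \<theta> * 2 powr (- (p * (1 - \<theta>) * real n))"
        using \<delta> by (simp add: ap powr_mult powr_powr powr_add[symmetric] algebra_simps)
      finally show "2 powr (- (p * real n)) * min 1 (2 powr (a * real n) * \<delta>) \<le> \<delta> powr \<theta> * 2 powr (- (p * (1 - \<theta>) * real n))" .
    qed (use p th in auto)
    then show ?thesis
      using p th by (intro exI[of _ "1 / (1 - 2 powr (- (p * (1 - \<theta>))))"]) (auto intro!: divide_nonneg_nonneg add_nonneg_nonneg simp: two_powr_neg_less_1 less_imp_le)
  qed
  then obtain C where C: "C \<ge> 0" "\<And>\<delta>. \<delta> > 0 \<Longrightarrow> scale_sum p a \<delta> \<le> ennreal (C * \<delta> powr \<theta>)" by blast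
  \<comment> \<open>One constant for both arguments of the minimum.\<close>
  define C' where "C' = max (max 1 C) (1 / (1 - 2 powr (- p)))"
  have "scale_sum p a \<delta> \<le> ennreal (C' * min 1 (\<delta> powr \<theta>))" if "\<delta> > 0" for \<delta>
  proof (cases "\<delta> powr \<theta> \<le> 1")
    case True
    have "C * \<delta> powr \<theta> \<le> C' * \<delta> powr \<theta>" by (intro mult_right_mono) (auto simp: C'_def)
    then show ?thesis using C(2)[OF that] True by (auto elim!: order_trans simp: min_def intro!: ennreal_leI)
  next
    case False
    then show ?thesis using scale_sum_le_const[OF p that, of a]
      by (auto elim!: order_trans simp: min_def C'_def intro!: ennreal_leI)
  qed
  moreover have "C' > 0" by (auto simp: C'_def)
  ultimately show ?thesis by blast
qed

lemma dyadic_sum_le_of_powr: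
  assumes "C > 0" "\<epsilon> > 0" and scale: "\<forall>\<delta>>0. scale_sum p a \<delta> \<le> ennreal (C * min 1 (\<delta> powr \<theta>))"
  shows "dyadic_sum p a r w \<epsilon> \<le> ennreal C * (\<Sum>n. ennreal (min (2 powr (- (r * real n))) (2 powr ((w * \<theta> - r) * real n) * \<epsilon> powr \<theta>)))"
proof -
  have "ennreal (2 powr (- (r * real n))) * scale_sum p a (2 powr (w * real n) * \<epsilon>)
      \<le> ennreal C * ennreal (min (2 powr (- (r * real n))) (2 powr ((w * \<theta> - r) * real n) * \<epsilon> powr \<theta>))" for n
  proof -
    have "ennreal (2 powr (- (r * real n))) * scale_sum p a (2 powr (w * real n) * \<epsilon>)
        \<le> ennreal (2 powr (- (r * real n))) * ennreal (C * min 1 ((2 powr (w * real n) * \<epsilon>) powr \<theta>))"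
      using assms(2) by (intro mult_left_mono scale[rule_format]) auto
    also have "\<dots> = ennreal (C * (2 powr (- (r * real n)) * min 1 ((2 powr (w * real n) * \<epsilon>) powr \<theta>)))"
      using assms(1) by (simp add: ennreal_mult[symmetric] ac_simps)
    also have "2 powr (- (r * real n)) * min 1 ((2 powr (w * real n) * \<epsilon>) powr \<theta>)
       = min (2 powr (- (r * real n))) (2 powr ((w * \<theta> - r) * real n) * \<epsilon> powr \<theta>)"
    proof -
      have "2 powr ((w * \<theta> - r) * real n) = 2 powr (- (r * real n)) * 2 powr (w * real n * \<theta>)"
        unfolding powr_add[symmetric] by (simp add: algebra_simps)
      then show ?thesis
        using assms(2) by (simp add: min_mult_distrib_left powr_mult powr_powr mult.assoc)
    qed
    finally show ?thesis using assms(1,2) by (simp add: ennreal_mult)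
  qed
  then show ?thesis
    unfolding dyadic_sum_def by (subst ennreal_suminf_cmult[symmetric]) (intro suminf_le summableI)
qed

text \<open>If \<open>w \<theta> < r\<close> the shells near the origin dominate, and the rate of a single shell survives.\<close>

lemma dyadic_sum_le_fast:
  assumes p: "p > 0" and a: "a > 0" and r: "r > 0"
    and \<theta>: "a < p \<and> \<theta> = 1 \<or> p < a \<and> \<theta> = p / a \<or> a = p \<and> 0 < \<theta> \<and> \<theta> < 1" and w: "w * \<theta> < r"
  shows "\<exists>C>0. \<forall>\<epsilon>>0. dyadic_sum p a r w \<epsilon> \<le> ennreal (C * \<epsilon> powr \<theta>)"
proof -
  obtain C where C: "C > 0" "\<forall>\<delta>>0. scale_sum p a \<delta> \<le> ennreal (C * min 1 (\<delta> powr \<theta>))"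
    using scale_sum_le_powr[OF p a \<theta>] by blast
  have less1: "2 powr (- (r - w * \<theta>)) < 1" using w by (intro powr_less_one) auto
  have "dyadic_sum p a r w \<epsilon> \<le> ennreal (C / (1 - 2 powr (- (r - w * \<theta>))) * \<epsilon> powr \<theta>)" if \<epsilon>: "\<epsilon> > 0" for \<epsilon>
  proof -
    have "(\<Sum>n. ennreal (min (2 powr (- (r * real n))) (2 powr ((w * \<theta> - r) * real n) * \<epsilon> powr \<theta>)))
        \<le> ennreal (\<epsilon> powr \<theta> / (1 - 2 powr (- (r - w * \<theta>))))"
      using w by (intro suminf_geometric_le) (auto simp: min_le_iff_disj algebra_simps)
    then have "ennreal C * (\<Sum>n. ennreal (min (2 powr (- (r * real n))) (2 powr ((w * \<theta> - r) * real n) * \<epsilon> powr \<theta>)))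
        \<le> ennreal C * ennreal (\<epsilon> powr \<theta> / (1 - 2 powr (- (r - w * \<theta>))))"
      by (rule mult_left_mono) simp
    also have "\<dots> = ennreal (C / (1 - 2 powr (- (r - w * \<theta>))) * \<epsilon> powr \<theta>)"
      using C(1) less1 by (simp add: ennreal_mult[symmetric] less_imp_le)
    finally show ?thesis
      by (rule order_trans[OF dyadic_sum_le_of_powr[OF C(1) \<epsilon> C(2)]])
  qed
  then show ?thesis using C(1) less1 by (intro exI[of _ "C / (1 - 2 powr (- (r - w * \<theta>)))"]) auto
qed

text \<open>If \<open>w \<theta> > r\<close> the shell where the trivial bound takes over dominates.  The resulting exponent
  \<open>r / w\<close> is the same for every admissible \<open>\<theta>\<close>.\<close>

lemma dyadic_sum_le_slow:
  assumes p: "p > 0" and a: "a > 0" and r: "r > 0" and w0: "w > 0"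
    and \<theta>: "a < p \<and> \<theta> = 1 \<or> p < a \<and> \<theta> = p / a \<or> a = p \<and> 0 < \<theta> \<and> \<theta> < 1" and w: "r < w * \<theta>"
  shows "\<exists>C>0. \<forall>\<epsilon>>0. dyadic_sum p a r w \<epsilon> \<le> ennreal (C * \<epsilon> powr (r / w))"
proof -
  obtain C where C: "C > 0" "\<forall>\<delta>>0. scale_sum p a \<delta> \<le> ennreal (C * min 1 (\<delta> powr \<theta>))"
    using scale_sum_le_powr[OF p a \<theta>] by blast
  have th: "\<theta> > 0" using p a \<theta> by auto
  define B where "B = 1 / (1 - 2 powr (- r)) + 1 / (1 - 2 powr (- (w * \<theta> - r)))"
  have B: "B > 0" unfolding B_def using r w by (intro add_pos_pos) (auto intro!: divide_pos_pos powr_less_one)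
  have "dyadic_sum p a r w \<epsilon> \<le> ennreal (C * B * \<epsilon> powr (r / w))" if \<epsilon>: "\<epsilon> > 0" for \<epsilon>
  proof -
    have "(\<Sum>n. ennreal (min (2 powr (- (r * real n))) (2 powr ((w * \<theta> - r) * real n) * \<epsilon> powr \<theta>)))
        \<le> ennreal (B * (\<epsilon> powr \<theta>) powr (r / (r + (w * \<theta> - r))))"
      unfolding B_def using r w \<epsilon> by (intro suminf_min_geometric_le) auto
    also have "(\<epsilon> powr \<theta>) powr (r / (r + (w * \<theta> - r))) = \<epsilon> powr (r / w)"
      using th w0 by (simp add: powr_powr)
    finally have "ennreal C * (\<Sum>n. ennreal (min (2 powr (- (r * real n))) (2 powr ((w * \<theta> - r) * real n) * \<epsilon> powr \<theta>)))
        \<le> ennreal C * ennreal (B * \<epsilon> powr (r / w))"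
      by (rule mult_left_mono) simp
    also have "\<dots> = ennreal (C * B * \<epsilon> powr (r / w))"
      using C(1) B by (simp add: ennreal_mult[symmetric] mult.assoc)
    finally show ?thesis
      by (rule order_trans[OF dyadic_sum_le_of_powr[OF C(1) \<epsilon> C(2)]])
  qed
  then show ?thesis using C(1) B by (intro exI[of _ "C * B"]) auto
qed

text \<open>For \<open>a = p\<close> the first \<open>log (1/\<delta>)\<close> scales contribute \<open>\<delta>\<close> each, and the remaining ones form a
  geometric series.\<close>

lemma scale_sum_critical_le:
  assumes p: "p > 0" and \<delta>: "\<delta> > 0"
  shows "scale_sum p p \<delta> \<le> ennreal ((1 + 1 / (p * ln 2) + 1 / (1 - 2 powr (- p))) * (1 + max 0 (ln (1 / \<delta>))) * \<delta>)"
proof -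
  define x where "x = max 0 (ln (1 / \<delta>))"
  \<comment> \<open>From scale \<open>m\<close> on, the geometric term \<open>2\<^bsup>-pl\<^esup>\<close> is below \<open>\<delta>\<close>.\<close>
  define m where "m = nat \<lceil>x / (p * ln 2)\<rceil>"
  have x: "x \<ge> 0" by (simp add: x_def)
  have m1: "real m \<le> x / (p * ln 2) + 1" and m2: "x / (p * ln 2) \<le> real m"
    using x p unfolding m_def by (auto simp: le_of_int_ceiling)
  define f where "f = (\<lambda>l. 2 powr (- (p * real l)) * min 1 (2 powr (p * real l) * \<delta>))"
  have f\<delta>: "f l \<le> \<delta>" for l
  proof -
    have "f l \<le> 2 powr (- (p * real l)) * (2 powr (p * real l) * \<delta>)"
      unfolding f_def by (intro mult_left_mono) auto
    also have "\<dots> = \<delta>" by (simp add: mult.assoc[symmetric] powr_add[symmetric])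
    finally show ?thesis .
  qed
  have right: "f (l + m) \<le> \<delta> * 2 powr (- (p * real l))" for l
  proof -
    have "x \<le> p * ln 2 * real m" using m2 p by (simp add: field_simps)
    then have "ln (1 / \<delta>) \<le> p * real m * ln 2" by (simp add: x_def algebra_simps)
    then have "exp (ln (1 / \<delta>)) \<le> exp (p * real m * ln 2)" by simp
    then have "1 / \<delta> \<le> 2 powr (p * real m)" using \<delta> by (simp add: powr_def)
    then have "2 powr (- (p * real m)) \<le> \<delta>" using \<delta> by (simp add: powr_minus field_simps)
    then have "2 powr (- (p * real m)) * 2 powr (- (p * real l)) \<le> \<delta> * 2 powr (- (p * real l))"
      by (rule mult_right_mono) simp
    moreover have "f (l + m) \<le> 2 powr (- (p * real m)) * 2 powr (- (p * real l))"
      unfolding f_def powr_add[symmetric] by (rule order_trans[OF mult_left_le]) (auto simp: algebra_simps)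
    ultimately show ?thesis by linarith
  qed
  have "scale_sum p p \<delta> = (\<Sum>l. ennreal (f (l + m))) + (\<Sum>l<m. ennreal (f l))"
    unfolding scale_sum_def f_def by (rule suminf_offset) simp
  also have "\<dots> \<le> ennreal (\<delta> / (1 - 2 powr (- p))) + (\<Sum>l<m. ennreal \<delta>)"
    using p \<delta> by (intro add_mono suminf_geometric_le sum_mono ennreal_leI f\<delta> right) auto
  also have "\<dots> = ennreal (\<delta> / (1 - 2 powr (- p)) + real m * \<delta>)"
    using p \<delta> by (simp add: ennreal_plus two_powr_neg_less_1 less_imp_le ennreal_mult ennreal_of_nat_eq_real_of_nat)
  also have "\<dots> \<le> ennreal ((1 + 1 / (p * ln 2) + 1 / (1 - 2 powr (- p))) * (1 + x) * \<delta>)"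
  proof (rule ennreal_leI)
    have g: "0 \<le> 1 / (1 - 2 powr (- p))" "0 \<le> 1 / (p * ln 2)" using p by (auto intro!: divide_nonneg_nonneg add_nonneg_nonneg simp: two_powr_neg_less_1 less_imp_le)
    have "1 / (1 - 2 powr (- p)) + real m \<le> 1 / (1 - 2 powr (- p)) + (1 / (p * ln 2) * x + 1)"
      using m1 by simp
    also have "\<dots> \<le> (1 + 1 / (p * ln 2) + 1 / (1 - 2 powr (- p))) * (1 + x)"
    proof -
      have "u + (v * x + 1) \<le> (1 + v + u) * (1 + x)" if "0 \<le> u" "0 \<le> v" for u v :: real
        using that x mult_nonneg_nonneg[OF that(1) x] by (simp add: algebra_simps)
      from this[OF g] show ?thesis .
    qed
    finally have "(1 / (1 - 2 powr (- p)) + real m) * \<delta> \<le> (1 + 1 / (p * ln 2) + 1 / (1 - 2 powr (- p))) * (1 + x) * \<delta>"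
      using \<delta> by (intro mult_right_mono) auto
    then show "\<delta> / (1 - 2 powr (- p)) + real m * \<delta> \<le> (1 + 1 / (p * ln 2) + 1 / (1 - 2 powr (- p))) * (1 + x) * \<delta>"
      by (simp add: algebra_simps)
  qed
  finally show ?thesis by (simp add: x_def)
qed

lemma dyadic_sum_critical_le:
  assumes p: "p > 0" and w0: "w > 0" and w: "w < r"
  shows "\<exists>C>0. \<forall>\<epsilon>>0. dyadic_sum p p r w \<epsilon> \<le> ennreal (C * ((1 + max 0 (ln (1 / \<epsilon>))) * \<epsilon>))"
proof -
  define B where "B = 1 + 1 / (p * ln 2) + 1 / (1 - 2 powr (- p))"
  have B: "B > 0" using p unfolding B_def by (intro add_pos_pos) (auto intro!: divide_pos_pos powr_less_one)
  have less1: "2 powr (- (r - w)) < 1" using w by (intro powr_less_one) auto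
  have "dyadic_sum p p r w \<epsilon> \<le> ennreal (B / (1 - 2 powr (- (r - w))) * ((1 + max 0 (ln (1 / \<epsilon>))) * \<epsilon>))" if \<epsilon>: "\<epsilon> > 0" for \<epsilon>
  proof -
    define E where "E = B * ((1 + max 0 (ln (1 / \<epsilon>))) * \<epsilon>)"
    have "ennreal (2 powr (- (r * real n))) * scale_sum p p (2 powr (w * real n) * \<epsilon>) \<le> ennreal (E * 2 powr (- ((r - w) * real n)))" for n
    proof -
      have "1 \<le> 2 powr (w * real n)" using w0 by (simp add: ge_one_powr_ge_zero)
      then have "ln (1 / (2 powr (w * real n) * \<epsilon>)) \<le> ln (1 / \<epsilon>)"
        using \<epsilon> w0 by (simp add: ln_div ln_mult)
      then have "max 0 (ln (1 / (2 powr (w * real n) * \<epsilon>))) \<le> max 0 (ln (1 / \<epsilon>))"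
        by (rule max.mono[OF order_refl])
      then have "B * (1 + max 0 (ln (1 / (2 powr (w * real n) * \<epsilon>)))) * (2 powr (w * real n) * \<epsilon>)
          \<le> B * (1 + max 0 (ln (1 / \<epsilon>))) * (2 powr (w * real n) * \<epsilon>)"
        using B \<epsilon> by (intro mult_right_mono mult_left_mono add_left_mono) auto
      then have "scale_sum p p (2 powr (w * real n) * \<epsilon>) \<le> ennreal (B * (1 + max 0 (ln (1 / \<epsilon>))) * (2 powr (w * real n) * \<epsilon>))"
        using \<epsilon> unfolding B_def by (intro order_trans[OF scale_sum_critical_le[OF p]] ennreal_leI) auto
      then have "ennreal (2 powr (- (r * real n))) * scale_sum p p (2 powr (w * real n) * \<epsilon>)
          \<le> ennreal (2 powr (- (r * real n))) * ennreal (B * (1 + max 0 (ln (1 / \<epsilon>))) * (2 powr (w * real n) * \<epsilon>))"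
        by (rule mult_left_mono) simp
      also have "\<dots> = ennreal (2 powr (- (r * real n)) * (B * (1 + max 0 (ln (1 / \<epsilon>))) * (2 powr (w * real n) * \<epsilon>)))"
        using B \<epsilon> by (simp add: ennreal_mult[symmetric])
      also have "2 powr (- (r * real n)) * (B * (1 + max 0 (ln (1 / \<epsilon>))) * (2 powr (w * real n) * \<epsilon>))
          = E * (2 powr (- (r * real n)) * 2 powr (w * real n))"
        by (simp add: E_def ac_simps)
      also have "2 powr (- (r * real n)) * 2 powr (w * real n) = 2 powr (- ((r - w) * real n))"
        unfolding powr_add[symmetric] by (simp add: algebra_simps)
      finally show ?thesis .
    qed
    then have "dyadic_sum p p r w \<epsilon> \<le> (\<Sum>n. ennreal (E * 2 powr (- ((r - w) * real n))))"
      unfolding dyadic_sum_def by (intro suminf_le summableI)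
    also have "\<dots> \<le> ennreal (E / (1 - 2 powr (- (r - w))))"
      using w B \<epsilon> by (intro suminf_geometric_le) (auto simp: E_def)
    finally show ?thesis by (simp add: E_def)
  qed
  then show ?thesis using B less1 by (intro exI[of _ "B / (1 - 2 powr (- (r - w)))"]) auto
qed

section \<open>Wasserstein rates from a mean deviation property\<close>

text \<open>A form of the concavity of \<open>x\<^sup>\<beta>\<close> with a factor \<open>2\<close>: with \<open>m\<close> the mean, \<open>x\<^sup>\<beta> \<le> m\<^sup>\<beta> + x m\<^bsup>\<beta>-1\<^esup>\<close>, by
  the first term for \<open>x \<le> m\<close> and by the second one for \<open>x > m\<close>.\<close>

lemma sum_powr_le_card:
  fixes x :: "'b \<Rightarrow> real"
  assumes fin: "finite Z" and x: "\<And>z. z \<in> Z \<Longrightarrow> 0 \<le> x z" and \<beta>: "0 < \<beta>" "\<beta> < 1"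
  shows "(\<Sum>z\<in>Z. x z powr \<beta>) \<le> 2 * real (card Z) powr (1 - \<beta>) * (\<Sum>z\<in>Z. x z) powr \<beta>"
proof (cases "(\<Sum>z\<in>Z. x z) = 0")
  case True
  then have "\<forall>z\<in>Z. x z = 0"
    using fin x by (simp add: sum_nonneg_eq_0_iff)
  then show ?thesis using \<beta> by simp
next
  case False
  define S where "S = (\<Sum>z\<in>Z. x z)"
  have S: "S > 0" using False x by (simp add: S_def sum_nonneg less_le)
  define c where "c = real (card Z)"
  have c: "c > 0" using False fin by (auto simp: c_def card_gt_0_iff)
  define m where "m = S / c"
  have m: "m > 0" using S c by (simp add: m_def)
  have "x z powr \<beta> \<le> m powr \<beta> + x z * m powr (\<beta> - 1)" if "z \<in> Z" for z
  proof (cases "x z \<le> m")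
    case True
    then have "x z powr \<beta> \<le> m powr \<beta>" using x[OF that] \<beta> by (intro powr_mono2) auto
    then show ?thesis using x[OF that] by (simp add: add_increasing2)
  next
    case False
    then have xz: "x z > m" "x z > 0" using m by auto
    have "x z powr \<beta> = x z * x z powr (\<beta> - 1)"
      using xz by (simp add: powr_diff)
    also have "\<dots> \<le> x z * m powr (\<beta> - 1)"
      using xz m \<beta> by (intro mult_left_mono powr_mono2') auto
    finally show ?thesis using powr_ge_zero[of m \<beta>] by linarith
  qed
  then have "(\<Sum>z\<in>Z. x z powr \<beta>) \<le> (\<Sum>z\<in>Z. m powr \<beta> + x z * m powr (\<beta> - 1))"
    by (rule sum_mono)
  also have "\<dots> = c * m powr \<beta> + S * m powr (\<beta> - 1)"
    by (simp add: sum.distrib sum_distrib_right[symmetric] c_def S_def)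
  also have "S * m powr (\<beta> - 1) = c * m powr \<beta>"
    using c S m by (simp add: m_def powr_diff)
  also have "c * m powr \<beta> = c powr (1 - \<beta>) * S powr \<beta>"
    using c S by (simp add: m_def powr_divide powr_diff)
  finally show ?thesis by (simp add: c_def S_def mult_ac)
qed

lemma shell_tail:
  fixes \<mu> :: "'a::euclidean_space measure"
  assumes prob: "prob_space \<mu>" and s: "sets \<mu> = sets borel" and q: "q > 0" and m: "abs_moment \<mu> q \<le> ennreal m" "1 \<le> m"
  shows "measure \<mu> (shell -` {n}) \<le> 2 powr q * m * 2 powr (- (q * real n))"
proof (cases n)
  case 0
  interpret prob_space \<mu> by fact
  have "1 \<le> 2 powr q" using q by (simp add: ge_one_powr_ge_zero)
  then have "1 * 1 \<le> 2 powr q * m" using m by (intro mult_mono) auto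
  then show ?thesis using order_trans[OF prob_le_1[of "shell -` {0}"]] 0 by simp
next
  case (Suc k)
  interpret prob_space \<mu> by fact
  note [measurable_cong] = s
  have shm: "shell -` {n} \<in> sets borel"
    using measurable_sets[OF measurable_shell, of "{n}"] by simp
  have "ennreal (2 powr (q * real k)) * emeasure \<mu> (shell -` {n}) = (\<integral>\<^sup>+x. ennreal (2 powr (q * real k)) * indicator (shell -` {n}) x \<partial>\<mu>)"
    by (subst nn_integral_cmult_indicator) (simp_all add: shm s)
  also have "\<dots> \<le> (\<integral>\<^sup>+x. ennreal (norm x powr q) \<partial>\<mu>)"
  proof (rule nn_integral_mono)
    fix x :: 'a
    have "2 powr (q * real k) \<le> norm x powr q" if "shell x = n"
    proof -
      have "2 ^ k \<le> norm x" using shell_less_norm[of k x] that Suc by simp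
      then have "(2 ^ k) powr q \<le> norm x powr q" using q by (intro powr_mono2) auto
      then show ?thesis by (simp add: powr_realpow[symmetric] powr_powr mult.commute)
    qed
    then show "ennreal (2 powr (q * real k)) * indicator (shell -` {n}) x \<le> ennreal (norm x powr q)"
      by (auto simp: indicator_def ennreal_leI)
  qed
  also have "\<dots> \<le> ennreal m" using m(1) by (simp add: abs_moment_def)
  finally have "2 powr (q * real k) * measure \<mu> (shell -` {n}) \<le> m"
    using m(2) by (simp add: emeasure_eq_measure ennreal_mult[symmetric])
  then have "2 powr (- (q * real k)) * (2 powr (q * real k) * measure \<mu> (shell -` {n})) \<le> 2 powr (- (q * real k)) * m"
    by (rule mult_left_mono) simp
  moreover have "2 powr (- (q * real k)) * (2 powr (q * real k) * measure \<mu> (shell -` {n})) = measure \<mu> (shell -` {n})"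
    by (simp add: mult.assoc[symmetric] powr_add[symmetric])
  moreover have "2 powr (- (q * real k)) * m = 2 powr q * m * 2 powr (- (q * real n))"
  proof -
    have "2 powr (- (q * real k)) = 2 powr q * 2 powr (- (q * real n))"
      unfolding powr_add[symmetric] Suc by (simp add: algebra_simps)
    then show ?thesis by simp
  qed
  ultimately show ?thesis by simp
qed

text \<open>The two arguments of the minimum on the right come from the additivity of \<open>\<mu>\<close> and from
  \<open>sum_powr_le_card\<close> over the at most \<open>(3 2\<^sup>l)\<^sup>d\<close> cells, combined with the tail of the shells.\<close>

lemma shell_cells_sum_le:
  fixes \<mu> :: "'a::euclidean_space measure" and \<beta> :: real
  defines "a \<equiv> real DIM('a) * (1 - \<beta>)"
  assumes prob: "prob_space \<mu>" and s: "sets \<mu> = sets borel"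
    and q: "q > 0" and m: "abs_moment \<mu> q \<le> ennreal m" "1 \<le> m" and \<beta>: "0 < \<beta>" "\<beta> < 1" and \<epsilon>: "0 < \<epsilon>"
  shows "(\<Sum>zs\<in>grid DIM('a) l. min (measure \<mu> (dyadic_label l -` {(n, zs)})) (measure \<mu> (dyadic_label l -` {(n, zs)}) powr \<beta> * \<epsilon>))
    \<le> 2 * 3 powr a * (2 powr q * m) * (2 powr (- (q * real n)) * min 1 (2 powr (a * real l) * (2 powr (q * (1 - \<beta>) * real n) * \<epsilon>)))"
proof -
  interpret prob_space \<mu> by fact
  define F where "F = (\<lambda>zs. measure \<mu> ((dyadic_label l :: 'a \<Rightarrow> _) -` {(n, zs)}))"
  define Z where "Z = grid DIM('a) l"
  define P where "P = (\<Sum>zs\<in>Z. F zs)"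
  define B where "B = 2 powr q * m * 2 powr (- (q * real n))"
  have fin: "finite Z" by (simp add: Z_def finite_grid)
  have shm: "(shell :: 'a \<Rightarrow> nat) -` {n} \<in> sets \<mu>"
    using measurable_sets[OF measurable_shell, of "{n}"] by (simp add: s)
  have "P = measure \<mu> (\<Union>zs\<in>Z. dyadic_label l -` {(n, zs)})"
    unfolding P_def F_def using fin
    by (intro finite_measure_finite_Union[symmetric]) (auto simp: s sets_dyadic_cell disjoint_family_on_def)
  also have "\<dots> \<le> measure \<mu> (shell -` {n})"
    using shm by (intro finite_measure_mono) (auto simp: dyadic_label_def)
  also have "\<dots> \<le> B"
    unfolding B_def by (rule shell_tail[OF prob s q m])
  finally have PB: "P \<le> B" .
  have P0: "0 \<le> P" unfolding P_def F_def by (intro sum_nonneg) simp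
  have "1 \<le> 2 powr q" using q by (simp add: ge_one_powr_ge_zero)
  then have "1 * 1 \<le> 2 powr q * m" using m by (intro mult_mono) auto
  then have M1: "1 \<le> 2 powr q * m" by simp
  have a0: "0 \<le> a" using \<beta> by (simp add: a_def)
  have sP: "(\<Sum>zs\<in>Z. min (F zs) (F zs powr \<beta> * \<epsilon>)) \<le> P"
    unfolding P_def by (intro sum_mono) simp
  have s1: "(\<Sum>zs\<in>Z. min (F zs) (F zs powr \<beta> * \<epsilon>)) \<le> 2 * 3 powr a * (2 powr q * m) * 2 powr (- (q * real n))"
  proof -
    have "1 * B \<le> (2 * 3 powr a) * B"
      using ge_one_powr_ge_zero[of 3 a] a0 m by (intro mult_right_mono) (auto simp: B_def)
    moreover have "2 * 3 powr a * (2 powr q * m) * 2 powr (- (q * real n)) = (2 * 3 powr a) * B"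
      by (simp add: B_def mult.assoc)
    ultimately show ?thesis using PB sP by linarith
  qed
  have "(\<Sum>zs\<in>Z. min (F zs) (F zs powr \<beta> * \<epsilon>)) \<le> (\<Sum>zs\<in>Z. F zs powr \<beta>) * \<epsilon>"
    unfolding sum_distrib_right by (intro sum_mono) simp
  also have "\<dots> \<le> 2 * real (card Z) powr (1 - \<beta>) * P powr \<beta> * \<epsilon>"
    using \<epsilon> \<beta> fin unfolding P_def by (intro mult_right_mono sum_powr_le_card) (auto simp: F_def)
  also have "\<dots> \<le> 2 * (3 powr a * 2 powr (a * real l)) * ((2 powr q * m) * 2 powr (- (q * \<beta> * real n))) * \<epsilon>"
  proof (intro mult_right_mono mult_mono mult_left_mono)
    have "real (card Z) powr (1 - \<beta>) \<le> ((3 * 2 ^ l) ^ DIM('a)) powr (1 - \<beta>)"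
      using \<beta> card_grid_le unfolding Z_def by (intro powr_mono2) auto
    also have "\<dots> = 3 powr a * 2 powr (a * real l)"
      by (simp add: a_def powr_mult powr_realpow[symmetric] powr_powr ac_simps power_mult_distrib)
    finally show "real (card Z) powr (1 - \<beta>) \<le> 3 powr a * 2 powr (a * real l)" .
    have "P powr \<beta> \<le> B powr \<beta>" using PB P0 \<beta> by (intro powr_mono2) auto
    also have "\<dots> = (2 powr q * m) powr \<beta> * 2 powr (- (q * \<beta> * real n))"
      using M1 m by (simp add: B_def powr_mult powr_powr ac_simps)
    also have "(2 powr q * m) powr \<beta> \<le> (2 powr q * m) powr 1"
      using M1 \<beta> by (intro powr_mono) auto
    finally show "P powr \<beta> \<le> (2 powr q * m) * 2 powr (- (q * \<beta> * real n))"
      using M1 by (simp add: mult_right_mono)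
  qed (use \<epsilon> m in auto)
  also have "\<dots> = 2 * 3 powr a * (2 powr q * m) * (2 powr (- (q * real n)) * (2 powr (a * real l) * (2 powr (q * (1 - \<beta>) * real n) * \<epsilon>)))"
  proof -
    have "2 powr (- (q * \<beta> * real n)) = 2 powr (- (q * real n)) * 2 powr (q * (1 - \<beta>) * real n)"
      unfolding powr_add[symmetric] by (simp add: algebra_simps)
    then show ?thesis by (simp add: ac_simps)
  qed
  finally have s2: "(\<Sum>zs\<in>Z. min (F zs) (F zs powr \<beta> * \<epsilon>)) \<le> \<dots>" .
  show ?thesis
    using s1 s2 unfolding Z_def F_def
    by (cases "1 \<le> 2 powr (a * real l) * (2 powr (q * (1 - \<beta>) * real n) * \<epsilon>)") (auto simp: min_def)
qed

lemma borel_measurable_nn_integral_count_space: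
  fixes f :: "'i::countable \<Rightarrow> 'b \<Rightarrow> ennreal"
  assumes [measurable]: "\<And>i. f i \<in> borel_measurable M"
  shows "(\<lambda>\<omega>. \<integral>\<^sup>+i. f i \<omega> \<partial>count_space UNIV) \<in> borel_measurable M"
proof -
  have "(\<lambda>z. f (snd z) (fst z)) \<in> borel_measurable (M \<Otimes>\<^sub>M count_space UNIV)"
    by (rule measurable_compose_countable[where g=snd]) measurable
  from sigma_finite_measure.borel_measurable_nn_integral_fst[OF sigma_finite_measure_count_space this]
  show ?thesis by simp
qed

text \<open>The constant \<open>K\<close> absorbs the moment of \<open>\<pi>\<close>, which is the same for all \<open>t \<ge> t0\<close>.\<close>

lemma expected_wasserstein_le_dyadic_sum:
  fixes \<nu> :: "'a::euclidean_space measure"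
  assumes p: "0 < p" "p < q" and \<beta>: "0 < \<beta>" "\<beta> < 1" and t0: "0 < t0"
    and N: "\<And>t. t \<ge> t0 \<Longrightarrow> N t \<in> M \<rightarrow>\<^sub>M prob_algebra borel"
    and \<nu>: "prob_space \<nu>" "sets \<nu> = sets borel" and mom: "abs_moment \<nu> p < \<top>"
    and A: "property_A M N \<nu> \<pi> t0 \<beta> q \<gamma>"
  shows "\<exists>K>0. \<forall>t\<ge>t0. (\<integral>\<^sup>+\<omega>. ennreal_powr (wasserstein p (N t \<omega>) \<nu>) p \<partial>M)
    \<le> ennreal K * dyadic_sum p (real DIM('a) * (1 - \<beta>)) (q - p) (q * (1 - \<beta>)) (t powr (- \<gamma>))"
proof -
  define a where "a = real DIM('a) * (1 - \<beta>)"
  obtain C0 :: real where C0: "C0 > 0" and dev: "\<And>t A. t \<ge> t0 \<Longrightarrow> A \<in> sets borel \<Longrightarrow>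
      (\<integral>\<^sup>+\<omega>. ennreal \<bar>measure (N t \<omega>) A - measure \<nu> A\<bar> \<partial>M)
          \<le> ennreal (C0 * min (measure (\<pi> t) A) (measure (\<pi> t) A powr \<beta> * t powr (-\<gamma>)))"
    using A unfolding property_A_def by blast
  define m where "m = enn2real (sup_moment \<pi> t0 q)"
  have m: "sup_moment \<pi> t0 q = ennreal m" using A by (simp add: m_def property_A_def)
  have "1 \<le> ennreal m" unfolding m[symmetric] sup_moment_def by simp
  then have m1: "1 \<le> m" by simp
  have q: "q > 0" using p by simp
  have \<pi>: "prob_space (\<pi> t)" "sets (\<pi> t) = sets borel" "abs_moment (\<pi> t) q \<le> ennreal m" if "t \<ge> t0" for t
  proof -
    show "prob_space (\<pi> t)" "sets (\<pi> t) = sets borel"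
      using A that unfolding property_A_def by auto
    show "abs_moment (\<pi> t) q \<le> ennreal m"
      unfolding m[symmetric] sup_moment_def using that by (intro max.coboundedI2 SUP_upper) simp
  qed
  define C where "C = real (2 * DIM('a)) powr p"
  define K where "K = C * (C0 * (2 * 3 powr a * (2 powr q * m)))"
  have C: "C > 0" by (simp add: C_def)
  have K: "K > 0" using C C0 m1 by (simp add: K_def)
  have "(\<integral>\<^sup>+\<omega>. ennreal_powr (wasserstein p (N t \<omega>) \<nu>) p \<partial>M) \<le> ennreal K * dyadic_sum p a (q - p) (q * (1 - \<beta>)) (t powr (- \<gamma>))"
    if t: "t \<ge> t0" for t
  proof -
    define \<epsilon> where "\<epsilon> = t powr (- \<gamma>)"
    have \<epsilon>: "\<epsilon> > 0" using t t0 by (simp add: \<epsilon>_def)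
    note [measurable] = N[OF t]
    define cell where "cell = (\<lambda>l i. (dyadic_label l :: 'a \<Rightarrow> _) -` {i})"
    have [measurable]: "cell l i \<in> sets borel" for l i by (simp add: cell_def sets_dyadic_cell)
    define wt where "wt = (\<lambda>l (i::nat \<times> int list). ennreal (2 powr (p * (real (fst i) - real l))))"
    have meas [measurable]: "(\<lambda>\<omega>. ennreal \<bar>measure (N t \<omega>) (cell l i) - measure \<nu> (cell l i)\<bar>) \<in> borel_measurable M" for l i
    proof -
      have [measurable]: "(\<lambda>\<omega>. measure (N t \<omega>) (cell l i)) \<in> borel_measurable M"
        by (rule measure_measurable_prob_algebra2[OF _ N[OF t]]) simp
      show ?thesis by measurable
    qed
    have "(\<integral>\<^sup>+\<omega>. ennreal_powr (wasserstein p (N t \<omega>) \<nu>) p \<partial>M)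
      \<le> (\<integral>\<^sup>+\<omega>. ennreal C * (\<Sum>l. \<integral>\<^sup>+i. wt l i * ennreal \<bar>measure (N t \<omega>) (cell l i) - measure \<nu> (cell l i)\<bar> \<partial>count_space UNIV) \<partial>M)"
    proof (rule nn_integral_mono)
      fix \<omega> assume "\<omega> \<in> space M"
      then have "prob_space (N t \<omega>)" "sets (N t \<omega>) = sets borel"
        using measurable_space[OF N[OF t]] by (auto simp: space_prob_algebra)
      from wasserstein_dyadic_bound[OF p(1) this(1) \<nu>(1) this(2) \<nu>(2) mom]
      show "ennreal_powr (wasserstein p (N t \<omega>) \<nu>) p \<le> ennreal C * (\<Sum>l. \<integral>\<^sup>+i. wt l i * ennreal \<bar>measure (N t \<omega>) (cell l i) - measure \<nu> (cell l i)\<bar> \<partial>count_space UNIV)"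
        unfolding C_def wt_def cell_def .
    qed
    also have "\<dots> = ennreal C * (\<Sum>l. \<integral>\<^sup>+\<omega>. \<integral>\<^sup>+i. wt l i * ennreal \<bar>measure (N t \<omega>) (cell l i) - measure \<nu> (cell l i)\<bar> \<partial>count_space UNIV \<partial>M)"
    proof -
      have [measurable]: "(\<lambda>\<omega>. \<integral>\<^sup>+i. wt l i * ennreal \<bar>measure (N t \<omega>) (cell l i) - measure \<nu> (cell l i)\<bar> \<partial>count_space UNIV) \<in> borel_measurable M" for l
        by (rule borel_measurable_nn_integral_count_space) measurable
      show ?thesis
        by (subst nn_integral_cmult, measurable) (subst nn_integral_suminf, simp_all)
    qed
    also have "\<dots> = ennreal C * (\<Sum>l. \<integral>\<^sup>+i. wt l i * (\<integral>\<^sup>+\<omega>. ennreal \<bar>measure (N t \<omega>) (cell l i) - measure \<nu> (cell l i)\<bar> \<partial>M) \<partial>count_space UNIV)"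
      by (subst nn_integral_count_space_nn_integral) (simp_all add: nn_integral_cmult)
    also have "\<dots> \<le> ennreal C * (\<Sum>l. \<integral>\<^sup>+i. wt l i * ennreal (C0 * min (measure (\<pi> t) (cell l i)) (measure (\<pi> t) (cell l i) powr \<beta> * \<epsilon>)) \<partial>count_space UNIV)"
      unfolding \<epsilon>_def by (intro mult_left_mono suminf_le summableI nn_integral_mono dev t) auto
    also have "\<dots> = ennreal C * (\<Sum>l. \<integral>\<^sup>+n. \<integral>\<^sup>+zs. wt l (n, zs) * ennreal (C0 * min (measure (\<pi> t) (cell l (n, zs))) (measure (\<pi> t) (cell l (n, zs)) powr \<beta> * \<epsilon>)) \<partial>count_space UNIV \<partial>count_space UNIV)"
      by (subst nn_integral_fst_count_space[symmetric]) (rule refl)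
    also have "\<dots> \<le> ennreal C * (\<Sum>l. \<integral>\<^sup>+n. ennreal (C0 * (2 * 3 powr a * (2 powr q * m))) *
        (ennreal (2 powr (- ((q - p) * real n))) * ennreal (2 powr (- (p * real l)) * min 1 (2 powr (a * real l) * (2 powr (q * (1 - \<beta>) * real n) * \<epsilon>)))) \<partial>count_space UNIV)"
    proof (intro mult_left_mono suminf_le summableI nn_integral_mono)
      fix l n
      define f where "f = (\<lambda>zs. min (measure (\<pi> t) (cell l (n, zs))) (measure (\<pi> t) (cell l (n, zs)) powr \<beta> * \<epsilon>))"
      have f0: "0 \<le> f zs" for zs using \<epsilon> by (simp add: f_def)
      define w where "w = 2 powr (p * (real n - real l))"
      have "(\<integral>\<^sup>+zs. wt l (n, zs) * ennreal (C0 * f zs) \<partial>count_space UNIV) = (\<Sum>zs\<in>grid DIM('a) l. wt l (n, zs) * ennreal (C0 * f zs))"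
      proof (rule nn_integral_count_space')
        fix zs assume "zs \<notin> grid DIM('a) l"
        then have "cell l (n, zs) = {}"
          using snd_dyadic_label_in_grid[where ?'a='a, of l] unfolding cell_def by (auto simp: vimage_def) (metis snd_conv)
        then show "wt l (n, zs) * ennreal (C0 * f zs) = 0" using \<epsilon> by (simp add: f_def)
      qed (simp_all add: finite_grid)
      also have "\<dots> = ennreal (w * C0 * (\<Sum>zs\<in>grid DIM('a) l. f zs))"
        using f0 C0 by (simp add: wt_def w_def ennreal_mult[symmetric] sum_nonneg sum_ennreal sum_distrib_left mult.assoc)
      also have "\<dots> \<le> ennreal (w * C0 * (2 * 3 powr a * (2 powr q * m) * (2 powr (- (q * real n)) * min 1 (2 powr (a * real l) * (2 powr (q * (1 - \<beta>) * real n) * \<epsilon>)))))"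
        unfolding f_def cell_def a_def
        by (intro ennreal_leI mult_left_mono shell_cells_sum_le \<pi> t q m1 \<beta> \<epsilon>) (use C0 in \<open>auto simp: w_def\<close>)
      also have "w * C0 * (2 * 3 powr a * (2 powr q * m) * (2 powr (- (q * real n)) * min 1 (2 powr (a * real l) * (2 powr (q * (1 - \<beta>) * real n) * \<epsilon>))))
         = C0 * (2 * 3 powr a * (2 powr q * m)) * ((w * 2 powr (- (q * real n))) * min 1 (2 powr (a * real l) * (2 powr (q * (1 - \<beta>) * real n) * \<epsilon>)))"
        by (simp only: ac_simps)
      also have "w * 2 powr (- (q * real n)) = 2 powr (- ((q - p) * real n)) * 2 powr (- (p * real l))"
        unfolding w_def powr_add[symmetric] by (simp add: algebra_simps)
      finally show "(\<integral>\<^sup>+zs. wt l (n, zs) * ennreal (C0 * min (measure (\<pi> t) (cell l (n, zs))) (measure (\<pi> t) (cell l (n, zs)) powr \<beta> * \<epsilon>)) \<partial>count_space UNIV)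
         \<le> ennreal (C0 * (2 * 3 powr a * (2 powr q * m))) *
        (ennreal (2 powr (- ((q - p) * real n))) * ennreal (2 powr (- (p * real l)) * min 1 (2 powr (a * real l) * (2 powr (q * (1 - \<beta>) * real n) * \<epsilon>))))"
        using C0 m1 \<epsilon> by (simp add: ennreal_mult[symmetric] f_def mult.assoc)
    qed auto
    also have "\<dots> = ennreal C * (ennreal (C0 * (2 * 3 powr a * (2 powr q * m))) * (\<integral>\<^sup>+n. (\<Sum>l. ennreal (2 powr (- ((q - p) * real n))) *
         ennreal (2 powr (- (p * real l)) * min 1 (2 powr (a * real l) * (2 powr (q * (1 - \<beta>) * real n) * \<epsilon>)))) \<partial>count_space UNIV))"
      by (subst nn_integral_suminf[symmetric], simp, subst nn_integral_cmult[symmetric], simp, subst ennreal_suminf_cmult) simp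
    also have "\<dots> = ennreal K * dyadic_sum p a (q - p) (q * (1 - \<beta>)) \<epsilon>"
      using C C0 m1 by (simp add: dyadic_sum_def scale_sum_def nn_integral_count_space_nat K_def ennreal_mult mult.assoc)
    finally show ?thesis by (simp add: \<epsilon>_def)
  qed
  with K show ?thesis unfolding a_def by blast
qed

text \<open>The moment factor in \<open>wasserstein_rate\<close> is at least \<open>1\<close> and can only enlarge the right-hand side.\<close>

lemma wasserstein_rateI:
  assumes K: "K > 0" and le: "\<And>t. t \<ge> t0 \<Longrightarrow> (\<integral>\<^sup>+\<omega>. ennreal_powr (wasserstein p (N t \<omega>) \<nu>) p \<partial>M) \<le> ennreal (K * r t)"
  shows "wasserstein_rate M N \<nu> \<pi> q p t0 r"
  unfolding wasserstein_rate_def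
proof (intro exI[of _ K] conjI allI impI K)
  fix t assume t: "t0 \<le> t"
  have "1 \<le> sup_moment \<pi> t0 q" by (simp add: sup_moment_def)
  then have "ennreal K * 1 * ennreal (r t) \<le> ennreal K * sup_moment \<pi> t0 q * ennreal (r t)"
    by (intro mult_right_mono mult_left_mono) auto
  then show "(\<integral>\<^sup>+\<omega>. ennreal_powr (wasserstein p (N t \<omega>) \<nu>) p \<partial>M) \<le> ennreal K * sup_moment \<pi> t0 q * ennreal (r t)"
    using le[OF t] K by (simp add: ennreal_mult')
qed

text \<open>The comparison of \<open>p\<close> with \<open>d (1 - \<beta>)\<close> selects the exponent \<open>\<theta>\<close> of the sum over scales, and the
  comparison of \<open>q (1 - \<beta>) \<theta>\<close> with \<open>q - p\<close> decides which shells dominate.\<close>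

lemma wasserstein_rates_of_property_A:
  fixes \<nu> :: "'a::euclidean_space measure"
  defines "d \<equiv> real DIM('a)"
  assumes p: "0 < p" "p < q" and \<beta>: "0 < \<beta>" "\<beta> < 1" and t0: "0 < t0" and \<gamma>: "0 < \<gamma>" "\<gamma> \<le> 1 / 2"
    and N: "\<And>t. t \<ge> t0 \<Longrightarrow> N t \<in> M \<rightarrow>\<^sub>M prob_algebra borel"
    and \<nu>: "prob_space \<nu>" "sets \<nu> = sets borel" and mom: "abs_moment \<nu> p < \<top>"
    and A: "property_A M N \<nu> \<pi> t0 \<beta> q \<gamma>"
  shows "p < d * (1 - \<beta>) \<Longrightarrow> p < d * q / (d + q) \<Longrightarrow>
      wasserstein_rate M N \<nu> \<pi> q p t0 (\<lambda>t. t powr (- (\<gamma> * (p / (d * (1 - \<beta>))))))"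
    and "p < d * (1 - \<beta>) \<Longrightarrow> d * q / (d + q) < p \<Longrightarrow>
      wasserstein_rate M N \<nu> \<pi> q p t0 (\<lambda>t. t powr (- (\<gamma> * ((q - p) / (q * (1 - \<beta>))))))"
    and "p = d * (1 - \<beta>) \<Longrightarrow> \<beta> * q < p \<Longrightarrow>
      wasserstein_rate M N \<nu> \<pi> q p t0 (\<lambda>t. t powr (- (\<gamma> * ((q - p) / (q * (1 - \<beta>))))))"
    and "p = d * (1 - \<beta>) \<Longrightarrow> p < \<beta> * q \<Longrightarrow>
      wasserstein_rate M N \<nu> \<pi> q p t0 (\<lambda>t. t powr (- \<gamma>) * ln (1 + t))"
    and "d * (1 - \<beta>) < p \<Longrightarrow> p < \<beta> * q \<Longrightarrow>
      wasserstein_rate M N \<nu> \<pi> q p t0 (\<lambda>t. t powr (- \<gamma>))"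
    and "d * (1 - \<beta>) < p \<Longrightarrow> \<beta> * q < p \<Longrightarrow>
      wasserstein_rate M N \<nu> \<pi> q p t0 (\<lambda>t. t powr (- (\<gamma> * ((q - p) / (q * (1 - \<beta>))))))"
proof -
  let ?rate = "wasserstein_rate M N \<nu> \<pi> q p t0"
  define a where "a = d * (1 - \<beta>)"
  define w where "w = q * (1 - \<beta>)"
  obtain K where K: "K > 0" "\<And>t. t \<ge> t0 \<Longrightarrow> (\<integral>\<^sup>+\<omega>. ennreal_powr (wasserstein p (N t \<omega>) \<nu>) p \<partial>M)
      \<le> ennreal K * dyadic_sum p a (q - p) w (t powr (- \<gamma>))"
    using expected_wasserstein_le_dyadic_sum[OF p \<beta> t0 N \<nu> mom A] unfolding a_def d_def w_def by blast
  have d: "d > 0" by (simp add: d_def)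
  have a: "a > 0" using d \<beta> by (simp add: a_def)
  have w: "w > 0" using p \<beta> by (simp add: w_def)
  have r: "q - p > 0" using p by simp
  have rate: "?rate f"
    if "C > 0" "\<And>t. t \<ge> t0 \<Longrightarrow> dyadic_sum p a (q - p) w (t powr (- \<gamma>)) \<le> ennreal (C * f t)" for C f
  proof (rule wasserstein_rateI)
    show "0 < K * C" using K that by simp
    fix t assume t: "t0 \<le> t"
    have "ennreal K * dyadic_sum p a (q - p) w (t powr (- \<gamma>)) \<le> ennreal K * ennreal (C * f t)"
      by (intro mult_left_mono that(2) t) simp
    also have "\<dots> = ennreal (K * C * f t)"
      using K by (simp add: ennreal_mult'[symmetric] mult.assoc)
    finally show "(\<integral>\<^sup>+\<omega>. ennreal_powr (wasserstein p (N t \<omega>) \<nu>) p \<partial>M) \<le> ennreal (K * C * f t)"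
      using K(2)[OF t] by (rule order_trans[rotated])
  qed
  have powr: "(t powr (- \<gamma>)) powr x = t powr (- (\<gamma> * x))" for t x
    by (simp add: powr_powr)
  have fast: "?rate (\<lambda>t. t powr (- (\<gamma> * \<theta>)))"
    if \<theta>: "a < p \<and> \<theta> = 1 \<or> p < a \<and> \<theta> = p / a \<or> a = p \<and> 0 < \<theta> \<and> \<theta> < 1" and w\<theta>: "w * \<theta> < q - p" for \<theta>
  proof -
    obtain C where C: "C > 0" "\<And>\<epsilon>. \<epsilon> > 0 \<Longrightarrow> dyadic_sum p a (q - p) w \<epsilon> \<le> ennreal (C * \<epsilon> powr \<theta>)"
      using dyadic_sum_le_fast[OF p(1) a r \<theta> w\<theta>] by blast
    have "dyadic_sum p a (q - p) w (t powr (- \<gamma>)) \<le> ennreal (C * t powr (- (\<gamma> * \<theta>)))" if "t \<ge> t0" for t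
      using C(2)[of "t powr (- \<gamma>)"] that t0 by (simp add: powr)
    then show ?thesis using C(1) by (intro rate)
  qed
  have slow: "?rate (\<lambda>t. t powr (- (\<gamma> * ((q - p) / w))))"
    if \<theta>: "a < p \<and> \<theta> = 1 \<or> p < a \<and> \<theta> = p / a \<or> a = p \<and> 0 < \<theta> \<and> \<theta> < 1" and w\<theta>: "q - p < w * \<theta>" for \<theta>
  proof -
    obtain C where C: "C > 0" "\<And>\<epsilon>. \<epsilon> > 0 \<Longrightarrow> dyadic_sum p a (q - p) w \<epsilon> \<le> ennreal (C * \<epsilon> powr ((q - p) / w))"
      using dyadic_sum_le_slow[OF p(1) a r w \<theta> w\<theta>] by blast
    have "dyadic_sum p a (q - p) w (t powr (- \<gamma>)) \<le> ennreal (C * t powr (- (\<gamma> * ((q - p) / w))))" if "t \<ge> t0" for t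
      using C(2)[of "t powr (- \<gamma>)"] that t0 by (simp add: powr)
    then show ?thesis using C(1) by (intro rate)
  qed
  have wp: "w * (p / a) < q - p \<longleftrightarrow> p < d * q / (d + q)" "q - p < w * (p / a) \<longleftrightarrow> d * q / (d + q) < p"
  proof -
    have e: "w * (p / a) = q * p / d" using \<beta> d by (simp add: w_def a_def)
    then show "w * (p / a) < q - p \<longleftrightarrow> p < d * q / (d + q)" "q - p < w * (p / a) \<longleftrightarrow> d * q / (d + q) < p"
      unfolding e using d p by (simp_all add: field_simps)
  qed
  show "?rate (\<lambda>t. t powr (- (\<gamma> * (p / (d * (1 - \<beta>))))))"
    if "p < d * (1 - \<beta>)" "p < d * q / (d + q)"
    using fast[of "p / a"] that wp by (simp add: a_def)
  show "?rate (\<lambda>t. t powr (- (\<gamma> * ((q - p) / (q * (1 - \<beta>))))))"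
    if "p < d * (1 - \<beta>)" "d * q / (d + q) < p"
    using slow[of "p / a"] that wp by (simp add: a_def w_def)
  show "?rate (\<lambda>t. t powr (- (\<gamma> * ((q - p) / (q * (1 - \<beta>))))))"
    if "p = d * (1 - \<beta>)" "\<beta> * q < p"
  proof -
    have "(q - p) / w < 1" using that w by (simp add: w_def field_simps)
    \<comment> \<open>An exponent close enough to \<open>1\<close> keeps the far shells dominant.\<close>
    then obtain \<theta> where \<theta>: "(q - p) / w < \<theta>" "\<theta> < 1" using dense by blast
    moreover have "0 < (q - p) / w" using r w by simp
    ultimately have "0 < \<theta>" "\<theta> < 1" "q - p < w * \<theta>"
      using w by (linarith, linarith, simp add: field_simps)
    then show ?thesis using slow[of \<theta>] that by (simp add: a_def w_def)
  qed
  show "?rate (\<lambda>t. t powr (- \<gamma>))" if "d * (1 - \<beta>) < p" "p < \<beta> * q"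
    using fast[of 1] that by (simp add: a_def w_def algebra_simps)
  show "?rate (\<lambda>t. t powr (- (\<gamma> * ((q - p) / (q * (1 - \<beta>))))))"
    if "d * (1 - \<beta>) < p" "\<beta> * q < p"
    using slow[of 1] that by (simp add: a_def w_def algebra_simps)
  show "?rate (\<lambda>t. t powr (- \<gamma>) * ln (1 + t))"
    if "p = d * (1 - \<beta>)" "p < \<beta> * q"
  proof -
    have ap: "a = p" using that by (simp add: a_def)
    have "w < q - p" using that by (simp add: w_def algebra_simps)
    then obtain C where C: "C > 0" "\<And>\<epsilon>. \<epsilon> > 0 \<Longrightarrow> dyadic_sum p a (q - p) w \<epsilon> \<le> ennreal (C * ((1 + max 0 (ln (1 / \<epsilon>))) * \<epsilon>))"
      using dyadic_sum_critical_le[OF p(1) w, of "q - p"] unfolding ap by blast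
    define c where "c = 1 / ln (1 + t0)"
    have c: "c > 0" using t0 by (simp add: c_def)
    show ?thesis
    proof (rule rate)
      show "0 < C * (c + 1)" using C c by simp
      fix t assume t: "t0 \<le> t"
      have "1 \<le> c * ln (1 + t)" using t t0 by (simp add: c_def)
      moreover have "max 0 (ln (1 / t powr (- \<gamma>))) \<le> ln (1 + t)"
      proof -
        have "ln (1 / t powr (- \<gamma>)) = \<gamma> * ln t" using t t0 by (simp add: ln_div ln_powr)
        also have "\<dots> \<le> ln (1 + t)"
        proof (cases "t \<ge> 1")
          case True
          then have "\<gamma> * ln t \<le> 1 * ln t" using \<gamma> by (intro mult_right_mono) auto
          moreover have "ln t \<le> ln (1 + t)" using True by simp
          ultimately show ?thesis by linarith
        next
          case False
          then have "\<gamma> * ln t \<le> 0" using t t0 \<gamma> by (simp add: mult_nonneg_nonpos)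
          moreover have "0 \<le> ln (1 + t)" using t t0 by simp
          ultimately show ?thesis by linarith
        qed
        finally show ?thesis using t t0 by simp
      qed
      ultimately have "1 + max 0 (ln (1 / t powr (- \<gamma>))) \<le> (c + 1) * ln (1 + t)"
        unfolding distrib_right by linarith
      then have "C * ((1 + max 0 (ln (1 / t powr (- \<gamma>)))) * t powr (- \<gamma>)) \<le> C * ((c + 1) * ln (1 + t) * t powr (- \<gamma>))"
        using C by (intro mult_left_mono mult_right_mono) auto
      also have "\<dots> = C * (c + 1) * (t powr (- \<gamma>) * ln (1 + t))" by (simp only: ac_simps)
      finally show "dyadic_sum p a (q - p) w (t powr (- \<gamma>)) \<le> ennreal (C * (c + 1) * (t powr (- \<gamma>) * ln (1 + t)))"
        using t t0 by (intro order_trans[OF C(2)] ennreal_leI) auto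
    qed
  qed
qed

section \<open>Mixing processes and their occupation measures\<close>

text \<open>The standing hypotheses, with the exponent \<open>q\<close> as a parameter: when all moments are finite, the
  locale is interpreted for other values of \<open>q\<close>.\<close>

locale mixing_process = stochastic_basis M F
  for M :: "'w measure" and F :: "real \<Rightarrow> 'w measure" +
  fixes X :: "real \<Rightarrow> 'w \<Rightarrow> 'a::euclidean_space"
    and \<nu> :: "'a measure" and \<kappa> :: "real \<Rightarrow> real \<Rightarrow> 'w \<Rightarrow> 'a measure"
    and \<Upsilon> :: "real \<Rightarrow> real \<Rightarrow> 'w \<Rightarrow> real" and e :: "real \<Rightarrow> real" and q \<gamma> :: real
  assumes process: "adapted_right_cont M F X"
    and q: "1 < q"
    and \<gamma>: "0 < \<gamma>" "\<gamma> \<le> 1 / 2"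
    and \<nu>: "prob_space \<nu>" "sets \<nu> = sets borel"
    and e_meas: "e \<in> borel_measurable (restrict_space borel {0..})"
    and e_nonneg: "\<forall>u\<ge>0. 0 \<le> e u"
    and e_bounded: "bounded (e ` {0..})"
    and \<Upsilon>_meas: "\<forall>s\<ge>0. (\<lambda>(t, \<omega>). \<Upsilon> t s \<omega>) \<in> borel_measurable (restrict_space borel {s..} \<Otimes>\<^sub>M F s)"
    and \<Upsilon>_nonneg: "\<forall>s\<ge>0. \<forall>t\<ge>s. \<forall>\<omega>\<in>space M. 0 \<le> \<Upsilon> t s \<omega>"
    and cond_law: "\<forall>s\<ge>0. \<forall>t\<ge>s. regular_cond_distr M (F s) (X t) (\<kappa> t s)"
    and tv_mixing: "\<forall>s\<ge>0. \<forall>t\<ge>s. AE \<omega> in M. tv_dist (\<kappa> t s \<omega>) \<nu> \<le> \<Upsilon> t s \<omega> * e (t - s)"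
    and e_rate: "(\<lambda>t. LINT s:{0..t}|lborel. e s) \<in> O[at_top](\<lambda>t. t powr (1 - 2 * \<gamma>))"
    and C_finite: "C_const M X \<Upsilon> q < \<top>"
begin

text \<open>Freezing the path at negative times makes it right continuous on the whole line, so that all
  measurability questions concern \<open>borel\<close>; \<open>ep\<close> extends \<open>e\<close> evenly for the same purpose.\<close>

definition Xp :: "real \<Rightarrow> 'w \<Rightarrow> 'a" where "Xp s = X (max 0 s)"

definition ep :: "real \<Rightarrow> real" where "ep u = e \<bar>u\<bar>"

definition Cq :: real where "Cq = enn2real (C_const M X \<Upsilon> q)"

lemma measurable_X_F: "0 \<le> t \<Longrightarrow> X t \<in> borel_measurable (F t)"
  using process by (auto simp: adapted_right_cont_def)

lemma measurable_F_M: "0 \<le> t \<Longrightarrow> f \<in> measurable (F t) N \<Longrightarrow> f \<in> measurable M N"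
  using measurable_from_subalg[OF subalg_F] by blast

lemma measurable_Xp [measurable]: "Xp t \<in> borel_measurable M"
  unfolding Xp_def by (rule measurable_F_M[OF _ measurable_X_F]) simp_all

text \<open>The path is the pointwise limit of the step processes that read \<open>X\<close> at the next point of a grid
  strictly to the right; right continuity makes them converge.\<close>

lemma joint_measurable [measurable]: "(\<lambda>z. Xp (fst z) (snd z)) \<in> borel_measurable (borel \<Otimes>\<^sub>M M)"
proof (rule borel_measurable_LIMSEQ_metric)
  define g where "g = (\<lambda>(n::nat) s. (\<lfloor>real (Suc n) * max 0 s\<rfloor> + 1) / real (Suc n))"
  show "(\<lambda>z. Xp (g n (fst z)) (snd z)) \<in> borel_measurable (borel \<Otimes>\<^sub>M M)" for n
  proof -
    have "(\<lambda>z. (\<lambda>k z. Xp ((real_of_int k + 1) / real (Suc n)) (snd z)) \<lfloor>real (Suc n) * max 0 (fst z)\<rfloor> z) \<in> borel_measurable (borel \<Otimes>\<^sub>M M)"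
      by (rule measurable_compose_countable) measurable
    then show ?thesis by (simp add: g_def)
  qed
  fix z :: "real \<times> 'w" assume z: "z \<in> space (borel \<Otimes>\<^sub>M M)"
  define s where "s = max 0 (fst z)"
  have gs: "s < g n (fst z)" "g n (fst z) \<le> s + 1 / real (Suc n)" for n
  proof -
    have "s < (\<lfloor>m * s\<rfloor> + 1) / m" "(\<lfloor>m * s\<rfloor> + 1) / m \<le> s + 1 / m" if "0 < m" for m :: real
    proof -
      have "m * s < \<lfloor>m * s\<rfloor> + 1" "\<lfloor>m * s\<rfloor> + 1 \<le> m * s + 1" by linarith+
      then show "s < (\<lfloor>m * s\<rfloor> + 1) / m" "(\<lfloor>m * s\<rfloor> + 1) / m \<le> s + 1 / m"
        using that by (simp_all add: field_simps)
    qed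
    from this[of "real (Suc n)"] show "s < g n (fst z)" "g n (fst z) \<le> s + 1 / real (Suc n)"
      unfolding g_def s_def[symmetric] by simp_all
  qed
  have lim: "(\<lambda>n. g n (fst z)) \<longlonglongrightarrow> s"
  proof (rule tendsto_sandwich[where f="\<lambda>_. s" and h="\<lambda>n. s + 1 / real (Suc n)"])
    show "(\<lambda>n. s + 1 / real (Suc n)) \<longlonglongrightarrow> s"
      using tendsto_add[OF tendsto_const[of s] LIMSEQ_inverse_real_of_nat] by (simp add: inverse_eq_divide)
    show "\<forall>\<^sub>F n in sequentially. s \<le> g n (fst z)"
      by (rule always_eventually) (use gs(1) in \<open>blast intro: less_imp_le\<close>)
    show "\<forall>\<^sub>F n in sequentially. g n (fst z) \<le> s + 1 / real (Suc n)"
      by (rule always_eventually) (use gs(2) in blast)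
  qed simp
  have "s \<ge> 0" by (simp add: s_def)
  then have "((\<lambda>u. X u (snd z)) \<longlongrightarrow> X s (snd z)) (at_right s)"
    using process z unfolding adapted_right_cont_def by (auto simp: continuous_within space_pair_measure)
  moreover have "filterlim (\<lambda>n. g n (fst z)) (at_right s) sequentially"
    unfolding filterlim_at using lim gs(1) by (auto intro!: always_eventually simp: less_imp_neq[symmetric])
  ultimately have "(\<lambda>n. X (g n (fst z)) (snd z)) \<longlonglongrightarrow> X s (snd z)"
    by (rule filterlim_compose)
  moreover have "max 0 (g n (fst z)) = g n (fst z)" for n
    using gs(1)[of n] \<open>s \<ge> 0\<close> by simp
  ultimately show "(\<lambda>n. Xp (g n (fst z)) (snd z)) \<longlonglongrightarrow> Xp (fst z) (snd z)"
    by (simp add: Xp_def s_def)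
qed

lemma measurable_path [measurable]: "\<omega> \<in> space M \<Longrightarrow> (\<lambda>s. Xp s \<omega>) \<in> borel_measurable borel"
  using measurable_compose[OF measurable_Pair2' joint_measurable] by simp

abbreviation U :: "real \<Rightarrow> real measure" where "U t \<equiv> uniform_measure lborel {0..t}"

lemma prob_space_U: "0 < t \<Longrightarrow> prob_space (U t)"
  by (rule prob_space_uniform_measure) auto

text \<open>The occupation measure is the law of the path at a uniformly distributed time.\<close>

lemma occ_measure_eq:
  assumes t: "0 < t" and \<omega>: "\<omega> \<in> space M"
  shows "occ_measure X t \<omega> = distr (U t) borel (\<lambda>s. Xp s \<omega>)"
proof (rule measure_eqI)
  fix A assume "A \<in> sets (occ_measure X t \<omega>)"
  then have A [measurable]: "A \<in> sets borel" by (simp add: occ_measure_def)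
  note [measurable] = measurable_path[OF \<omega>]
  have p: "(\<lambda>s. X s \<omega>) \<in> borel_measurable (restrict_space lborel {0..t})"
  proof -
    have "(\<lambda>s. Xp s \<omega>) \<in> borel_measurable (restrict_space lborel {0..t})"
      by (rule measurable_restrict_space1) simp
    then show ?thesis
      by (rule measurable_cong[THEN iffD1, rotated]) (auto simp: Xp_def space_restrict_space max_def)
  qed
  have "(\<lambda>s. X s \<omega>) -` A \<inter> {0..t} = {0..t} \<inter> (\<lambda>s. Xp s \<omega>) -` A"
    by (auto simp: Xp_def max_def)
  moreover have "(\<lambda>s. Xp s \<omega>) -` A \<in> sets lborel"
    using measurable_sets[OF measurable_path[OF \<omega>] A] by simp
  ultimately show "emeasure (occ_measure X t \<omega>) A = emeasure (distr (U t) borel (\<lambda>s. Xp s \<omega>)) A"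
    using t p by (simp add: occ_measure_def emeasure_distr emeasure_restrict_space space_restrict_space
        divide_ennreal_def inverse_ennreal mult.commute inverse_eq_divide)
qed (simp add: occ_measure_def)

lemma occ_measure_prob_algebra [measurable]:
  assumes t: "0 < t" shows "occ_measure X t \<in> M \<rightarrow>\<^sub>M prob_algebra borel"
proof (rule measurable_prob_algebraI)
  interpret U: prob_space "U t" by (rule prob_space_U[OF t])
  show prob: "prob_space (occ_measure X t \<omega>)" if "\<omega> \<in> space M" for \<omega>
    using measurable_path[OF that] unfolding occ_measure_eq[OF t that] by (intro U.prob_space_distr) simp
  show "occ_measure X t \<in> M \<rightarrow>\<^sub>M subprob_algebra borel"
  proof (rule measurable_subprob_algebra)
    fix A :: "'a set" assume A [measurable]: "A \<in> sets borel"
    have "(\<lambda>\<omega>. \<integral>\<^sup>+s. indicator A (Xp s \<omega>) \<partial>U t) \<in> borel_measurable M"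
    proof -
      have "(\<lambda>z. indicator A (Xp (snd z) (fst z)) :: ennreal) \<in> borel_measurable (M \<Otimes>\<^sub>M U t)"
        using measurable_compose[OF measurable_pair_swap' joint_measurable] by (simp add: case_prod_beta cong: measurable_cong_sets)
      from U.borel_measurable_nn_integral_fst[OF this] show ?thesis by simp
    qed
    moreover have "emeasure (occ_measure X t \<omega>) A = (\<integral>\<^sup>+s. indicator A (Xp s \<omega>) \<partial>U t)" if "\<omega> \<in> space M" for \<omega>
    proof -
      note [measurable] = measurable_path[OF that]
      have "emeasure (occ_measure X t \<omega>) A = emeasure (U t) ((\<lambda>s. Xp s \<omega>) -` A)"
        unfolding occ_measure_eq[OF t that] by (subst emeasure_distr) auto
      also have "\<dots> = (\<integral>\<^sup>+s. indicator ((\<lambda>s. Xp s \<omega>) -` A) s \<partial>U t)"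
        using measurable_sets[OF measurable_path[OF that] A] by (subst nn_integral_indicator) auto
      finally show ?thesis by (simp add: indicator_vimage)
    qed
    ultimately show "(\<lambda>\<omega>. emeasure (occ_measure X t \<omega>) A) \<in> borel_measurable M"
      by (simp cong: measurable_cong)
  next
    show "subprob_space (occ_measure X t \<omega>)" if "\<omega> \<in> space M" for \<omega>
      using prob[OF that] by (rule prob_space_imp_subprob_space)
  qed (simp add: occ_measure_def)
qed

lemma nn_integral_mean_occ_measure:
  assumes t: "0 < t" and [measurable]: "f \<in> borel_measurable borel"
  shows "(\<integral>\<^sup>+x. f x \<partial>mean_occ_measure M X t) = (\<integral>\<^sup>+s. \<integral>\<^sup>+\<omega>. f (Xp s \<omega>) \<partial>M \<partial>U t)"
proof -
  interpret U: prob_space "U t" by (rule prob_space_U[OF t])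
  interpret P: pair_sigma_finite "U t" M ..
  have "(\<integral>\<^sup>+x. f x \<partial>mean_occ_measure M X t) = (\<integral>\<^sup>+\<omega>. \<integral>\<^sup>+x. f x \<partial>occ_measure X t \<omega> \<partial>M)"
    unfolding mean_occ_measure_def
    by (rule nn_integral_bind[OF assms(2) measurable_prob_algebraD[OF occ_measure_prob_algebra[OF t]]])
  also have "\<dots> = (\<integral>\<^sup>+\<omega>. \<integral>\<^sup>+s. f (Xp s \<omega>) \<partial>U t \<partial>M)"
    using measurable_path by (intro nn_integral_cong) (simp add: occ_measure_eq[OF t] nn_integral_distr)
  also have "\<dots> = (\<integral>\<^sup>+s. \<integral>\<^sup>+\<omega>. f (Xp s \<omega>) \<partial>M \<partial>U t)"
  proof (rule P.Fubini')
    show "(\<lambda>(s, \<omega>). f (Xp s \<omega>)) \<in> borel_measurable (U t \<Otimes>\<^sub>M M)"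
      using measurable_compose[OF joint_measurable assms(2)] by (simp add: case_prod_beta cong: measurable_cong_sets)
  qed
  finally show ?thesis .
qed

lemma sets_mean_occ_measure: "0 < t \<Longrightarrow> sets (mean_occ_measure M X t) = sets borel"
  unfolding mean_occ_measure_def
  by (rule sets_bind) (simp_all add: occ_measure_def not_empty)

lemma prob_space_mean_occ_measure:
  assumes t: "0 < t" shows "prob_space (mean_occ_measure M X t)"
proof
  interpret U: prob_space "U t" by (rule prob_space_U[OF t])
  have "emeasure (mean_occ_measure M X t) (space (mean_occ_measure M X t)) = (\<integral>\<^sup>+x. 1 \<partial>mean_occ_measure M X t)"
    by simp
  also have "\<dots> = 1"
    using nn_integral_mean_occ_measure[OF t, of "\<lambda>_. 1"] t by (simp add: emeasure_space_1 ennreal_divide_self)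
  finally show "emeasure (mean_occ_measure M X t) (space (mean_occ_measure M X t)) = 1" .
qed

lemma Cq: "0 \<le> Cq" "\<And>s t. 0 \<le> s \<Longrightarrow> s \<le> t \<Longrightarrow> (\<integral>\<^sup>+\<omega>. ennreal (\<Upsilon> t s \<omega> powr q) \<partial>M) \<le> ennreal Cq"
  "\<And>t. 0 \<le> t \<Longrightarrow> (\<integral>\<^sup>+\<omega>. ennreal (norm (X t \<omega>) powr q) \<partial>M) \<le> ennreal Cq"
proof -
  have eq: "ennreal Cq = C_const M X \<Upsilon> q" using C_finite by (simp add: Cq_def)
  have sup: "(SUP s\<in>{0..t}. \<integral>\<^sup>+\<omega>. ennreal (\<Upsilon> t s \<omega> powr q) \<partial>M) + (\<integral>\<^sup>+\<omega>. ennreal (norm (X t \<omega>) powr q) \<partial>M) \<le> ennreal Cq" if "0 \<le> t" for t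
    unfolding eq C_const_def using that by (intro SUP_upper) simp
  show "0 \<le> Cq" by (simp add: Cq_def)
  show "(\<integral>\<^sup>+\<omega>. ennreal (norm (X t \<omega>) powr q) \<partial>M) \<le> ennreal Cq" if "0 \<le> t" for t
    by (rule order_trans[OF _ sup[OF that]]) simp
  show "(\<integral>\<^sup>+\<omega>. ennreal (\<Upsilon> t s \<omega> powr q) \<partial>M) \<le> ennreal Cq" if "0 \<le> s" "s \<le> t" for s t
  proof -
    have "(\<integral>\<^sup>+\<omega>. ennreal (\<Upsilon> t s \<omega> powr q) \<partial>M) \<le> (SUP s\<in>{0..t}. \<integral>\<^sup>+\<omega>. ennreal (\<Upsilon> t s \<omega> powr q) \<partial>M)"
      using that by (intro SUP_upper) simp
    also have "\<dots> \<le> ennreal Cq" using that by (intro order_trans[OF _ sup[of t]]) (simp_all add: add_increasing2)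
    finally show ?thesis .
  qed
qed

lemma measurable_\<Upsilon>: "0 \<le> s \<Longrightarrow> s \<le> t \<Longrightarrow> \<Upsilon> t s \<in> borel_measurable M"
  using measurable_F_M[OF _ measurable_compose[OF measurable_Pair1'[of t "restrict_space borel {s..}" "F s"] \<Upsilon>_meas[rule_format]]]
  by (simp add: space_restrict_space)

lemma measure_diff_le_tv_dist:
  assumes "prob_space \<mu>" "sets \<mu> = sets borel" and A: "A \<in> sets borel"
  shows "\<bar>measure \<mu> A - measure \<nu> A\<bar> \<le> tv_dist \<mu> \<nu>"
proof -
  interpret \<mu>: prob_space \<mu> by fact
  interpret \<nu>: prob_space \<nu> by (rule \<nu>(1))
  have sp: "space \<mu> = UNIV" "space \<nu> = UNIV" using assms(2) \<nu>(2) by (auto dest!: sets_eq_imp_space_eq)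
  have le: "\<bar>(\<integral>x. f x \<partial>N)\<bar> \<le> 1" if "prob_space N" "f \<in> borel_measurable N" "\<forall>x. \<bar>f x\<bar> \<le> 1" for f :: "'a \<Rightarrow> real" and N
  proof -
    interpret N: prob_space N by fact
    have "norm (\<integral>x. f x \<partial>N) \<le> (\<integral>x. 1 \<partial>N)"
      using that by (intro Bochner_Integration.integral_norm_bound_integral N.integrable_const_bound[where B=1]) auto
    then show ?thesis by (simp add: N.prob_space)
  qed
  have "\<bar>(\<integral>x. f x \<partial>\<mu>) - (\<integral>x. f x \<partial>\<nu>)\<bar> \<le> 2" if "f \<in> borel_measurable borel" "\<forall>x. \<bar>f x\<bar> \<le> 1" for f :: "'a \<Rightarrow> real"
  proof -
    have "\<bar>\<integral>x. f x \<partial>\<mu>\<bar> \<le> 1" "\<bar>\<integral>x. f x \<partial>\<nu>\<bar> \<le> 1"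
      using le[of \<mu> f] le[of \<nu> f] that assms \<nu> by (auto cong: measurable_cong_sets)
    then show ?thesis by linarith
  qed
  then have "bdd_above ((\<lambda>f::'a \<Rightarrow> real. \<bar>(\<integral>x. f x \<partial>\<mu>) - (\<integral>x. f x \<partial>\<nu>)\<bar>) ` {f \<in> borel_measurable borel. \<forall>x. \<bar>f x\<bar> \<le> 1})"
    by (auto intro!: bdd_aboveI[of _ 2])
  then have "\<bar>(\<integral>x. indicator A x \<partial>\<mu>) - (\<integral>x. indicator A x \<partial>\<nu>)\<bar> \<le> tv_dist \<mu> \<nu>"
    unfolding tv_dist_def using A by (intro cSUP_upper) auto
  then show ?thesis using A assms \<nu> sp by simp
qed

text \<open>The indicator of \<open>A\<close> is a test function for the total variation norm of the conditional law.\<close>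

lemma cond_prob_deviation:
  assumes s: "0 \<le> s" "s \<le> t" and A: "A \<in> sets borel"
  shows "AE \<omega> in M. \<bar>real_cond_exp M (F s) (\<lambda>\<omega>'. indicator A (X t \<omega>')) \<omega> - measure \<nu> A\<bar> \<le> \<Upsilon> t s \<omega> * e (t - s)"
proof -
  have rcd: "regular_cond_distr M (F s) (X t) (\<kappa> t s)" using cond_law s by simp
  have "AE \<omega> in M. measure (\<kappa> t s \<omega>) A = real_cond_exp M (F s) (\<lambda>\<omega>'. indicator A (X t \<omega>')) \<omega>"
    using rcd A by (simp add: regular_cond_distr_def)
  moreover have "AE \<omega> in M. tv_dist (\<kappa> t s \<omega>) \<nu> \<le> \<Upsilon> t s \<omega> * e (t - s)"
    using tv_mixing s by simp
  moreover have "AE \<omega> in M. \<bar>measure (\<kappa> t s \<omega>) A - measure \<nu> A\<bar> \<le> tv_dist (\<kappa> t s \<omega>) \<nu>"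
  proof (rule AE_I2)
    fix \<omega> assume "\<omega> \<in> space M"
    then have "\<omega> \<in> space (F s)" using subalg_F[OF s(1)] by (simp add: subalgebra_def)
    moreover have "\<kappa> t s \<in> F s \<rightarrow>\<^sub>M prob_algebra borel"
      using rcd by (simp add: regular_cond_distr_def)
    ultimately have "\<kappa> t s \<omega> \<in> space (prob_algebra borel)"
      by (rule measurable_space[rotated])
    then have "prob_space (\<kappa> t s \<omega>)" "sets (\<kappa> t s \<omega>) = sets borel"
      by (auto simp: space_prob_algebra)
    then show "\<bar>measure (\<kappa> t s \<omega>) A - measure \<nu> A\<bar> \<le> tv_dist (\<kappa> t s \<omega>) \<nu>"
      by (rule measure_diff_le_tv_dist) fact
  qed
  ultimately show ?thesis by eventually_elim auto
qed

text \<open>Conditioning replaces the indicator by its conditional expectation, which is within \<open>\<Upsilon> e(t - s)\<close> of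
  \<open>\<nu>(A)\<close>.  The free parameter \<open>l\<close> splits \<open>\<bar>f\<bar> \<Upsilon>\<close> according to whether \<open>\<Upsilon> \<le> l\<close>: on the first event
  \<open>\<bar>f\<bar> \<Upsilon> \<le> l \<bar>f\<bar>\<close>, on the second one \<open>\<Upsilon> \<le> l\<^bsup>1-q\<^esup> \<Upsilon>\<^sup>q\<close>.\<close>

lemma covariance_le:
  fixes f :: "'w \<Rightarrow> real"
  assumes s: "0 \<le> s" "s \<le> t" and A: "A \<in> sets borel" and l: "0 < l"
    and f: "f \<in> borel_measurable (F s)" and f1: "\<And>\<omega>. \<bar>f \<omega>\<bar> \<le> 1"
  shows "ennreal \<bar>\<integral>\<omega>. f \<omega> * (indicator A (X t \<omega>) - measure \<nu> A) \<partial>M\<bar>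
    \<le> ennreal (e (t - s)) * (ennreal l * (\<integral>\<^sup>+\<omega>. ennreal \<bar>f \<omega>\<bar> \<partial>M) + ennreal (l powr (1 - q) * Cq))"
proof -
  interpret S: finite_measure_subalgebra M "F s"
    using subalg_F[OF s(1)] by unfold_locales
  have [measurable]: "f \<in> borel_measurable M" by (rule measurable_F_M[OF s(1) f])
  have [measurable]: "X t \<in> borel_measurable M" using s by (intro measurable_F_M[OF _ measurable_X_F]) auto
  note [measurable] = A f
  have [measurable]: "\<Upsilon> t s \<in> borel_measurable M" by (rule measurable_\<Upsilon>[OF s])
  define g where "g = (\<lambda>\<omega>. indicator A (X t \<omega>) :: real)"
  define c where "c = measure \<nu> A"
  have [measurable]: "g \<in> borel_measurable M" unfolding g_def by measurable
  have fi: "integrable M f" using f1 by (intro integrable_const_bound[where B=1]) auto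
  have fg: "integrable M (\<lambda>\<omega>. f \<omega> * g \<omega>)"
    using f1 by (intro integrable_const_bound[where B=1]) (auto simp: g_def indicator_def)
  note ce = S.real_cond_exp_intg[OF fg f, simplified]
  have "(\<integral>\<omega>. f \<omega> * (g \<omega> - c) \<partial>M) = (\<integral>\<omega>. f \<omega> * g \<omega> - f \<omega> * c \<partial>M)" by (simp add: algebra_simps)
  also have "\<dots> = (\<integral>\<omega>. f \<omega> * g \<omega> \<partial>M) - (\<integral>\<omega>. f \<omega> * c \<partial>M)"
    using fg fi by (intro Bochner_Integration.integral_diff) auto
  also have "\<dots> = (\<integral>\<omega>. f \<omega> * real_cond_exp M (F s) g \<omega> - f \<omega> * c \<partial>M)"
    using ce fi by (subst Bochner_Integration.integral_diff) auto
  also have "\<dots> = (\<integral>\<omega>. f \<omega> * (real_cond_exp M (F s) g \<omega> - c) \<partial>M)" by (simp add: algebra_simps)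
  finally have eq: "(\<integral>\<omega>. f \<omega> * (g \<omega> - c) \<partial>M) = \<dots>" .
  have "ennreal \<bar>\<integral>\<omega>. f \<omega> * (g \<omega> - c) \<partial>M\<bar> \<le> (\<integral>\<^sup>+\<omega>. ennreal \<bar>f \<omega> * (real_cond_exp M (F s) g \<omega> - c)\<bar> \<partial>M)"
    unfolding eq using integral_norm_bound_ennreal[of M "\<lambda>\<omega>. f \<omega> * (real_cond_exp M (F s) g \<omega> - c)"] ce fi
    by (simp add: algebra_simps)
  also have "\<dots> \<le> (\<integral>\<^sup>+\<omega>. ennreal (e (t - s)) * (ennreal l * ennreal \<bar>f \<omega>\<bar> + ennreal (l powr (1 - q)) * ennreal (\<Upsilon> t s \<omega> powr q)) \<partial>M)"
  proof (rule nn_integral_mono_AE)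
    show "AE \<omega> in M. ennreal \<bar>f \<omega> * (real_cond_exp M (F s) g \<omega> - c)\<bar>
        \<le> ennreal (e (t - s)) * (ennreal l * ennreal \<bar>f \<omega>\<bar> + ennreal (l powr (1 - q)) * ennreal (\<Upsilon> t s \<omega> powr q))"
      using cond_prob_deviation[OF s A] AE_space
    proof eventually_elim
      case (elim \<omega>)
      have Y: "0 \<le> \<Upsilon> t s \<omega>" using \<Upsilon>_nonneg s elim by auto
      have e0: "0 \<le> e (t - s)" using e_nonneg s by simp
      have key: "\<bar>f \<omega>\<bar> * \<Upsilon> t s \<omega> \<le> l * \<bar>f \<omega>\<bar> + l powr (1 - q) * \<Upsilon> t s \<omega> powr q"
      proof (cases "\<Upsilon> t s \<omega> \<le> l")
        case True
        then have "\<bar>f \<omega>\<bar> * \<Upsilon> t s \<omega> \<le> \<bar>f \<omega>\<bar> * l" by (intro mult_left_mono) auto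
        then show ?thesis by (simp add: mult.commute add_increasing2)
      next
        case False
        then have pos: "0 < \<Upsilon> t s \<omega>" using l by simp
        have "\<bar>f \<omega>\<bar> * \<Upsilon> t s \<omega> \<le> 1 * \<Upsilon> t s \<omega>" using f1 Y by (intro mult_right_mono) auto
        also have "\<dots> = \<Upsilon> t s \<omega> powr (1 - q) * \<Upsilon> t s \<omega> powr q"
          using pos by (simp add: powr_add[symmetric])
        also have "\<dots> \<le> l powr (1 - q) * \<Upsilon> t s \<omega> powr q"
          using False l q by (intro mult_right_mono powr_mono2') auto
        finally show ?thesis using l by (simp add: add_increasing)
      qed
      have "\<bar>f \<omega> * (real_cond_exp M (F s) g \<omega> - c)\<bar> \<le> \<bar>f \<omega>\<bar> * (\<Upsilon> t s \<omega> * e (t - s))"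
        unfolding abs_mult using elim(1) by (intro mult_left_mono) (auto simp: g_def c_def)
      also have "\<dots> = e (t - s) * (\<bar>f \<omega>\<bar> * \<Upsilon> t s \<omega>)" by simp
      also have "\<dots> \<le> e (t - s) * (l * \<bar>f \<omega>\<bar> + l powr (1 - q) * \<Upsilon> t s \<omega> powr q)"
        using key e0 by (rule mult_left_mono)
      finally show ?case
        using e0 l by (simp add: ennreal_mult[symmetric] ennreal_plus[symmetric] ennreal_leI del: ennreal_plus)
    qed
  qed
  also have "\<dots> = ennreal (e (t - s)) * (ennreal l * (\<integral>\<^sup>+\<omega>. ennreal \<bar>f \<omega>\<bar> \<partial>M) + ennreal (l powr (1 - q)) * (\<integral>\<^sup>+\<omega>. ennreal (\<Upsilon> t s \<omega> powr q) \<partial>M))"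
    by (simp add: nn_integral_cmult nn_integral_add)
  also have "\<dots> \<le> ennreal (e (t - s)) * (ennreal l * (\<integral>\<^sup>+\<omega>. ennreal \<bar>f \<omega>\<bar> \<partial>M) + ennreal (l powr (1 - q)) * ennreal Cq)"
    by (intro mult_left_mono add_left_mono Cq s) auto
  finally show ?thesis
    using Cq(1) by (simp add: g_def c_def ennreal_mult)
qed

end

section \<open>Decorrelation in time and moments of the limit\<close>

context mixing_process begin

lemma measurable_ep [measurable]: "ep \<in> borel_measurable borel"
proof -
  have "(\<lambda>u::real. \<bar>u\<bar>) \<in> borel \<rightarrow>\<^sub>M restrict_space borel {0..}"
    by (rule measurable_restrict_space2) auto
  from measurable_compose[OF this e_meas] show ?thesis by (simp add: ep_def[abs_def])
qed

lemma ep_nonneg: "0 \<le> ep u"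
  using e_nonneg by (simp add: ep_def)

lemma e_integral:
  assumes t: "0 \<le> t"
  shows "(\<integral>\<^sup>+u. ennreal (ep u) * indicator {0..t} u \<partial>lborel) = ennreal (LINT s:{0..t}|lborel. e s)"
    and "0 \<le> (LINT s:{0..t}|lborel. e s)"
proof -
  obtain B where B: "\<And>u. 0 \<le> u \<Longrightarrow> \<bar>e u\<bar> \<le> B"
    using e_bounded unfolding bounded_iff by auto
  then have epB: "\<bar>ep u\<bar> \<le> B" for u by (simp add: ep_def)
  have int: "integrable lborel (\<lambda>u. indicator {0..t} u * ep u)"
  proof (rule Bochner_Integration.integrable_bound)
    show "integrable lborel (\<lambda>u. indicator {0..t} u * B)"
      using t by (intro integrable_mult_left integrable_real_indicator) auto
    show "AE u in lborel. norm (indicator {0..t} u * ep u) \<le> norm (indicator {0..t} u * B)"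
      using epB by (intro AE_I2) (auto simp: indicator_def intro: order_trans[OF _ abs_ge_self])
  qed measurable
  have eq: "(LINT s:{0..t}|lborel. e s) = (\<integral>u. indicator {0..t} u * ep u \<partial>lborel)"
    unfolding set_lebesgue_integral_def by (intro Bochner_Integration.integral_cong) (auto simp: ep_def indicator_def)
  have "(\<integral>\<^sup>+u. ennreal (indicator {0..t} u * ep u) \<partial>lborel) = ennreal (\<integral>u. indicator {0..t} u * ep u \<partial>lborel)"
    using int by (rule nn_integral_eq_integral) (simp add: ep_nonneg)
  moreover have "(\<integral>\<^sup>+u. ennreal (ep u) * indicator {0..t} u \<partial>lborel) = (\<integral>\<^sup>+u. ennreal (indicator {0..t} u * ep u) \<partial>lborel)"
    by (intro nn_integral_cong) (simp add: indicator_def)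
  ultimately show "(\<integral>\<^sup>+u. ennreal (ep u) * indicator {0..t} u \<partial>lborel) = ennreal (LINT s:{0..t}|lborel. e s)"
    by (simp add: eq)
  show "0 \<le> (LINT s:{0..t}|lborel. e s)"
    unfolding eq by (intro integral_nonneg_AE AE_I2) (simp add: ep_nonneg)
qed

lemma e_integral_le_rate:
  assumes t0: "0 < t0"
  shows "\<exists>K>0. \<forall>t\<ge>t0. (LINT s:{0..t}|lborel. e s) \<le> K * t powr (1 - 2 * \<gamma>)"
proof -
  define E where "E = (\<lambda>t. LINT s:{0..t}|lborel. e s)"
  obtain c where c: "c > 0" "\<forall>\<^sub>F t in at_top. norm (E t) \<le> c * norm (t powr (1 - 2 * \<gamma>))"
    using landau_o.bigE[OF e_rate] unfolding E_def by blast
  then obtain T where T: "\<And>t. t \<ge> T \<Longrightarrow> \<bar>E t\<bar> \<le> c * t powr (1 - 2 * \<gamma>)"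
    unfolding eventually_at_top_linorder by auto
  define b where "b = \<bar>E (max T t0)\<bar> / t0 powr (1 - 2 * \<gamma>)"
  have mono: "E s \<le> E t" if "0 \<le> s" "s \<le> t" for s t
  proof -
    have "ennreal (E s) \<le> ennreal (E t)"
      unfolding E_def using that e_integral(1)[of s, symmetric] e_integral(1)[of t, symmetric]
      by (auto intro!: nn_integral_mono simp: indicator_def)
    then show ?thesis using e_integral(2)[of t] that by (simp add: E_def)
  qed
  have "E t \<le> (c + b) * t powr (1 - 2 * \<gamma>)" if t: "t \<ge> t0" for t
  proof (cases "t \<ge> T")
    case True
    have "E t \<le> c * t powr (1 - 2 * \<gamma>)" using T[OF True] by linarith
    also have "\<dots> \<le> (c + b) * t powr (1 - 2 * \<gamma>)"
      by (intro mult_right_mono) (auto simp: b_def)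
    finally show ?thesis .
  next
    case False
    have "E t \<le> \<bar>E (max T t0)\<bar>"
      using mono[of t "max T t0"] False t t0 by linarith
    also have "\<dots> = b * t0 powr (1 - 2 * \<gamma>)" using t0 by (simp add: b_def)
    also have "\<dots> \<le> (c + b) * t powr (1 - 2 * \<gamma>)"
      using c t t0 \<gamma> by (intro mult_mono powr_mono2) (auto simp: b_def)
    finally show ?thesis .
  qed
  moreover have "c + b > 0" using c by (simp add: b_def add_pos_nonneg)
  ultimately show ?thesis unfolding E_def by blast
qed

text \<open>A positive lower bound for \<open>e\<close> would make its integral grow linearly, against the rate
  \<open>t\<^bsup>1-2\<gamma>\<^esup>\<close>.\<close>

lemma e_small:
  assumes "0 < \<eta>" shows "\<exists>t\<ge>0. e t < \<eta>"
proof (rule ccontr)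
  assume "\<not> (\<exists>t\<ge>0. e t < \<eta>)"
  then have ge: "\<eta> \<le> e t" if "0 \<le> t" for t using that by (meson not_less)
  obtain K where K: "K > 0" "\<And>t. t \<ge> 1 \<Longrightarrow> (LINT s:{0..t}|lborel. e s) \<le> K * t powr (1 - 2 * \<gamma>)"
    using e_integral_le_rate[of 1] by auto
  have le: "\<eta> * t \<le> K * t powr (1 - 2 * \<gamma>)" if t: "t \<ge> 1" for t
  proof -
    have "ennreal (\<eta> * t) = (\<integral>\<^sup>+u. ennreal \<eta> * indicator {0..t} u \<partial>lborel)"
      using t assms by (simp add: nn_integral_cmult_indicator ennreal_mult)
    also have "\<dots> \<le> (\<integral>\<^sup>+u. ennreal (ep u) * indicator {0..t} u \<partial>lborel)"
      using ge by (intro nn_integral_mono) (auto simp: indicator_def ep_def intro!: ennreal_leI)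
    also have "\<dots> = ennreal (LINT s:{0..t}|lborel. e s)" using t by (intro e_integral) auto
    finally have "\<eta> * t \<le> (LINT s:{0..t}|lborel. e s)"
      using e_integral(2)[of t] t by simp
    then show ?thesis using K(2)[OF t] by linarith
  qed
  \<comment> \<open>The linear lower bound is now at least twice the upper bound.\<close>
  define t where "t = max 1 ((2 * K / \<eta>) powr (1 / (2 * \<gamma>)))"
  have t1: "t \<ge> 1" by (simp add: t_def)
  have "2 * K / \<eta> = ((2 * K / \<eta>) powr (1 / (2 * \<gamma>))) powr (2 * \<gamma>)"
    using K assms \<gamma> by (simp add: powr_powr)
  also have "\<dots> \<le> t powr (2 * \<gamma>)"
    using \<gamma> by (intro powr_mono2) (auto simp: t_def)
  finally have "2 * K \<le> \<eta> * t powr (2 * \<gamma>)"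
    using assms by (simp add: field_simps)
  then have "2 * K * t powr (1 - 2 * \<gamma>) \<le> \<eta> * t powr (2 * \<gamma>) * t powr (1 - 2 * \<gamma>)"
    by (rule mult_right_mono) simp
  moreover have "t powr (2 * \<gamma>) * t powr (1 - 2 * \<gamma>) = t"
    using t1 by (simp add: powr_add[symmetric])
  ultimately have "2 * K * t powr (1 - 2 * \<gamma>) \<le> \<eta> * t"
    by (simp only: mult.assoc)
  then have "2 * K * t powr (1 - 2 * \<gamma>) \<le> K * t powr (1 - 2 * \<gamma>)"
    using le[OF t1] by linarith
  then show False using K(1) t1 by simp
qed

definition X_moment where "X_moment = (SUP t\<in>{0..}. \<integral>\<^sup>+\<omega>. ennreal (norm (X t \<omega>) powr q) \<partial>M)"

lemma moment_le_X_moment: "0 \<le> t \<Longrightarrow> (\<integral>\<^sup>+\<omega>. ennreal (norm (X t \<omega>) powr q) \<partial>M) \<le> X_moment"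
  unfolding X_moment_def by (rule SUP_upper) simp

lemma X_moment_finite: "X_moment < \<top>"
proof -
  have "X_moment \<le> ennreal Cq" unfolding X_moment_def by (rule SUP_least) (simp add: Cq)
  then show ?thesis by (simp add: le_less_trans)
qed

text \<open>The case \<open>s = 0\<close>, \<open>f = 1\<close>, \<open>l = 1\<close> of the covariance bound.\<close>

lemma law_close:
  assumes t: "0 \<le> t" and A: "A \<in> sets borel"
  shows "emeasure \<nu> A \<le> emeasure (distr M borel (X t)) A + ennreal (e t * (1 + Cq))"
proof -
  interpret \<nu>: prob_space \<nu> by (rule \<nu>(1))
  have [measurable]: "X t \<in> borel_measurable M" by (rule measurable_F_M[OF t measurable_X_F[OF t]])
  note [measurable] = A
  have "ennreal \<bar>\<integral>\<omega>. 1 * (indicator A (X t \<omega>) - measure \<nu> A) \<partial>M\<bar> \<le> ennreal (e (t - 0)) * (ennreal 1 * (\<integral>\<^sup>+\<omega>. ennreal \<bar>1\<bar> \<partial>M) + ennreal (1 powr (1 - q) * Cq))"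
    using t A by (intro covariance_le) auto
  also have "\<dots> = ennreal (e t * (1 + Cq))"
    using Cq(1) e_nonneg t by (simp add: emeasure_space_1 ennreal_mult ennreal_plus)
  finally have "\<bar>\<integral>\<omega>. (indicator A (X t \<omega>) - measure \<nu> A) \<partial>M\<bar> \<le> e t * (1 + Cq)"
    using Cq(1) e_nonneg t by (simp add: mult_nonneg_nonneg)
  moreover have "(\<integral>\<omega>. (indicator A (X t \<omega>) - measure \<nu> A) \<partial>M) = measure (distr M borel (X t)) A - measure \<nu> A"
  proof -
    have "(\<integral>\<omega>. (indicator A (X t \<omega>) - measure \<nu> A) \<partial>M) = (\<integral>\<omega>. indicator A (X t \<omega>) \<partial>M) - (\<integral>\<omega>. measure \<nu> A \<partial>M)"
      by (intro Bochner_Integration.integral_diff integrable_const_bound[where B=1]) (auto simp: indicator_def)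
    also have "(\<integral>\<omega>. indicator A (X t \<omega>) \<partial>M) = measure (distr M borel (X t)) A"
      using integral_distr[of "X t" M borel "indicator A :: 'a \<Rightarrow> real"] by simp
    finally show ?thesis by (simp add: prob_space)
  qed
  ultimately have le: "measure \<nu> A \<le> measure (distr M borel (X t)) A + e t * (1 + Cq)" by linarith
  interpret D: prob_space "distr M borel (X t)" by (rule prob_space_distr) simp
  show ?thesis
    using le Cq(1) e_nonneg t by (simp add: \<nu>.emeasure_eq_measure D.emeasure_eq_measure ennreal_plus[symmetric] ennreal_leI del: ennreal_plus)
qed

text \<open>For a simple function below \<open>\<bar>x\<bar>\<^sup>q\<close>, the integrals against \<open>\<nu>\<close> and against the law of \<open>X\<^sub>t\<close> differ by
  at most a multiple of \<open>e(t)\<close>, which can be made arbitrarily small.\<close>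

lemma moment_\<nu>_le: "abs_moment \<nu> q \<le> X_moment"
  unfolding abs_moment_def nn_integral_def
proof (rule SUP_least, safe)
  fix g assume g: "simple_function \<nu> g" and le: "g \<le> (\<lambda>x. ennreal (norm x powr q))"
  have sp: "space \<nu> = UNIV" using \<nu>(2) by (auto dest: sets_eq_imp_space_eq)
  have gb: "simple_function borel g"
    using g \<nu>(2) sp unfolding simple_function_def by simp
  have fin: "finite (range g)" using g sp by (simp add: simple_function_def)
  have gtop: "g x < \<top>" for x using le_funD[OF le, of x] by (auto intro: le_less_trans)
  define G where "G = (\<Sum>y\<in>range g. y)"
  have "G < \<top>" unfolding G_def by (simp add: less_top[symmetric] fin) (metis gtop rangeE order_less_irrefl)
  have key: "integral\<^sup>S \<nu> g \<le> X_moment + G * ennreal (e t * (1 + Cq))" if t: "0 \<le> t" for t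
  proof -
    have [measurable]: "X t \<in> borel_measurable M" by (rule measurable_F_M[OF t measurable_X_F[OF t]])
    define D where "D = distr M borel (X t)"
    have "integral\<^sup>S \<nu> g = (\<Sum>y\<in>range g. y * emeasure \<nu> (g -` {y}))"
      by (simp add: simple_integral_def sp)
    also have "\<dots> \<le> (\<Sum>y\<in>range g. y * (emeasure D (g -` {y}) + ennreal (e t * (1 + Cq))))"
      unfolding D_def using simple_functionD(2)[OF gb, of "{_}"]
      by (intro sum_mono mult_left_mono law_close t) auto
    also have "\<dots> = integral\<^sup>S D g + G * ennreal (e t * (1 + Cq))"
      by (simp add: simple_integral_def D_def G_def distrib_left sum.distrib sum_distrib_right)
    also have "integral\<^sup>S D g = (\<integral>\<^sup>+x. g x \<partial>D)"
      using gb unfolding D_def by (intro nn_integral_eq_simple_integral[symmetric]) (simp add: simple_function_def)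
    also have "\<dots> \<le> (\<integral>\<^sup>+x. ennreal (norm x powr q) \<partial>D)"
      using le by (intro nn_integral_mono) (simp add: le_fun_def)
    also have "\<dots> = (\<integral>\<^sup>+\<omega>. ennreal (norm (X t \<omega>) powr q) \<partial>M)"
      unfolding D_def by (subst nn_integral_distr) auto
    also have "\<dots> \<le> X_moment" by (rule moment_le_X_moment[OF t])
    finally show ?thesis by (simp add: add_right_mono)
  qed
  show "integral\<^sup>S \<nu> g \<le> X_moment"
  proof (rule ennreal_le_epsilon)
    fix \<epsilon> :: real assume \<epsilon>: "0 < \<epsilon>"
    define h where "h = enn2real G"
    have h: "G = ennreal h" "0 \<le> h" using \<open>G < \<top>\<close> by (simp_all add: h_def)
    have pos: "0 < \<epsilon> / ((1 + h) * (1 + Cq))" using \<epsilon> h Cq by (intro divide_pos_pos mult_pos_pos) auto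
    obtain t where t: "0 \<le> t" "e t < \<epsilon> / ((1 + h) * (1 + Cq))" using e_small[OF pos] by blast
    have "h * (e t * (1 + Cq)) \<le> (1 + h) * (\<epsilon> / ((1 + h) * (1 + Cq)) * (1 + Cq))"
      using t h Cq e_nonneg by (intro mult_mono) auto
    also have "\<dots> = \<epsilon>" proof -
      have "1 + h \<noteq> 0" "1 + Cq \<noteq> 0" using h(2) Cq(1) by linarith+
      then show ?thesis by simp
    qed
    finally have "G * ennreal (e t * (1 + Cq)) \<le> ennreal \<epsilon>"
      using h Cq e_nonneg t by (simp add: ennreal_mult[symmetric] ennreal_leI)
    then show "integral\<^sup>S \<nu> g \<le> X_moment + ennreal \<epsilon>"
      using key[OF t(1)] by (meson add_left_mono order_trans)
  qed
qed

lemma emeasure_mean_occ_measure: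
  assumes t: "0 < t" and A: "A \<in> sets borel"
  shows "emeasure (mean_occ_measure M X t) A = (\<integral>\<^sup>+s. \<integral>\<^sup>+\<omega>. indicator A (Xp s \<omega>) \<partial>M \<partial>U t)"
  using nn_integral_mean_occ_measure[OF t, of "indicator A"] A sets_mean_occ_measure[OF t] by simp

definition Y :: "'a set \<Rightarrow> real \<Rightarrow> 'w \<Rightarrow> real" where
  "Y A s \<omega> = indicator A (Xp s \<omega>) - measure \<nu> A"

lemma Y_bound: "\<bar>Y A s \<omega>\<bar> \<le> 1"
  using prob_space.prob_le_1[OF \<nu>(1), of A] measure_nonneg[of \<nu> A] by (auto simp: Y_def indicator_def)

lemma Y_joint_measurable [measurable]:
  assumes [measurable]: "A \<in> sets borel"
  shows "(\<lambda>z. Y A (fst z) (snd z)) \<in> borel_measurable (borel \<Otimes>\<^sub>M M)"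
proof -
  have "(\<lambda>x. indicator A x :: real) \<in> borel_measurable borel" by measurable
  note [measurable] = measurable_compose[OF joint_measurable this]
  show ?thesis unfolding Y_def by measurable
qed

lemma Y_measurable [measurable]:
  assumes [measurable]: "A \<in> sets borel"
  shows "Y A s \<in> borel_measurable M"
  unfolding Y_def by measurable

text \<open>Adding \<open>G s\<close> and \<open>G u\<close> makes the bound symmetric, so that it covers both orders of the two times.\<close>

lemma covariance_Y_le:
  assumes s: "0 \<le> s" "0 \<le> u" and A: "A \<in> sets borel" and l: "0 < l"
  defines "G \<equiv> (\<lambda>s. ennreal l * (\<integral>\<^sup>+\<omega>. ennreal \<bar>Y A s \<omega>\<bar> \<partial>M) + ennreal (l powr (1 - q) * Cq))"
  shows "ennreal \<bar>\<integral>\<omega>. Y A s \<omega> * Y A u \<omega> \<partial>M\<bar> \<le> ennreal (ep (u - s)) * (G s + G u)"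
proof -
  have *: "ennreal \<bar>\<integral>\<omega>. Y A s \<omega> * Y A u \<omega> \<partial>M\<bar> \<le> ennreal (ep (u - s)) * G s" if s: "0 \<le> s" "s \<le> u" for s u
  proof -
    have "Y A s \<in> borel_measurable (F s)"
      using measurable_X_F[OF s(1)] A s unfolding Y_def[abs_def] Xp_def by (simp add: max_def)
    from covariance_le[OF s A l this Y_bound] show ?thesis
      using s by (simp add: G_def Y_def Xp_def ep_def max_def)
  qed
  show ?thesis
  proof (cases "s \<le> u")
    case True
    have "ennreal (ep (u - s)) * G s \<le> ennreal (ep (u - s)) * (G s + G u)"
      by (intro mult_left_mono) simp_all
    then show ?thesis using *[OF s(1) True] by (rule order_trans[rotated])
  next
    case False
    have "ennreal (ep (u - s)) * G u \<le> ennreal (ep (u - s)) * (G s + G u)"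
      by (intro mult_left_mono) simp_all
    moreover have "ep (s - u) = ep (u - s)" by (simp add: ep_def abs_minus_commute)
    ultimately show ?thesis using *[OF s(2), of s] False by (simp add: mult.commute)
  qed
qed

text \<open>Seen from any \<open>s\<close>, the time interval reaches at most \<open>t\<close> to the left and to the right; this is the
  factor \<open>2\<close>.\<close>

lemma ep_average_le:
  assumes t: "0 < t" and s: "s \<in> {0..t}"
  shows "(\<integral>\<^sup>+u. ennreal (ep (u - s)) \<partial>U t) \<le> ennreal (2 * (LINT s:{0..t}|lborel. e s) / t)"
proof -
  define E where "E = (LINT s:{0..t}|lborel. e s)"
  have E: "0 \<le> E" "(\<integral>\<^sup>+u. ennreal (ep u) * indicator {0..t} u \<partial>lborel) = ennreal E"
    using e_integral[of t] t by (simp_all add: E_def)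
  have "(\<integral>\<^sup>+u. ennreal (ep (u - s)) * indicator {0..t} u \<partial>lborel)
      = (\<integral>\<^sup>+v. ennreal (ep v) * indicator {0..t} (s + v) \<partial>lborel)"
    by (subst nn_integral_real_affine[where c=1 and t=s]) (auto simp: add.commute)
  also have "\<dots> \<le> (\<integral>\<^sup>+v. ennreal (ep v) * indicator {0..t} v + ennreal (ep v) * indicator {0..t} (0 + - 1 * v) \<partial>lborel)"
    using s by (intro nn_integral_mono) (auto simp: indicator_def)
  also have "\<dots> = ennreal E + (\<integral>\<^sup>+v. ennreal (ep v) * indicator {0..t} (0 + - 1 * v) \<partial>lborel)"
    by (subst nn_integral_add) (auto simp: E)
  also have "(\<integral>\<^sup>+v. ennreal (ep v) * indicator {0..t} (0 + - 1 * v) \<partial>lborel) = (\<integral>\<^sup>+v. ennreal (ep (0 + - 1 * v)) * indicator {0..t} (0 + - 1 * v) \<partial>lborel)"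
    by (simp add: ep_def)
  also have "\<dots> = (\<integral>\<^sup>+u. ennreal (ep u) * indicator {0..t} u \<partial>lborel)"
    using nn_integral_real_affine[of "\<lambda>u. ennreal (ep u) * indicator {0..t} u" "-1" 0] by simp
  also have "ennreal E + \<dots> = ennreal (2 * E)"
    using E by (simp add: ennreal_plus[symmetric] del: ennreal_plus)
  finally have le: "(\<integral>\<^sup>+u. ennreal (ep (u - s)) * indicator {0..t} u \<partial>lborel) \<le> ennreal (2 * E)" .
  have "(\<integral>\<^sup>+u. ennreal (ep (u - s)) \<partial>U t) = (\<integral>\<^sup>+u. ennreal (ep (u - s)) * indicator {0..t} u \<partial>lborel) / emeasure lborel {0..t}"
    by (rule nn_integral_uniform_measure) auto
  also have "\<dots> \<le> ennreal (2 * E) / ennreal t"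
    using le t by (simp add: divide_right_mono_ennreal)
  also have "\<dots> = ennreal (2 * E / t)" using E t by (simp add: divide_ennreal)
  finally show ?thesis by (simp add: E_def)
qed

text \<open>The square of the time average is a double time average of \<open>Y\<^sub>s Y\<^sub>u\<close>.  After the covariance bound,
  integrating the kernel \<open>e(\<bar>u - s\<bar>)\<close> in one variable gives \<open>2/t\<close> times the integral of \<open>e\<close>, and
  integrating \<open>G\<close> in the other one gives the mean occupation measure of \<open>A\<close>.\<close>

lemma second_moment_le:
  assumes t: "0 < t" and A: "A \<in> sets borel" and l: "0 < l"
  defines "P \<equiv> measure (mean_occ_measure M X t) A + measure \<nu> A"
  shows "(\<integral>\<omega>. (\<integral>s. Y A s \<omega> \<partial>U t)\<^sup>2 \<partial>M) \<le> 4 * (LINT s:{0..t}|lborel. e s) / t * (l * P + l powr (1 - q) * Cq)"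
proof -
  interpret U: prob_space "U t" by (rule prob_space_U[OF t])
  interpret P: pair_prob_space "U t" M ..
  interpret UU: pair_sigma_finite "U t" "U t" ..
  interpret \<nu>: prob_space \<nu> by (rule \<nu>(1))
  interpret m: prob_space "mean_occ_measure M X t" by (rule prob_space_mean_occ_measure[OF t])
  note [measurable] = A
  define E where "E = (LINT s:{0..t}|lborel. e s)"
  have E: "0 \<le> E" using e_integral(2)[of t] t by (simp add: E_def)
  have Yj [measurable]: "(\<lambda>z. Y A (fst z) (snd z)) \<in> borel_measurable (U t \<Otimes>\<^sub>M M)"
    using Y_joint_measurable[OF A] by (simp cong: measurable_cong_sets)
  have Yj' [measurable]: "(\<lambda>z. Y A (snd z) (fst z)) \<in> borel_measurable (M \<Otimes>\<^sub>M U t)"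
    using measurable_compose[OF measurable_pair_swap' Yj] by (simp add: case_prod_beta)
  define Z where "Z = (\<lambda>\<omega>. \<integral>s. Y A s \<omega> \<partial>U t)"
  have [measurable]: "Z \<in> borel_measurable M"
    unfolding Z_def by (rule U.borel_measurable_lebesgue_integral) (simp add: case_prod_beta)
  have Z1: "\<bar>Z \<omega>\<bar> \<le> 1" if "\<omega> \<in> space M" for \<omega>
  proof -
    have [measurable]: "(\<lambda>s. Y A s \<omega>) \<in> borel_measurable (U t)"
      using measurable_compose[OF measurable_Pair2'[OF that] Yj] by simp
    have "norm (Z \<omega>) \<le> (\<integral>s. 1 \<partial>U t)"
      unfolding Z_def by (intro Bochner_Integration.integral_norm_bound_integral U.integrable_const_bound[where B=1])
        (auto simp: Y_bound)
    then show ?thesis by (simp add: U.prob_space[simplified])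
  qed
  have swap: "(\<integral>\<omega>. \<integral>s. Y A s \<omega> * V \<omega> \<partial>U t \<partial>M) = (\<integral>s. \<integral>\<omega>. Y A s \<omega> * V \<omega> \<partial>M \<partial>U t)"
    if [measurable]: "V \<in> borel_measurable M" and V: "\<And>\<omega>. \<omega> \<in> space M \<Longrightarrow> \<bar>V \<omega>\<bar> \<le> 1" for V
  proof (rule P.Fubini_integral)
    show "integrable (U t \<Otimes>\<^sub>M M) (\<lambda>(s, \<omega>). Y A s \<omega> * V \<omega>)"
    proof (rule P.integrable_const_bound[where B=1])
      show "AE z in U t \<Otimes>\<^sub>M M. norm (case z of (s, \<omega>) \<Rightarrow> Y A s \<omega> * V \<omega>) \<le> 1"
        using V Y_bound by (intro AE_I2) (auto simp: abs_mult space_pair_measure intro!: mult_le_one)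
      show "(\<lambda>(s, \<omega>). Y A s \<omega> * V \<omega>) \<in> borel_measurable (U t \<Otimes>\<^sub>M M)"
        unfolding case_prod_beta by measurable
    qed
  qed
  have norm_le: "ennreal \<bar>\<integral>x. f x \<partial>N\<bar> \<le> (\<integral>\<^sup>+x. ennreal \<bar>f x\<bar> \<partial>N)" for N and f :: "'b \<Rightarrow> real"
    using integral_norm_bound_ennreal[of N f] by (cases "integrable N f") (auto simp: not_integrable_integral_eq)
  define G where "G = (\<lambda>s. ennreal l * (\<integral>\<^sup>+\<omega>. ennreal \<bar>Y A s \<omega>\<bar> \<partial>M) + ennreal (l powr (1 - q) * Cq))"
  have "(\<integral>\<omega>. (Z \<omega>)\<^sup>2 \<partial>M) = (\<integral>\<omega>. \<integral>s. Y A s \<omega> * Z \<omega> \<partial>U t \<partial>M)"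
    by (simp add: Z_def power2_eq_square)
  also have "\<dots> = (\<integral>s. \<integral>\<omega>. Y A s \<omega> * Z \<omega> \<partial>M \<partial>U t)"
    by (rule swap) (use Z1 in auto)
  finally have "ennreal \<bar>\<integral>\<omega>. (Z \<omega>)\<^sup>2 \<partial>M\<bar> \<le> (\<integral>\<^sup>+s. ennreal \<bar>\<integral>\<omega>. Y A s \<omega> * Z \<omega> \<partial>M\<bar> \<partial>U t)"
    using norm_le[of "U t" "\<lambda>s. \<integral>\<omega>. Y A s \<omega> * Z \<omega> \<partial>M"] by simp
  also have "\<dots> \<le> (\<integral>\<^sup>+s. \<integral>\<^sup>+u. ennreal \<bar>\<integral>\<omega>. Y A s \<omega> * Y A u \<omega> \<partial>M\<bar> \<partial>U t \<partial>U t)"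
  proof (rule nn_integral_mono)
    fix s
    have "(\<integral>\<omega>. Y A s \<omega> * Z \<omega> \<partial>M) = (\<integral>\<omega>. \<integral>u. Y A u \<omega> * Y A s \<omega> \<partial>U t \<partial>M)"
      by (simp add: Z_def mult.commute)
    also have "\<dots> = (\<integral>u. \<integral>\<omega>. Y A u \<omega> * Y A s \<omega> \<partial>M \<partial>U t)"
      by (rule swap) (auto simp: Y_bound)
    finally show "ennreal \<bar>\<integral>\<omega>. Y A s \<omega> * Z \<omega> \<partial>M\<bar> \<le> (\<integral>\<^sup>+u. ennreal \<bar>\<integral>\<omega>. Y A s \<omega> * Y A u \<omega> \<partial>M\<bar> \<partial>U t)"
      using norm_le[of "U t" "\<lambda>u. \<integral>\<omega>. Y A u \<omega> * Y A s \<omega> \<partial>M"] by (simp add: mult.commute)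
  qed
  also have "\<dots> \<le> (\<integral>\<^sup>+s. \<integral>\<^sup>+u. ennreal (ep (u - s)) * (G s + G u) \<partial>U t \<partial>U t)"
  proof -
    have ae: "AE s in U t. 0 \<le> s"
      using t by (subst AE_uniform_measure) auto
    show ?thesis
      unfolding G_def
      by (rule nn_integral_mono_AE, rule eventually_mono[OF ae], rule nn_integral_mono_AE, rule eventually_mono[OF ae])
         (rule covariance_Y_le[OF _ _ A l])
  qed
  finally have 1: "ennreal \<bar>\<integral>\<omega>. (Z \<omega>)\<^sup>2 \<partial>M\<bar> \<le> (\<integral>\<^sup>+s. \<integral>\<^sup>+u. ennreal (ep (u - s)) * (G s + G u) \<partial>U t \<partial>U t)" .
  have [measurable]: "(\<lambda>s. \<integral>\<^sup>+\<omega>. ennreal \<bar>Y A s \<omega>\<bar> \<partial>M) \<in> borel_measurable borel"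
    using borel_measurable_nn_integral_fst[of "\<lambda>z. ennreal \<bar>Y A (fst z) (snd z)\<bar>" borel] by simp
  have Gm [measurable]: "G \<in> borel_measurable borel" unfolding G_def by measurable
  have half: "(\<integral>\<^sup>+s. \<integral>\<^sup>+u. ennreal (ep (u - s)) * G s \<partial>U t \<partial>U t) \<le> ennreal (2 * E / t) * (\<integral>\<^sup>+s. G s \<partial>U t)"
  proof -
    have "(\<integral>\<^sup>+s. \<integral>\<^sup>+u. ennreal (ep (u - s)) * G s \<partial>U t \<partial>U t) = (\<integral>\<^sup>+s. (\<integral>\<^sup>+u. ennreal (ep (u - s)) \<partial>U t) * G s \<partial>U t)"
      by (intro nn_integral_cong nn_integral_multc) (simp cong: measurable_cong_sets)
    also have "\<dots> \<le> (\<integral>\<^sup>+s. ennreal (2 * E / t) * G s \<partial>U t)"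
    proof (rule nn_integral_mono_AE)
      have "AE s in U t. s \<in> {0..t}" using t by (subst AE_uniform_measure) auto
      then show "AE s in U t. (\<integral>\<^sup>+u. ennreal (ep (u - s)) \<partial>U t) * G s \<le> ennreal (2 * E / t) * G s"
        by eventually_elim (auto intro!: mult_right_mono ep_average_le[OF t, folded E_def])
    qed
    also have "\<dots> = ennreal (2 * E / t) * (\<integral>\<^sup>+s. G s \<partial>U t)"
      by (rule nn_integral_cmult) (simp cong: measurable_cong_sets)
    finally show ?thesis .
  qed
  have epm: "(\<lambda>(s, u). ennreal (ep (u - s)) * G u) \<in> borel_measurable (U t \<Otimes>\<^sub>M U t)"
  proof -
    have "(\<lambda>z. ennreal (ep (snd z - fst z)) * G (snd z)) \<in> borel_measurable (borel \<Otimes>\<^sub>M borel)" by measurable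
    then show ?thesis by (simp add: case_prod_beta cong: measurable_cong_sets sets_pair_measure_cong)
  qed
  have "(\<integral>\<^sup>+s. \<integral>\<^sup>+u. ennreal (ep (u - s)) * (G s + G u) \<partial>U t \<partial>U t)
      = (\<integral>\<^sup>+s. (\<integral>\<^sup>+u. ennreal (ep (u - s)) * G s \<partial>U t) + (\<integral>\<^sup>+u. ennreal (ep (u - s)) * G u \<partial>U t) \<partial>U t)"
    by (intro nn_integral_cong) (subst nn_integral_add[symmetric], auto simp: distrib_left cong: measurable_cong_sets)
  also have "\<dots> = (\<integral>\<^sup>+s. \<integral>\<^sup>+u. ennreal (ep (u - s)) * G s \<partial>U t \<partial>U t) + (\<integral>\<^sup>+s. \<integral>\<^sup>+u. ennreal (ep (u - s)) * G u \<partial>U t \<partial>U t)"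
  proof (rule nn_integral_add)
    show "(\<lambda>s. \<integral>\<^sup>+u. ennreal (ep (u - s)) * G u \<partial>U t) \<in> borel_measurable (U t)"
      using U.borel_measurable_nn_integral_fst[OF epm] by simp
    have "(\<lambda>(s, u). ennreal (ep (u - s)) * G s) \<in> borel_measurable (U t \<Otimes>\<^sub>M U t)"
    proof -
      have "(\<lambda>z. ennreal (ep (snd z - fst z)) * G (fst z)) \<in> borel_measurable (borel \<Otimes>\<^sub>M borel)" by measurable
      then show ?thesis by (simp add: case_prod_beta cong: measurable_cong_sets sets_pair_measure_cong)
    qed
    from U.borel_measurable_nn_integral_fst[OF this]
    show "(\<lambda>s. \<integral>\<^sup>+u. ennreal (ep (u - s)) * G s \<partial>U t) \<in> borel_measurable (U t)" by simp
  qed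
  also have "(\<integral>\<^sup>+s. \<integral>\<^sup>+u. ennreal (ep (u - s)) * G u \<partial>U t \<partial>U t) = (\<integral>\<^sup>+u. \<integral>\<^sup>+s. ennreal (ep (u - s)) * G u \<partial>U t \<partial>U t)"
    by (rule UU.Fubini'[symmetric]) (rule epm)
  also have "\<dots> = (\<integral>\<^sup>+s. \<integral>\<^sup>+u. ennreal (ep (u - s)) * G s \<partial>U t \<partial>U t)"
    by (simp add: ep_def abs_minus_commute)
  also have "(\<integral>\<^sup>+s. \<integral>\<^sup>+u. ennreal (ep (u - s)) * G s \<partial>U t \<partial>U t) + (\<integral>\<^sup>+s. \<integral>\<^sup>+u. ennreal (ep (u - s)) * G s \<partial>U t \<partial>U t)
      \<le> ennreal (2 * E / t) * (\<integral>\<^sup>+s. G s \<partial>U t) + ennreal (2 * E / t) * (\<integral>\<^sup>+s. G s \<partial>U t)"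
    by (intro add_mono half)
  finally have 2: "(\<integral>\<^sup>+s. \<integral>\<^sup>+u. ennreal (ep (u - s)) * (G s + G u) \<partial>U t \<partial>U t)
     \<le> ennreal (2 * E / t) * (\<integral>\<^sup>+s. G s \<partial>U t) + ennreal (2 * E / t) * (\<integral>\<^sup>+s. G s \<partial>U t)" .
  have "(\<integral>\<^sup>+s. G s \<partial>U t) = ennreal l * (\<integral>\<^sup>+s. \<integral>\<^sup>+\<omega>. ennreal \<bar>Y A s \<omega>\<bar> \<partial>M \<partial>U t) + ennreal (l powr (1 - q) * Cq)"
    unfolding G_def by (subst nn_integral_add) (auto simp: nn_integral_cmult U.emeasure_space_1[simplified] cong: measurable_cong_sets)
  also have "(\<integral>\<^sup>+s. \<integral>\<^sup>+\<omega>. ennreal \<bar>Y A s \<omega>\<bar> \<partial>M \<partial>U t) \<le> (\<integral>\<^sup>+s. (\<integral>\<^sup>+\<omega>. indicator A (Xp s \<omega>) \<partial>M) + ennreal (measure \<nu> A) \<partial>U t)"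
  proof (rule nn_integral_mono)
    fix s
    have "(\<integral>\<^sup>+\<omega>. ennreal \<bar>Y A s \<omega>\<bar> \<partial>M) \<le> (\<integral>\<^sup>+\<omega>. indicator A (Xp s \<omega>) + ennreal (measure \<nu> A) \<partial>M)"
    proof (rule nn_integral_mono)
      fix \<omega>
      have "\<bar>Y A s \<omega>\<bar> \<le> indicator A (Xp s \<omega>) + measure \<nu> A"
        unfolding Y_def using measure_nonneg[of \<nu> A] by (auto simp: indicator_def)
      then show "ennreal \<bar>Y A s \<omega>\<bar> \<le> indicator A (Xp s \<omega>) + ennreal (measure \<nu> A)"
        by (auto simp: indicator_def ennreal_plus[symmetric] ennreal_leI simp del: ennreal_plus simp flip: ennreal_1)
    qed
    also have "\<dots> = (\<integral>\<^sup>+\<omega>. indicator A (Xp s \<omega>) \<partial>M) + ennreal (measure \<nu> A)"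
      by (subst nn_integral_add) (auto simp: emeasure_space_1)
    finally show "(\<integral>\<^sup>+\<omega>. ennreal \<bar>Y A s \<omega>\<bar> \<partial>M) \<le> (\<integral>\<^sup>+\<omega>. indicator A (Xp s \<omega>) \<partial>M) + ennreal (measure \<nu> A)" .
  qed
  also have "\<dots> = emeasure (mean_occ_measure M X t) A + ennreal (measure \<nu> A)"
  proof -
    have "(\<lambda>z. indicator A (Xp (fst z) (snd z)) :: ennreal) \<in> borel_measurable (borel \<Otimes>\<^sub>M M)"
      by (rule measurable_compose[OF joint_measurable]) measurable
    from borel_measurable_nn_integral_fst[OF this]
    have [measurable]: "(\<lambda>s. \<integral>\<^sup>+\<omega>. indicator A (Xp s \<omega>) \<partial>M) \<in> borel_measurable (U t)"
      by (simp cong: measurable_cong_sets)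
    show ?thesis
      by (subst nn_integral_add) (auto simp: emeasure_mean_occ_measure[OF t A] U.emeasure_space_1[simplified])
  qed
  also have "ennreal l * (emeasure (mean_occ_measure M X t) A + ennreal (measure \<nu> A)) + ennreal (l powr (1 - q) * Cq) = ennreal (l * P + l powr (1 - q) * Cq)"
    using l Cq(1) by (simp add: m.emeasure_eq_measure P_def ennreal_plus ennreal_mult)
  finally have 3: "(\<integral>\<^sup>+s. G s \<partial>U t) \<le> ennreal (l * P + l powr (1 - q) * Cq)"
    using l by (simp add: mult_left_mono add_right_mono)
  have R0: "0 \<le> l * P + l powr (1 - q) * Cq" using l Cq(1) by (simp add: P_def)
  have "ennreal \<bar>\<integral>\<omega>. (Z \<omega>)\<^sup>2 \<partial>M\<bar> \<le> ennreal (2 * E / t) * ennreal (l * P + l powr (1 - q) * Cq) + ennreal (2 * E / t) * ennreal (l * P + l powr (1 - q) * Cq)"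
    by (rule order_trans[OF 1], rule order_trans[OF 2]) (intro add_mono mult_left_mono 3, auto)
  also have "\<dots> = ennreal (4 * E / t * (l * P + l powr (1 - q) * Cq))"
    using E t R0 by (simp add: ennreal_mult[symmetric] ennreal_plus[symmetric] del: ennreal_plus)
  finally have "(\<integral>\<omega>. (Z \<omega>)\<^sup>2 \<partial>M) \<le> 4 * E / t * (l * P + l powr (1 - q) * Cq)"
    using E t R0 by (subst (asm) ennreal_le_iff) (auto intro!: mult_nonneg_nonneg divide_nonneg_pos)
  then show ?thesis by (simp add: Z_def E_def)
qed

end

section \<open>Mean deviation of the occupation measure\<close>

lemma emeasure_half_sum:
  fixes \<mu> \<nu> :: "'a::euclidean_space measure"
  assumes "sets \<mu> = sets borel" "sets \<nu> = sets borel" "A \<in> sets borel"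
  shows "emeasure (half_sum \<mu> \<nu>) A = 1 / 2 * (emeasure \<mu> A + emeasure \<nu> A)"
  using assms by (simp add: half_sum_eq emeasure_add_measure)

lemma half_mult_ennreal:
  assumes "0 \<le> x" shows "1 / 2 * ennreal x = ennreal (x / 2)"
proof -
  have "1 / 2 * ennreal x = ennreal x / ennreal 2"
    by (simp add: divide_ennreal_def mult.commute)
  also have "\<dots> = ennreal (x / 2)"
    using assms by (rule divide_ennreal) simp
  finally show ?thesis .
qed

lemma half_sum_prob:
  fixes \<mu> \<nu> :: "'a::euclidean_space measure"
  assumes prob: "prob_space \<mu>" "prob_space \<nu>" and sets: "sets \<mu> = sets borel" "sets \<nu> = sets borel"
  shows "prob_space (half_sum \<mu> \<nu>)"
    and "A \<in> sets borel \<Longrightarrow> measure (half_sum \<mu> \<nu>) A = (measure \<mu> A + measure \<nu> A) / 2"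
proof -
  interpret \<mu>: prob_space \<mu> by fact
  interpret \<nu>: prob_space \<nu> by fact
  have sp: "space \<mu> = UNIV" "space \<nu> = UNIV" "space (half_sum \<mu> \<nu>) = UNIV"
    using sets by (auto dest!: sets_eq_imp_space_eq simp: half_sum_def)
  have eq: "emeasure (half_sum \<mu> \<nu>) A = ennreal ((measure \<mu> A + measure \<nu> A) / 2)" if "A \<in> sets borel" for A
  proof -
    have "emeasure (half_sum \<mu> \<nu>) A = 1 / 2 * ennreal (measure \<mu> A + measure \<nu> A)"
      unfolding emeasure_half_sum[OF sets that] \<mu>.emeasure_eq_measure \<nu>.emeasure_eq_measure
      by (simp only: ennreal_plus measure_nonneg)
    also have "\<dots> = ennreal ((measure \<mu> A + measure \<nu> A) / 2)"
      by (rule half_mult_ennreal) simp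
    finally show ?thesis .
  qed
  have "measure \<mu> UNIV = 1" "measure \<nu> UNIV = 1" using \<mu>.prob_space \<nu>.prob_space sp by simp_all
  then have "emeasure (half_sum \<mu> \<nu>) UNIV = 1" using eq[of UNIV] by simp
  then show "prob_space (half_sum \<mu> \<nu>)" by (intro prob_spaceI) (simp add: sp)
  show "A \<in> sets borel \<Longrightarrow> measure (half_sum \<mu> \<nu>) A = (measure \<mu> A + measure \<nu> A) / 2"
    using eq[of A] by (simp add: measure_def)
qed

lemma abs_moment_half_sum_le:
  fixes \<mu> \<nu> :: "'a::euclidean_space measure"
  assumes sets: "sets \<mu> = sets borel" "sets \<nu> = sets borel"
    and le: "abs_moment \<mu> q \<le> m" "abs_moment \<nu> q \<le> m" and m: "m < \<top>"
  shows "abs_moment (half_sum \<mu> \<nu>) q \<le> m"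
proof -
  have meas: "(\<lambda>x. ennreal (norm x powr q)) \<in> borel_measurable (add_measure \<mu> \<nu>)" "(\<lambda>x. ennreal (norm x powr q)) \<in> borel_measurable \<mu>"
    using sets by (simp_all cong: measurable_cong_sets)
  have "abs_moment (half_sum \<mu> \<nu>) q = 1 / 2 * (abs_moment \<mu> q + abs_moment \<nu> q)"
    unfolding abs_moment_def half_sum_eq[OF sets]
    using meas sets by (simp add: nn_integral_scale_measure nn_integral_add_measure)
  also have "\<dots> \<le> 1 / 2 * (m + m)"
    by (intro mult_left_mono add_mono le) simp
  also have "\<dots> = m"
  proof -
    obtain s where s: "m = ennreal s" "0 \<le> s" using m by (cases m) auto
    have "1 / 2 * (m + m) = 1 / 2 * ennreal (s + s)"
      unfolding s(1) by (simp only: ennreal_plus s(2))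
    also have "\<dots> = m"
      unfolding s(1) using s(2) by (subst half_mult_ennreal) simp_all
    finally show ?thesis .
  qed
  finally show ?thesis .
qed

lemma abs_moment_finite_mono:
  fixes \<nu> :: "'a::euclidean_space measure"
  assumes \<nu>: "prob_space \<nu>" "sets \<nu> = sets borel" and p: "0 < p" "p \<le> q" and fin: "abs_moment \<nu> q < \<top>"
  shows "abs_moment \<nu> p < \<top>"
proof -
  interpret prob_space \<nu> by fact
  note [measurable_cong] = \<nu>(2)
  have "abs_moment \<nu> p \<le> (\<integral>\<^sup>+x. 1 + ennreal (norm x powr q) \<partial>\<nu>)"
    unfolding abs_moment_def
  proof (rule nn_integral_mono)
    fix x :: 'a
    have "norm x powr p \<le> 1 + norm x powr q"
    proof (cases "norm x \<le> 1")
      case True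
      then have "norm x powr p \<le> 1 powr p" using p by (intro powr_mono2) auto
      then show ?thesis by (simp add: add_increasing2)
    next
      case False
      then have "norm x powr p \<le> norm x powr q" using p by (intro powr_mono) auto
      then show ?thesis by simp
    qed
    then show "ennreal (norm x powr p) \<le> 1 + ennreal (norm x powr q)"
      by (simp add: ennreal_plus[symmetric] ennreal_leI del: ennreal_plus flip: ennreal_1)
  qed
  also have "\<dots> = 1 + abs_moment \<nu> q"
    unfolding abs_moment_def by (subst nn_integral_add) (auto simp: emeasure_space_1)
  also have "\<dots> < \<top>" using fin by simp
  finally show ?thesis .
qed

context mixing_process begin

abbreviation mean_half :: "real \<Rightarrow> 'a measure" where
  "mean_half t \<equiv> half_sum (mean_occ_measure M X t) \<nu>"

abbreviation occ_rate :: "real \<Rightarrow> real \<Rightarrow> (real \<Rightarrow> real) \<Rightarrow> bool" where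
  "occ_rate \<equiv> wasserstein_rate M (occ_measure X) \<nu> mean_half q"

lemma occ_deviation:
  assumes t: "0 < t" and A: "A \<in> sets borel" and \<omega>: "\<omega> \<in> space M"
  shows "measure (occ_measure X t \<omega>) A - measure \<nu> A = (\<integral>s. Y A s \<omega> \<partial>U t)"
proof -
  interpret U: prob_space "U t" by (rule prob_space_U[OF t])
  note [measurable] = A measurable_path[OF \<omega>]
  have "measure (occ_measure X t \<omega>) A = (\<integral>x. indicator A x \<partial>occ_measure X t \<omega>)"
    using A by (simp add: occ_measure_def)
  also have "\<dots> = (\<integral>s. indicator A (Xp s \<omega>) \<partial>U t)"
    unfolding occ_measure_eq[OF t \<omega>] by (rule integral_distr) auto
  finally have 1: "measure (occ_measure X t \<omega>) A = (\<integral>s. indicator A (Xp s \<omega>) \<partial>U t)" .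
  have "(\<integral>s. Y A s \<omega> \<partial>U t) = (\<integral>s. indicator A (Xp s \<omega>) \<partial>U t) - (\<integral>s. measure \<nu> A \<partial>U t)"
    unfolding Y_def by (intro Bochner_Integration.integral_diff U.integrable_const_bound[where B=1])
      (auto simp: indicator_def prob_space.prob_le_1[OF \<nu>(1)])
  then show ?thesis using 1 by (simp add: U.prob_space[simplified])
qed

lemma mean_deviation_le_sqrt:
  assumes t: "0 < t" and A: "A \<in> sets borel"
  shows "(\<integral>\<^sup>+\<omega>. ennreal \<bar>measure (occ_measure X t \<omega>) A - measure \<nu> A\<bar> \<partial>M)
    \<le> ennreal (sqrt (\<integral>\<omega>. (\<integral>s. Y A s \<omega> \<partial>U t)\<^sup>2 \<partial>M))"
proof -
  define Z where "Z = (\<lambda>\<omega>. \<bar>measure (occ_measure X t \<omega>) A - measure \<nu> A\<bar>)"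
  have [measurable]: "(\<lambda>\<omega>. measure (occ_measure X t \<omega>) A) \<in> borel_measurable M"
    by (rule measure_measurable_prob_algebra2[OF _ occ_measure_prob_algebra[OF t]]) (use A in simp)
  have [measurable]: "Z \<in> borel_measurable M" unfolding Z_def by measurable
  have Z1: "0 \<le> Z \<omega>" "Z \<omega> \<le> 1" if "\<omega> \<in> space M" for \<omega>
  proof -
    have "prob_space (occ_measure X t \<omega>)"
      using measurable_space[OF occ_measure_prob_algebra[OF t] that] by (simp add: space_prob_algebra)
    then have "measure (occ_measure X t \<omega>) A \<le> 1" by (rule prob_space.prob_le_1)
    moreover have "measure \<nu> A \<le> 1" using \<nu>(1) by (rule prob_space.prob_le_1)
    moreover have "0 \<le> measure (occ_measure X t \<omega>) A" "0 \<le> measure \<nu> A" by simp_all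
    ultimately show "0 \<le> Z \<omega>" "Z \<omega> \<le> 1" unfolding Z_def by linarith+
  qed
  have i1: "integrable M Z"
    using Z1 by (intro integrable_const_bound[where B=1]) auto
  have i2: "integrable M (\<lambda>\<omega>. (Z \<omega>)\<^sup>2)"
    using Z1 by (intro integrable_const_bound[where B=1]) (auto simp: power_le_one)
  have "(expectation Z)\<^sup>2 \<le> expectation (\<lambda>\<omega>. (Z \<omega>)\<^sup>2)"
    using variance_eq[OF i1 i2] variance_positive[of Z] by simp
  then have "expectation Z \<le> sqrt (expectation (\<lambda>\<omega>. (Z \<omega>)\<^sup>2))"
    by (rule real_le_rsqrt)
  also have "expectation (\<lambda>\<omega>. (Z \<omega>)\<^sup>2) = (\<integral>\<omega>. (\<integral>s. Y A s \<omega> \<partial>U t)\<^sup>2 \<partial>M)"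
    by (intro Bochner_Integration.integral_cong refl) (simp add: Z_def occ_deviation[OF t A])
  finally have "ennreal (expectation Z) \<le> ennreal (sqrt (\<integral>\<omega>. (\<integral>s. Y A s \<omega> \<partial>U t)\<^sup>2 \<partial>M))"
    by (rule ennreal_leI)
  moreover have "(\<integral>\<^sup>+\<omega>. ennreal (Z \<omega>) \<partial>M) = ennreal (expectation Z)"
    using Z1 by (intro nn_integral_eq_integral i1 AE_I2) auto
  ultimately show ?thesis by (simp add: Z_def)
qed

lemma mean_deviation_le_sum:
  assumes t: "0 < t" and A: "A \<in> sets borel"
  shows "(\<integral>\<^sup>+\<omega>. ennreal \<bar>measure (occ_measure X t \<omega>) A - measure \<nu> A\<bar> \<partial>M)
    \<le> ennreal (measure (mean_occ_measure M X t) A + measure \<nu> A)"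
proof -
  interpret m: prob_space "mean_occ_measure M X t" by (rule prob_space_mean_occ_measure[OF t])
  have [measurable]: "(\<lambda>\<omega>. measure (occ_measure X t \<omega>) A) \<in> borel_measurable M"
    by (rule measure_measurable_prob_algebra2[OF _ occ_measure_prob_algebra[OF t]]) (use A in simp)
  have "(\<integral>\<^sup>+\<omega>. ennreal \<bar>measure (occ_measure X t \<omega>) A - measure \<nu> A\<bar> \<partial>M)
     \<le> (\<integral>\<^sup>+\<omega>. ennreal (measure (occ_measure X t \<omega>) A) + ennreal (measure \<nu> A) \<partial>M)"
  proof (rule nn_integral_mono)
    fix \<omega>
    have "\<bar>measure (occ_measure X t \<omega>) A - measure \<nu> A\<bar> \<le> measure (occ_measure X t \<omega>) A + measure \<nu> A"
      using measure_nonneg[of "occ_measure X t \<omega>" A] measure_nonneg[of \<nu> A] by linarith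
    then show "ennreal \<bar>measure (occ_measure X t \<omega>) A - measure \<nu> A\<bar> \<le> ennreal (measure (occ_measure X t \<omega>) A) + ennreal (measure \<nu> A)"
      by (simp add: ennreal_plus[symmetric] ennreal_leI del: ennreal_plus)
  qed
  also have "\<dots> = (\<integral>\<^sup>+\<omega>. ennreal (measure (occ_measure X t \<omega>) A) \<partial>M) + ennreal (measure \<nu> A)"
    by (subst nn_integral_add) (auto simp: emeasure_space_1)
  also have "(\<integral>\<^sup>+\<omega>. ennreal (measure (occ_measure X t \<omega>) A) \<partial>M) = (\<integral>\<^sup>+\<omega>. emeasure (occ_measure X t \<omega>) A \<partial>M)"
  proof (rule nn_integral_cong)
    fix \<omega> assume "\<omega> \<in> space M"
    then interpret o: prob_space "occ_measure X t \<omega>"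
      using measurable_space[OF occ_measure_prob_algebra[OF t]] by (simp add: space_prob_algebra)
    show "ennreal (measure (occ_measure X t \<omega>) A) = emeasure (occ_measure X t \<omega>) A"
      by (simp add: o.emeasure_eq_measure)
  qed
  also have "\<dots> = emeasure (mean_occ_measure M X t) A"
    unfolding mean_occ_measure_def
    by (rule emeasure_bind[OF not_empty measurable_prob_algebraD[OF occ_measure_prob_algebra[OF t]] A, symmetric])
  finally show ?thesis
    by (simp add: m.emeasure_eq_measure ennreal_plus)
qed

lemma abs_moment_mean_occ_le:
  assumes t: "0 < t"
  shows "abs_moment (mean_occ_measure M X t) q \<le> X_moment"
proof -
  interpret U: prob_space "U t" by (rule prob_space_U[OF t])
  have "abs_moment (mean_occ_measure M X t) q = (\<integral>\<^sup>+s. \<integral>\<^sup>+\<omega>. ennreal (norm (Xp s \<omega>) powr q) \<partial>M \<partial>U t)"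
    unfolding abs_moment_def by (rule nn_integral_mean_occ_measure[OF t]) measurable
  also have "\<dots> \<le> (\<integral>\<^sup>+s. X_moment \<partial>U t)"
    unfolding Xp_def by (intro nn_integral_mono moment_le_X_moment) simp
  also have "\<dots> = X_moment"
    by (simp add: U.emeasure_space_1[simplified])
  finally show ?thesis .
qed

text \<open>The parameter of \<open>second_moment_le\<close> is chosen as \<open>P\<^bsup>-1/q\<^esup>\<close> with \<open>P = 2 \<pi>\<^sub>t(A)\<close>, which balances its two
  terms: both become \<open>P\<^bsup>1-1/q\<^esup> = P\<^bsup>2\<beta>\<^esup>\<close>.  A null set of \<open>\<pi>\<^sub>t\<close> is covered by the trivial bound.\<close>

lemma property_A_occ_measure:
  assumes t0: "0 < t0"
  shows "property_A M (occ_measure X) \<nu> mean_half t0 (1 / 2 * (1 - 1 / q)) q \<gamma>"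
    and "sup_moment mean_half t0 q \<le> max 1 X_moment"
proof -
  define \<beta> where "\<beta> = 1 / 2 * (1 - 1 / q)"
  have \<beta>: "0 < \<beta>" "\<beta> < 1" "2 * \<beta> = 1 - 1 / q" using q by (simp_all add: \<beta>_def field_simps)
  have half: "prob_space (mean_half t)" "A \<in> sets borel \<Longrightarrow> measure (mean_half t) A = (measure (mean_occ_measure M X t) A + measure \<nu> A) / 2"
    if "t0 \<le> t" for t A
    using half_sum_prob[OF prob_space_mean_occ_measure \<nu>(1) sets_mean_occ_measure \<nu>(2)] that t0 by auto
  have mom: "abs_moment (mean_half t) q \<le> X_moment" if "t0 \<le> t" for t
    using that t0
    by (intro abs_moment_half_sum_le sets_mean_occ_measure \<nu> abs_moment_mean_occ_le moment_\<nu>_le X_moment_finite) auto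
  then have "(SUP t\<in>{t0..}. abs_moment (mean_half t) q) \<le> X_moment" by (intro SUP_least) simp
  then show sup: "sup_moment mean_half t0 q \<le> max 1 X_moment"
    unfolding sup_moment_def by (rule max.mono[OF order_refl])
  also have "max 1 X_moment < \<top>" using X_moment_finite by simp
  finally have sup_fin: "sup_moment mean_half t0 q < \<top>" .
  obtain K where K: "K > 0" "\<And>t. t \<ge> t0 \<Longrightarrow> (LINT s:{0..t}|lborel. e s) \<le> K * t powr (1 - 2 * \<gamma>)"
    using e_integral_le_rate[OF t0] by blast
  define B where "B = sqrt (4 * K * (1 + Cq))"
  define C0 where "C0 = max 2 (2 * B)"
  have B0: "0 \<le> B" using K Cq(1) by (simp add: B_def)
  have "(\<integral>\<^sup>+\<omega>. ennreal \<bar>measure (occ_measure X t \<omega>) A - measure \<nu> A\<bar> \<partial>M)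
      \<le> ennreal (C0 * min (measure (mean_half t) A) (measure (mean_half t) A powr \<beta> * t powr (-\<gamma>)))"
    if t: "t0 \<le> t" and A: "A \<in> sets borel" for t A
  proof -
    have tp: "0 < t" using t t0 by simp
    define P where "P = measure (mean_occ_measure M X t) A + measure \<nu> A"
    have P: "measure (mean_half t) A = P / 2" using half(2)[OF t A] by (simp add: P_def)
    have P0: "0 \<le> P" by (simp add: P_def)
    have 1: "(\<integral>\<^sup>+\<omega>. ennreal \<bar>measure (occ_measure X t \<omega>) A - measure \<nu> A\<bar> \<partial>M) \<le> ennreal P"
      unfolding P_def by (rule mean_deviation_le_sum[OF tp A])
    show ?thesis
    proof (cases "P = 0")
      case True
      then show ?thesis using 1 P by simp
    next
      case False
      then have Pp: "0 < P" using P0 by simp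
      define l where "l = P powr (- (1 / q))"
      define E where "E = (LINT s:{0..t}|lborel. e s)"
      have E: "0 \<le> E" "E \<le> K * t powr (1 - 2 * \<gamma>)"
        using e_integral(2)[of t] K(2)[OF t] tp by (simp_all add: E_def)
      have l: "l * P = P powr (2 * \<beta>)" "l powr (1 - q) = P powr (2 * \<beta>)"
      proof -
        have "l * P = P powr (- (1 / q)) * P powr 1" using Pp by (simp add: l_def)
        also have "\<dots> = P powr (2 * \<beta>)" unfolding powr_add[symmetric] \<beta>(3) by (simp add: algebra_simps)
        finally show "l * P = P powr (2 * \<beta>)" .
        have "- (1 / q) * (1 - q) = 2 * \<beta>" unfolding \<beta>(3) using q by (simp add: field_simps)
        then show "l powr (1 - q) = P powr (2 * \<beta>)" by (simp add: l_def powr_powr)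
      qed
      have "(\<integral>\<omega>. (\<integral>s. Y A s \<omega> \<partial>U t)\<^sup>2 \<partial>M) \<le> 4 * E / t * (l * P + l powr (1 - q) * Cq)"
        unfolding E_def P_def by (rule second_moment_le[OF tp A]) (use Pp in \<open>simp add: l_def\<close>)
      also have "\<dots> = 4 * (E / t) * ((1 + Cq) * P powr (2 * \<beta>))"
        unfolding l by (simp add: algebra_simps)
      also have "\<dots> \<le> 4 * (K * t powr (- (2 * \<gamma>))) * ((1 + Cq) * P powr (2 * \<beta>))"
      proof (intro mult_right_mono mult_left_mono)
        have "E / t \<le> K * t powr (1 - 2 * \<gamma>) / t" using E tp by (intro divide_right_mono) auto
        also have "\<dots> = K * t powr (- (2 * \<gamma>))" using tp by (simp add: powr_diff powr_minus field_simps)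
        finally show "E / t \<le> K * t powr (- (2 * \<gamma>))" .
      qed (use Cq(1) in auto)
      also have "\<dots> = (4 * K * (1 + Cq)) * (t powr (- \<gamma>) * P powr \<beta>)\<^sup>2"
      proof -
        have sq: "x powr (2 * y) = (x powr y)\<^sup>2" for x y :: real
          unfolding power2_eq_square powr_add[symmetric] by (rule arg_cong) (rule mult_2)
        have "t powr (- (2 * \<gamma>)) = (t powr (- \<gamma>))\<^sup>2"
          unfolding sq[symmetric] by simp
        then show ?thesis
          unfolding sq power_mult_distrib by (simp only: mult.assoc mult.commute mult.left_commute)
      qed
      finally have "sqrt (\<integral>\<omega>. (\<integral>s. Y A s \<omega> \<partial>U t)\<^sup>2 \<partial>M) \<le> sqrt ((4 * K * (1 + Cq)) * (t powr (- \<gamma>) * P powr \<beta>)\<^sup>2)"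
        by (rule real_sqrt_le_mono)
      also have "\<dots> = B * (t powr (- \<gamma>) * P powr \<beta>)"
        by (simp add: B_def real_sqrt_mult)
      finally have 2: "(\<integral>\<^sup>+\<omega>. ennreal \<bar>measure (occ_measure X t \<omega>) A - measure \<nu> A\<bar> \<partial>M) \<le> ennreal (B * (t powr (- \<gamma>) * P powr \<beta>))"
        by (intro order_trans[OF mean_deviation_le_sqrt[OF tp A]] ennreal_leI)
      have "P \<le> C0 * (P / 2)"
        using mult_right_mono[of 2 C0 "P / 2"] P0 by (simp add: C0_def)
      moreover have "B * (t powr (- \<gamma>) * P powr \<beta>) \<le> C0 * ((P / 2) powr \<beta> * t powr (- \<gamma>))"
      proof -
        have "P powr \<beta> = 2 powr \<beta> * (P / 2) powr \<beta>" using Pp by (simp add: powr_divide)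
        also have "\<dots> \<le> 2 powr 1 * (P / 2) powr \<beta>" using \<beta> by (intro mult_right_mono powr_mono) auto
        finally have "B * (t powr (- \<gamma>) * P powr \<beta>) \<le> B * (t powr (- \<gamma>) * (2 * (P / 2) powr \<beta>))"
          using B0 by (intro mult_left_mono) auto
        also have "\<dots> = (2 * B) * ((P / 2) powr \<beta> * t powr (- \<gamma>))" by simp
        also have "\<dots> \<le> C0 * ((P / 2) powr \<beta> * t powr (- \<gamma>))"
          by (intro mult_right_mono) (simp_all add: C0_def)
        finally show ?thesis .
      qed
      ultimately show ?thesis
        using order_trans[OF 1 ennreal_leI] order_trans[OF 2 ennreal_leI] unfolding P by (simp add: min_def)
    qed
  qed
  moreover have "C0 > 0" by (simp add: C0_def)
  ultimately show "property_A M (occ_measure X) \<nu> mean_half t0 (1 / 2 * (1 - 1 / q)) q \<gamma>"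
    unfolding property_A_def \<beta>_def[symmetric] using half(1) sup_fin by auto
qed

end

section \<open>Convergence rates for mixing processes\<close>

lemma d_minus_less_d_plus:
  assumes d: "1 \<le> d" shows "d_minus d < d_plus d"
proof -
  have "sqrt (d\<^sup>2 + 8 * d) \<le> sqrt ((d + 4)\<^sup>2)"
    by (rule real_sqrt_le_mono) (simp add: power2_eq_square algebra_simps)
  then have "sqrt (d\<^sup>2 + 8 * d) \<le> d + 4" using d by simp
  moreover have "sqrt ((d + 1)\<^sup>2) \<le> sqrt ((d + 1)\<^sup>2 + 4 * d)"
    using d by (intro real_sqrt_le_mono) simp
  then have "d + 1 \<le> sqrt ((d + 1)\<^sup>2 + 4 * d)" using d by simp
  ultimately show ?thesis using d by (simp add: d_minus_def d_plus_def)
qed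

text \<open>\<open>d_plus d\<close> is the positive root of \<open>q\<^sup>2 - (d + 1) q - d\<close>, which has the sign of
  \<open>(q - 1)/2 - d/2 (1 + 1/q)\<close>.\<close>

lemma d_plus_iff:
  assumes d: "0 < d" and q: "0 < q"
  shows "q < d_plus d \<longleftrightarrow> (q - 1) / 2 < d / 2 * (1 + 1 / q)"
    and "d_plus d < q \<longleftrightarrow> d / 2 * (1 + 1 / q) < (q - 1) / 2"
proof -
  define s where "s = sqrt ((d + 1)\<^sup>2 + 4 * d)"
  have s2: "s\<^sup>2 = (d + 1)\<^sup>2 + 4 * d" using d by (simp add: s_def)
  have s: "d + 1 \<le> s" unfolding s_def using d by (intro real_le_rsqrt) simp
  have fac: "4 * (q\<^sup>2 - (d + 1) * q - d) = (2 * q - (d + 1) - s) * (2 * q - (d + 1) + s)"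
    using s2 by (simp add: power2_eq_square algebra_simps)
  have pos: "0 < 2 * q - (d + 1) + s" using q s by linarith
  have a: "q < d_plus d \<longleftrightarrow> 2 * q - (d + 1) - s < 0" "d_plus d < q \<longleftrightarrow> 0 < 2 * q - (d + 1) - s"
    unfolding d_plus_def s_def[symmetric] by (auto simp: field_simps)
  have b: "2 * q - (d + 1) - s < 0 \<longleftrightarrow> q\<^sup>2 - (d + 1) * q - d < 0" "0 < 2 * q - (d + 1) - s \<longleftrightarrow> 0 < q\<^sup>2 - (d + 1) * q - d"
  proof -
    have four: "(x < 0) = (4 * x < 0)" "(0 < x) = (0 < 4 * x)" for x :: real by auto
    have m: "(q\<^sup>2 - (d + 1) * q - d < 0) = ((2 * q - (d + 1) - s) * (2 * q - (d + 1) + s) < 0)"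
      "(0 < q\<^sup>2 - (d + 1) * q - d) = (0 < (2 * q - (d + 1) - s) * (2 * q - (d + 1) + s))"
      unfolding fac[symmetric] by (rule four)+
    have "(x * y < 0) = (x < 0)" "(0 < x * y) = (0 < x)" if "0 < y" for x y :: real
      using that by (auto simp: mult_less_0_iff zero_less_mult_iff)
    from this[OF pos] show "2 * q - (d + 1) - s < 0 \<longleftrightarrow> q\<^sup>2 - (d + 1) * q - d < 0"
      "0 < 2 * q - (d + 1) - s \<longleftrightarrow> 0 < q\<^sup>2 - (d + 1) * q - d"
      unfolding m by metis+
  qed
  have c: "2 * q * ((q - 1) / 2 - d / 2 * (1 + 1 / q)) = q\<^sup>2 - (d + 1) * q - d"
    using q by (simp add: power2_eq_square field_simps)
  have e: "(q - 1) / 2 < d / 2 * (1 + 1 / q) \<longleftrightarrow> q\<^sup>2 - (d + 1) * q - d < 0" 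
    "d / 2 * (1 + 1 / q) < (q - 1) / 2 \<longleftrightarrow> 0 < q\<^sup>2 - (d + 1) * q - d"
    unfolding c[symmetric] using q by (auto simp: mult_less_0_iff zero_less_mult_iff)
  show "q < d_plus d \<longleftrightarrow> (q - 1) / 2 < d / 2 * (1 + 1 / q)"
    and "d_plus d < q \<longleftrightarrow> d / 2 * (1 + 1 / q) < (q - 1) / 2"
    using a b e by simp_all
qed

text \<open>The moment factor is a finite constant and is absorbed into \<open>K\<close>.\<close>

lemma Lp_norm_le_of_wasserstein_rate:
  assumes rate: "wasserstein_rate M N \<nu> \<pi> q p t0 r" and fin: "sup_moment \<pi> t0 q < \<top>"
    and p: "0 < p" and r: "\<And>t. t \<ge> t0 \<Longrightarrow> 0 \<le> r t"
  shows "\<exists>K>0. \<forall>t\<ge>t0. Lp_norm M p (\<lambda>\<omega>. wasserstein p (N t \<omega>) \<nu>) \<le> ennreal (K * r t powr (1 / p))"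
proof -
  obtain K where K: "K > 0" "\<And>t. t \<ge> t0 \<Longrightarrow> (\<integral>\<^sup>+\<omega>. ennreal_powr (wasserstein p (N t \<omega>) \<nu>) p \<partial>M)
          \<le> ennreal K * sup_moment \<pi> t0 q * ennreal (r t)"
    using rate unfolding wasserstein_rate_def by blast
  obtain m where m: "sup_moment \<pi> t0 q = ennreal m" "0 \<le> m" using fin by (cases "sup_moment \<pi> t0 q") auto
  have "1 \<le> sup_moment \<pi> t0 q" by (simp add: sup_moment_def)
  then have m1: "1 \<le> m" using m by simp
  have "Lp_norm M p (\<lambda>\<omega>. wasserstein p (N t \<omega>) \<nu>) \<le> ennreal ((K * m) powr (1 / p) * r t powr (1 / p))" if t: "t \<ge> t0" for t
  proof -
    have "(\<integral>\<^sup>+\<omega>. ennreal_powr (wasserstein p (N t \<omega>) \<nu>) p \<partial>M) \<le> ennreal (K * m * r t)"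
      using K(2)[OF t] K(1) m m1 r[OF t] by (simp add: ennreal_mult)
    then have "Lp_norm M p (\<lambda>\<omega>. wasserstein p (N t \<omega>) \<nu>) \<le> ennreal_powr (ennreal (K * m * r t)) (1 / p)"
      unfolding Lp_norm_def using p by (intro ennreal_powr_mono) auto
    also have "\<dots> = ennreal ((K * m) powr (1 / p) * r t powr (1 / p))"
      using K(1) m1 r[OF t] by (simp add: ennreal_powr_def powr_mult)
    finally show ?thesis .
  qed
  moreover have "0 < (K * m) powr (1 / p)" using K(1) m1 by simp
  ultimately show ?thesis by blast
qed

lemma powr_neg_le_slower:
  fixes t0 x y :: real
  assumes "0 < t0" "y \<le> x"
  shows "\<exists>K>0. \<forall>t\<ge>t0. t powr (- x) \<le> K * t powr (- y)"
proof (intro exI[of _ "t0 powr (y - x)"] conjI allI impI)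
  show "0 < t0 powr (y - x)" using assms by simp
  fix t assume t: "t0 \<le> t"
  have "t powr (- x) = t powr (y - x) * t powr (- y)"
    unfolding powr_add[symmetric] by simp
  also have "\<dots> \<le> t0 powr (y - x) * t powr (- y)"
    using assms t by (intro mult_right_mono powr_mono2') auto
  finally show "t powr (- x) \<le> t0 powr (y - x) * t powr (- y)" .
qed

context mixing_process begin

text \<open>The general rates at \<open>\<beta> = (1 - 1/q)/2\<close>, where \<open>1 - \<beta> = (q + 1)/(2 q)\<close> and \<open>\<beta> q = (q - 1)/2\<close>.\<close>

lemma wasserstein_rates:
  fixes p t0 :: real
  defines "d \<equiv> real DIM('a)"
  assumes p: "0 < p" "p < q" and t0: "0 < t0"
  shows "p < d / 2 * (1 + 1 / q) \<Longrightarrow> p < d * q / (d + q) \<Longrightarrow>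
      occ_rate p t0 (\<lambda>t. t powr (- (2 * \<gamma> * p * q / ((q + 1) * d))))"
    and "p < d / 2 * (1 + 1 / q) \<Longrightarrow> d * q / (d + q) < p \<Longrightarrow>
      occ_rate p t0 (\<lambda>t. t powr (- (2 * \<gamma> * (q - p) / (q + 1))))"
    and "p = d / 2 * (1 + 1 / q) \<Longrightarrow> q < d_plus d \<Longrightarrow>
      occ_rate p t0 (\<lambda>t. t powr (- (2 * \<gamma> * (q - p) / (q + 1))))"
    and "p = d / 2 * (1 + 1 / q) \<Longrightarrow> d_plus d < q \<Longrightarrow>
      occ_rate p t0 (\<lambda>t. t powr (- \<gamma>) * ln (1 + t))"
    and "d / 2 * (1 + 1 / q) < p \<Longrightarrow> p < (q - 1) / 2 \<Longrightarrow>
      occ_rate p t0 (\<lambda>t. t powr (- \<gamma>))"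
    and "d / 2 * (1 + 1 / q) < p \<Longrightarrow> (q - 1) / 2 < p \<Longrightarrow>
      occ_rate p t0 (\<lambda>t. t powr (- (2 * \<gamma> * (q - p) / (q + 1))))"
proof -
  define \<beta> where "\<beta> = 1 / 2 * (1 - 1 / q)"
  have \<beta>: "0 < \<beta>" "\<beta> < 1" using q by (simp_all add: \<beta>_def field_simps)
  have d: "0 < d" by (simp add: d_def)
  have q0: "0 < q" using q by simp
  have N: "occ_measure X t \<in> M \<rightarrow>\<^sub>M prob_algebra borel" if "t0 \<le> t" for t
    using that t0 by (intro occ_measure_prob_algebra) simp
  have mom: "abs_moment \<nu> p < \<top>"
    using abs_moment_finite_mono[OF \<nu> p(1) less_imp_le[OF p(2)]] moment_\<nu>_le X_moment_finite by (auto intro: le_less_trans)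
  have A: "property_A M (occ_measure X) \<nu> mean_half t0 \<beta> q \<gamma>"
    unfolding \<beta>_def by (rule property_A_occ_measure(1)[OF t0])
  note rates = wasserstein_rates_of_property_A[OF p \<beta> t0 \<gamma> N \<nu> mom A, folded d_def]
  have thr: "d * (1 - \<beta>) = d / 2 * (1 + 1 / q)" "\<beta> * q = (q - 1) / 2"
    using q by (simp_all add: \<beta>_def field_simps)
  have q\<beta>: "q * (1 - \<beta>) = (q + 1) / 2" using thr(2) by (simp add: algebra_simps)
  have slow: "\<gamma> * ((q - p) / (q * (1 - \<beta>))) = 2 * \<gamma> * (q - p) / (q + 1)"
    unfolding q\<beta> using q by (simp add: field_simps)
  have fast: "\<gamma> * (p / (d * (1 - \<beta>))) = 2 * \<gamma> * p * q / ((q + 1) * d)"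
  proof -
    have "d * (1 - \<beta>) = (q + 1) * d / (2 * q)" unfolding thr(1) using q by (simp add: field_simps)
    then show ?thesis using q by simp
  qed
  note r = rates[unfolded slow fast, unfolded thr]
  show "p < d / 2 * (1 + 1 / q) \<Longrightarrow> p < d * q / (d + q) \<Longrightarrow>
      occ_rate p t0 (\<lambda>t. t powr (- (2 * \<gamma> * p * q / ((q + 1) * d))))"
    by (rule r(1))
  show "p < d / 2 * (1 + 1 / q) \<Longrightarrow> d * q / (d + q) < p \<Longrightarrow>
      occ_rate p t0 (\<lambda>t. t powr (- (2 * \<gamma> * (q - p) / (q + 1))))"
    by (rule r(2))
  show "occ_rate p t0 (\<lambda>t. t powr (- (2 * \<gamma> * (q - p) / (q + 1))))"
    if "p = d / 2 * (1 + 1 / q)" "q < d_plus d"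
    by (rule r(3)[OF _ that(1) iffD1[OF d_plus_iff(1)[OF d q0] that(2), folded that(1)]])
  show "occ_rate p t0 (\<lambda>t. t powr (- \<gamma>) * ln (1 + t))"
    if "p = d / 2 * (1 + 1 / q)" "d_plus d < q"
    by (rule r(4)[OF _ that(1) iffD1[OF d_plus_iff(2)[OF d q0] that(2), folded that(1)]])
  show "d / 2 * (1 + 1 / q) < p \<Longrightarrow> p < (q - 1) / 2 \<Longrightarrow>
      occ_rate p t0 (\<lambda>t. t powr (- \<gamma>))"
    by (rule r(5))
  show "d / 2 * (1 + 1 / q) < p \<Longrightarrow> (q - 1) / 2 < p \<Longrightarrow>
      occ_rate p t0 (\<lambda>t. t powr (- (2 * \<gamma> * (q - p) / (q + 1))))"
    by (rule r(6))
qed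

text \<open>For \<open>q > d\<close> the range \<open>p \<le> d/2\<close> lies in the first regime; its exponent carries the factor
  \<open>q/(q + 1)\<close>, which exceeds \<open>1 - \<epsilon>\<close> once \<open>q > 1/\<epsilon>\<close>.\<close>

lemma wasserstein_Lp_rate_small:
  assumes p: "0 < p" "p \<le> real DIM('a) / 2" and t0: "0 < t0" and \<epsilon>: "0 < \<epsilon>"
    and big: "q > 1 / \<epsilon>" "q > real DIM('a)"
  shows "\<exists>K>0. \<forall>t\<ge>t0. Lp_norm M p (\<lambda>\<omega>. wasserstein p (occ_measure X t \<omega>) \<nu>)
    \<le> ennreal (K * t powr (- (2 * \<gamma> / real DIM('a) * (1 - \<epsilon>))))"
proof -
  define d where "d = real DIM('a)"
  have d: "0 < d" by (simp add: d_def)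
  have pq: "p < q" using p big d_def d by simp
  have "d / 2 < d / 2 * (1 + 1 / q)" using d q by (simp add: field_simps)
  then have c1: "p < d / 2 * (1 + 1 / q)" using p(2) unfolding d_def by linarith
  have "p * (d + q) < d * q"
  proof -
    have "p * d \<le> (d - p) * d" using p d by (intro mult_right_mono) (auto simp: d_def)
    also have "\<dots> < (d - p) * q" using p big d by (intro mult_strict_left_mono) (auto simp: d_def)
    finally show ?thesis by (simp add: algebra_simps)
  qed
  then have c2: "p < d * q / (d + q)" using d q by (simp add: field_simps)
  have fin: "sup_moment mean_half t0 q < \<top>"
    using property_A_occ_measure(1)[OF t0] by (simp add: property_A_def)
  obtain K where K: "K > 0" "\<And>t. t \<ge> t0 \<Longrightarrow> Lp_norm M p (\<lambda>\<omega>. wasserstein p (occ_measure X t \<omega>) \<nu>)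
      \<le> ennreal (K * (t powr (- (2 * \<gamma> * p * q / ((q + 1) * d)))) powr (1 / p))"
    using Lp_norm_le_of_wasserstein_rate[OF wasserstein_rates(1)[OF p(1) pq t0, folded d_def, OF c1 c2] fin p(1)] by auto
  have "2 * \<gamma> / d * (1 - \<epsilon>) \<le> 2 * \<gamma> / d * (q / (q + 1))"
  proof (rule mult_left_mono)
    have "1 < \<epsilon> * q" using big \<epsilon> by (simp add: field_simps)
    then have "(1 - \<epsilon>) * (q + 1) \<le> q" using \<epsilon> by (simp add: algebra_simps)
    then show "1 - \<epsilon> \<le> q / (q + 1)" using q by (simp add: field_simps)
  qed (use \<gamma> d in simp)
  from powr_neg_le_slower[OF t0 this] obtain K' where K': "K' > 0"
    "\<And>t. t \<ge> t0 \<Longrightarrow> t powr (- (2 * \<gamma> / d * (q / (q + 1)))) \<le> K' * t powr (- (2 * \<gamma> / d * (1 - \<epsilon>)))" by blast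
  have "Lp_norm M p (\<lambda>\<omega>. wasserstein p (occ_measure X t \<omega>) \<nu>) \<le> ennreal (K * K' * t powr (- (2 * \<gamma> / d * (1 - \<epsilon>))))"
    if t: "t \<ge> t0" for t
  proof -
    have "(t powr (- (2 * \<gamma> * p * q / ((q + 1) * d)))) powr (1 / p) = t powr (- (2 * \<gamma> / d * (q / (q + 1))))"
      using p by (simp add: powr_powr mult_ac)
    also have "K * \<dots> \<le> K * (K' * t powr (- (2 * \<gamma> / d * (1 - \<epsilon>))))"
      using K K'(2)[OF t] by (intro mult_left_mono) auto
    finally show ?thesis
      by (intro order_trans[OF K(2)[OF t]] ennreal_leI) (simp add: mult.assoc)
  qed
  then show ?thesis using K(1) K'(1) unfolding d_def by (intro exI[of _ "K * K'"]) auto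
qed

text \<open>As \<open>q\<close> grows, \<open>d/2 (1 + 1/q)\<close> falls below \<open>p\<close> and \<open>(q - 1)/2\<close> rises above \<open>p\<close>, which is the regime of
  rate \<open>t\<^bsup>-\<gamma>\<^esup>\<close>.\<close>

lemma wasserstein_Lp_rate_large:
  assumes p: "real DIM('a) / 2 < p" and t0: "0 < t0"
    and big: "q > 2 * p + 1" "q > real DIM('a) / (2 * p - real DIM('a))"
  shows "\<exists>K>0. \<forall>t\<ge>t0. Lp_norm M p (\<lambda>\<omega>. wasserstein p (occ_measure X t \<omega>) \<nu>) \<le> ennreal (K * t powr (- (\<gamma> / p)))"
proof -
  define d where "d = real DIM('a)"
  have d: "0 < d" by (simp add: d_def)
  have p0: "0 < p" "p < q" using p d big by (auto simp: d_def)
  have "d < q * (2 * p - d)" using big p by (simp add: d_def field_simps)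
  then have c1: "d / 2 * (1 + 1 / q) < p" using q by (simp add: field_simps)
  have c2: "p < (q - 1) / 2" using big by simp
  have fin: "sup_moment mean_half t0 q < \<top>"
    using property_A_occ_measure(1)[OF t0] by (simp add: property_A_def)
  have "\<exists>K>0. \<forall>t\<ge>t0. Lp_norm M p (\<lambda>\<omega>. wasserstein p (occ_measure X t \<omega>) \<nu>) \<le> ennreal (K * (t powr (- \<gamma>)) powr (1 / p))"
    by (rule Lp_norm_le_of_wasserstein_rate[OF wasserstein_rates(5)[OF p0 t0, folded d_def, OF c1 c2] fin p0(1)]) simp
  then show ?thesis by (simp add: powr_powr)
qed

end

theorem theorem2p5:
  fixes M :: "'w measure"
    and F :: "real \<Rightarrow> 'w measure"
    and X :: "real \<Rightarrow> 'w \<Rightarrow> 'a::euclidean_space"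
    and \<nu> :: "'a measure"
    and \<kappa> :: "real \<Rightarrow> real \<Rightarrow> 'w \<Rightarrow> 'a measure"
    and \<Upsilon> :: "real \<Rightarrow> real \<Rightarrow> 'w \<Rightarrow> real"
    and e :: "real \<Rightarrow> real"
    and q \<gamma> d :: real
    and \<pi> :: "real \<Rightarrow> 'a measure"
  defines "d \<equiv> real DIM('a)"
    and "\<pi> \<equiv> (\<lambda>t. half_sum (mean_occ_measure M X t) \<nu>)"
  assumes basis: "stochastic_basis M F"
    and process: "adapted_right_cont M F X"
    and q: "1 < q"
    and \<gamma>: "0 < \<gamma>" "\<gamma> \<le> 1 / 2"
    and \<nu>: "prob_space \<nu>" "sets \<nu> = sets borel"
    and e_meas: "e \<in> borel_measurable (restrict_space borel {0..})"
    and e_nonneg: "\<forall>u\<ge>0. 0 \<le> e u"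
    and e_bounded: "bounded (e ` {0..})"
    and \<Upsilon>_meas: "\<forall>s\<ge>0. (\<lambda>(t, \<omega>). \<Upsilon> t s \<omega>) \<in> borel_measurable (restrict_space borel {s..} \<Otimes>\<^sub>M F s)"
    and \<Upsilon>_nonneg: "\<forall>s\<ge>0. \<forall>t\<ge>s. \<forall>\<omega>\<in>space M. 0 \<le> \<Upsilon> t s \<omega>"
    and cond_law: "\<forall>s\<ge>0. \<forall>t\<ge>s. regular_cond_distr M (F s) (X t) (\<kappa> t s)"
    and i: "\<forall>s\<ge>0. \<forall>t\<ge>s. AE \<omega> in M. tv_dist (\<kappa> t s \<omega>) \<nu> \<le> \<Upsilon> t s \<omega> * e (t - s)"
    and ii: "(\<lambda>t. LINT s:{0..t}|lborel. e s) \<in> O[at_top](\<lambda>t. t powr (1 - 2 * \<gamma>))"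
    and iii: "C_const M X \<Upsilon> q < \<top>"
  shows "abs_moment \<nu> q < \<top> \<and>
    (\<forall>t0>0. property_A M (occ_measure X) \<nu> \<pi> t0 (1 / 2 * (1 - 1 / q)) q \<gamma> \<and>
            sup_moment \<pi> t0 q \<le> max 1 (SUP t\<in>{0..}. \<integral>\<^sup>+\<omega>. ennreal (norm (X t \<omega>) powr q) \<partial>M)) \<and>
    d_minus d < d_plus d \<and>
    (\<forall>p t0. 0 < p \<and> p < q \<and> 0 < t0 \<longrightarrow>
      (p < d / 2 * (1 + 1 / q) \<longrightarrow>
        (p < d * q / (d + q) \<longrightarrow>
          wasserstein_rate M (occ_measure X) \<nu> \<pi> q p t0 (\<lambda>t. t powr (- (2 * \<gamma> * p * q / ((q + 1) * d))))) \<and>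
        (d * q / (d + q) < p \<longrightarrow>
          wasserstein_rate M (occ_measure X) \<nu> \<pi> q p t0 (\<lambda>t. t powr (- (2 * \<gamma> * (q - p) / (q + 1)))))) \<and>
      (p = d / 2 * (1 + 1 / q) \<longrightarrow>
        (d_minus d < q \<and> q < d_plus d \<longrightarrow>
          wasserstein_rate M (occ_measure X) \<nu> \<pi> q p t0 (\<lambda>t. t powr (- (2 * \<gamma> * (q - p) / (q + 1))))) \<and>
        (d_plus d < q \<longrightarrow>
          wasserstein_rate M (occ_measure X) \<nu> \<pi> q p t0 (\<lambda>t. t powr (- \<gamma>) * ln (1 + t)))) \<and>
      (d / 2 * (1 + 1 / q) < p \<longrightarrow>
        (p < (q - 1) / 2 \<longrightarrow>
          wasserstein_rate M (occ_measure X) \<nu> \<pi> q p t0 (\<lambda>t. t powr (- \<gamma>))) \<and>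
        ((q - 1) / 2 < p \<longrightarrow>
          wasserstein_rate M (occ_measure X) \<nu> \<pi> q p t0 (\<lambda>t. t powr (- (2 * \<gamma> * (q - p) / (q + 1))))))) \<and>
    ((\<forall>q'>0. C_const M X \<Upsilon> q' < \<top>) \<longrightarrow>
      (\<forall>p \<epsilon> t0. 0 < p \<and> 0 < \<epsilon> \<and> 0 < t0 \<longrightarrow>
        (\<exists>K>0. \<forall>t\<ge>t0.
          Lp_norm M p (\<lambda>\<omega>. wasserstein p (occ_measure X t \<omega>) \<nu>)
            \<le> ennreal (K * (if p \<le> d / 2 then t powr (- (2 * \<gamma> / d * (1 - \<epsilon>)))
                            else t powr (- (\<gamma> / p)))))))"
proof -
  have mix: "mixing_process M F X \<nu> \<kappa> \<Upsilon> e q' \<gamma>" if "1 < q'" "C_const M X \<Upsilon> q' < \<top>" for q'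
    by (intro mixing_process.intro mixing_process_axioms.intro)
       (fact basis process \<gamma> \<nu> e_meas e_nonneg e_bounded \<Upsilon>_meas \<Upsilon>_nonneg cond_law i ii that)+
  interpret mixing_process M F X \<nu> \<kappa> \<Upsilon> e q \<gamma>
    by (rule mix[OF q iii])
  have d: "1 \<le> d" by (simp add: d_def Suc_leI)
  have moment: "abs_moment \<nu> q < \<top>"
    using moment_\<nu>_le X_moment_finite by (rule le_less_trans)
  note rates = wasserstein_rates[folded d_def \<pi>_def]
  have Lp: "\<exists>K>0. \<forall>t\<ge>t0. Lp_norm M p (\<lambda>\<omega>. wasserstein p (occ_measure X t \<omega>) \<nu>)
      \<le> ennreal (K * (if p \<le> d / 2 then t powr (- (2 * \<gamma> / d * (1 - \<epsilon>))) else t powr (- (\<gamma> / p))))"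
    if all: "\<forall>q'>0. C_const M X \<Upsilon> q' < \<top>" and p: "0 < p" and \<epsilon>: "0 < \<epsilon>" and t0: "0 < t0" for p \<epsilon> t0
  proof (cases "p \<le> d / 2")
    case True
    \<comment> \<open>Large enough for both requirements of the rate for small \<open>p\<close>.\<close>
    define q' where "q' = 1 / \<epsilon> + d + 1"
    have q': "1 < q'" "1 / \<epsilon> < q'" "d < q'" using d \<epsilon> by (simp_all add: q'_def add_pos_pos)
    interpret Q: mixing_process M F X \<nu> \<kappa> \<Upsilon> e q' \<gamma>
      using q' all by (intro mix) auto
    show ?thesis
      using Q.wasserstein_Lp_rate_small[OF p _ t0 \<epsilon>] True q' by (simp add: d_def)
  next
    case False
    \<comment> \<open>Large enough for both requirements of the rate for large \<open>p\<close>.\<close>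
    define q' where "q' = 2 * p + 2 + d / (2 * p - d)"
    have "0 < d / (2 * p - d)" using False d by (intro divide_pos_pos) auto
    then have q': "1 < q'" "2 * p + 1 < q'" "d / (2 * p - d) < q'" using p by (simp_all add: q'_def)
    interpret Q: mixing_process M F X \<nu> \<kappa> \<Upsilon> e q' \<gamma>
      using q' all by (intro mix) auto
    show ?thesis
      using Q.wasserstein_Lp_rate_large[OF _ t0] False q' by (simp add: d_def)
  qed
  show ?thesis
  proof (intro conjI allI impI; (elim conjE)?)
    show "abs_moment \<nu> q < \<top>" by (fact moment)
    show "d_minus d < d_plus d" by (rule d_minus_less_d_plus[OF d])
    fix t0 :: real assume "0 < t0"
    then show "property_A M (occ_measure X) \<nu> \<pi> t0 (1 / 2 * (1 - 1 / q)) q \<gamma>"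
      and "sup_moment \<pi> t0 q \<le> max 1 (SUP t\<in>{0..}. \<integral>\<^sup>+\<omega>. ennreal (norm (X t \<omega>) powr q) \<partial>M)"
      unfolding \<pi>_def X_moment_def[symmetric] by (fact property_A_occ_measure)+
  qed (rule rates Lp; assumption)+
qed

end
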